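(* Let $d_1,d_2\in\mathbb{N}$ and let $\Phi\in\mathrm{UCP}(d_1,d_2)$, i.e. $\Phi:\mathbb{M}_{d_1}\to\mathbb{M}_{d_2}$ is a unital completely positive map. If $\Phi$ is a $C^*$-extreme point of $\mathrm{UCP}(d_1,d_2)$, then $\Phi$ is degradable.
   Context: $\mathbb{M}_d$ is the algebra of complex $d\times d$ matrices and $\mathrm{Ad}_V(X)=V^*XV$. $\mathrm{UCP}(d_1,d_2)$ is the set of unital completely positive (CP) maps $\mathbb{M}_{d_1}\to\mathbb{M}_{d_2}$. $\Phi\in\mathrm{UCP}(d_1,d_2)$ is a $C^*$-extreme point of $\mathrm{UCP}(d_1,d_2)$ if whenever $\Phi=\sum_{i=1}^n\mathrm{Ad}_{T_i}\circ\Phi_i$ with $T_i\in\mathbb{M}_{d_2}$ invertible, $\sum_{i=1}^nT_i^*T_i=I_{d_2}$ and $\Phi_i\in\mathrm{UCP}(d_1,d_2)$, there exist unitaries $U_i\in\mathbb{M}_{d_2}$ such that $\Phi_i=\mathrm{Ad}_{U_i}\circ\Phi$ for all $i$. A CP map $\Psi:\mathbb{M}_{d_1}\to\mathbb{M}_{d_3}$ is complementary to a CP map $\Phi:\mathbb{M}_{d_1}\to\mathbb{M}_{d_2}$ if there is a linear $A:\mathbb{C}^{d_1}\to\mathbb{C}^{d_2}\otimes\mathbb{C}^{d_3}$ with $\Phi(X)=(\mathrm{id}\otimes\operatorname{tr})(AXA^* )$ and $\Psi(X)=(\operatorname{tr}\otimes\mathrm{id})(AXA^* )$ for all $X\in\mathbb{M}_{d_1}$.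 $\Phi$ is degradable if there is a CP map $\Gamma:\mathbb{M}_{d_2}\to\mathbb{M}_{d_3}$ (some $d_3$) such that $\Gamma\circ\Phi$ is complementary to $\Phi$. *)

theory Defs
  imports "Jordan_Normal_Form.Schur_Decomposition"
begin

text \<open>A map \<open>M_{d1} \<rightarrow> M_{d2}\<close> is a function on the type of all complex matrices of which only
  the values on \<^term>\<open>carrier_mat d1 d1\<close> matter; equality of two such maps is always equality on
  that carrier.\<close>

definition linear_mat_map :: "nat \<Rightarrow> nat \<Rightarrow> (complex mat \<Rightarrow> complex mat) \<Rightarrow> bool" where
  "linear_mat_map d1 d2 \<Phi> \<longleftrightarrow>
     (\<forall>X \<in> carrier_mat d1 d1. \<Phi> X \<in> carrier_mat d2 d2) \<and>
     (\<forall>X \<in> carrier_mat d1 d1. \<forall>Y \<in> carrier_mat d1 d1. \<Phi> (X + Y) = \<Phi> X + \<Phi> Y) \<and>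
     (\<forall>c. \<forall>X \<in> carrier_mat d1 d1. \<Phi> (c \<cdot>\<^sub>m X) = c \<cdot>\<^sub>m \<Phi> X)"

text \<open>The order on \<^typ>\<open>complex\<close> is the partial one: \<open>0 \<le> z\<close> says that \<open>z\<close> is real and
  nonnegative, so a positive semidefinite matrix is automatically Hermitian.\<close>

definition psd :: "nat \<Rightarrow> complex mat \<Rightarrow> bool" where
  "psd n A \<longleftrightarrow> A \<in> carrier_mat n n \<and> (\<forall>v \<in> carrier_vec n. 0 \<le> (A *\<^sub>v v) \<bullet>c v)"

definition unitary_mat :: "nat \<Rightarrow> complex mat \<Rightarrow> bool" where
  "unitary_mat n U \<longleftrightarrow>
     U \<in> carrier_mat n n \<and> mat_adjoint U * U = 1\<^sub>m n \<and> U * mat_adjoint U = 1\<^sub>m n"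

text \<open>Throughout, \<open>\<complex>\<^sup>m \<otimes> \<complex>\<^sup>n\<close> is identified with \<open>\<complex>\<^bsup>mn\<^esup>\<close> by sending \<open>e_i \<otimes> f_j\<close> to the
  basis vector with index \<open>i * n + j\<close>, indices starting at 0. Accordingly an element of
  \<open>M_k(M_d)\<close> is a \<open>kd \<times> kd\<close> matrix whose \<open>(i, j)\<close> entry is its \<open>(i, j)\<close> block of
  size \<open>d \<times> d\<close>.\<close>

definition mat_block :: "nat \<Rightarrow> complex mat \<Rightarrow> nat \<Rightarrow> nat \<Rightarrow> complex mat" where
  "mat_block d X i j = mat d d (\<lambda>(a, b). X $$ (i * d + a, j * d + b))"

text \<open>The ampliation \<open>id_k \<otimes> \<Phi> : M_k(M_{d1}) \<rightarrow> M_k(M_{d2})\<close>, applying \<open>\<Phi>\<close> to every block.\<close>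

definition ampliation ::
    "nat \<Rightarrow> nat \<Rightarrow> nat \<Rightarrow> (complex mat \<Rightarrow> complex mat) \<Rightarrow> complex mat \<Rightarrow> complex mat" where
  "ampliation k d1 d2 \<Phi> X = mat (k * d2) (k * d2)
     (\<lambda>(p, q). \<Phi> (mat_block d1 X (p div d2) (q div d2)) $$ (p mod d2, q mod d2))"

definition cp_map :: "nat \<Rightarrow> nat \<Rightarrow> (complex mat \<Rightarrow> complex mat) \<Rightarrow> bool" where
  "cp_map d1 d2 \<Phi> \<longleftrightarrow> linear_mat_map d1 d2 \<Phi> \<and>
     (\<forall>k X. psd (k * d1) X \<longrightarrow> psd (k * d2) (ampliation k d1 d2 \<Phi> X))"

definition UCP :: "nat \<Rightarrow> nat \<Rightarrow> (complex mat \<Rightarrow> complex mat) set" where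
  "UCP d1 d2 = {\<Phi>. cp_map d1 d2 \<Phi> \<and> \<Phi> (1\<^sub>m d1) = 1\<^sub>m d2}"

definition Ad :: "complex mat \<Rightarrow> complex mat \<Rightarrow> complex mat" where
  "Ad V X = mat_adjoint V * X * V"

abbreviation mat_fsum :: "nat \<Rightarrow> (nat \<Rightarrow> complex mat) \<Rightarrow> nat \<Rightarrow> complex mat" where
  "mat_fsum d F n \<equiv> finsum (module_mat TYPE(complex) d d) F {..<n}"

definition Cstar_extreme :: "nat \<Rightarrow> nat \<Rightarrow> (complex mat \<Rightarrow> complex mat) \<Rightarrow> bool" where
  "Cstar_extreme d1 d2 \<Phi> \<longleftrightarrow> \<Phi> \<in> UCP d1 d2 \<and>
     (\<forall>(n::nat) (T :: nat \<Rightarrow> complex mat) (\<Psi> :: nat \<Rightarrow> complex mat \<Rightarrow> complex mat).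
        (\<forall>i<n. T i \<in> carrier_mat d2 d2 \<and> invertible_mat (T i)) \<longrightarrow>
        mat_fsum d2 (\<lambda>i. mat_adjoint (T i) * T i) n = 1\<^sub>m d2 \<longrightarrow>
        (\<forall>i<n. \<Psi> i \<in> UCP d1 d2) \<longrightarrow>
        (\<forall>X \<in> carrier_mat d1 d1. \<Phi> X = mat_fsum d2 (\<lambda>i. Ad (T i) (\<Psi> i X)) n) \<longrightarrow>
        (\<exists>U :: nat \<Rightarrow> complex mat. \<forall>i<n. unitary_mat d2 (U i) \<and>
           (\<forall>X \<in> carrier_mat d1 d1. \<Psi> i X = Ad (U i) (\<Phi> X))))"

text \<open>The partial traces \<open>id \<otimes> tr\<close> and \<open>tr \<otimes> id\<close> on matrices over \<open>\<complex>\<^sup>m \<otimes> \<complex>\<^sup>n\<close>.\<close>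

definition id_tensor_tr :: "nat \<Rightarrow> nat \<Rightarrow> complex mat \<Rightarrow> complex mat" where
  "id_tensor_tr m n Y = mat m m (\<lambda>(i, j). \<Sum>k<n. Y $$ (i * n + k, j * n + k))"

definition tr_tensor_id :: "nat \<Rightarrow> nat \<Rightarrow> complex mat \<Rightarrow> complex mat" where
  "tr_tensor_id m n Y = mat n n (\<lambda>(k, l). \<Sum>i<m. Y $$ (i * n + k, i * n + l))"

definition complementary ::
    "nat \<Rightarrow> nat \<Rightarrow> nat \<Rightarrow> (complex mat \<Rightarrow> complex mat) \<Rightarrow> (complex mat \<Rightarrow> complex mat) \<Rightarrow> bool" where
  "complementary d1 d2 d3 \<Psi> \<Phi> \<longleftrightarrow> cp_map d1 d3 \<Psi> \<and> cp_map d1 d2 \<Phi> \<and>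
     (\<exists>A \<in> carrier_mat (d2 * d3) d1. \<forall>X \<in> carrier_mat d1 d1.
        \<Phi> X = id_tensor_tr d2 d3 (A * X * mat_adjoint A) \<and>
        \<Psi> X = tr_tensor_id d2 d3 (A * X * mat_adjoint A))"

definition degradable :: "nat \<Rightarrow> nat \<Rightarrow> (complex mat \<Rightarrow> complex mat) \<Rightarrow> bool" where
  "degradable d1 d2 \<Phi> \<longleftrightarrow>
     (\<exists>d3 \<Gamma>. cp_map d2 d3 \<Gamma> \<and> complementary d1 d2 d3 (\<Gamma> \<circ> \<Phi>) \<Phi>)"

end

theory Submission
  imports Defs "HOL-Analysis.L2_Norm"
begin

text \<open>
  The proof has an analytic half, which shows that the Kraus operators of a \<open>C\<^sup>*\<close>-extreme \<open>\<Phi>\<close>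
  can be chosen with pairwise orthogonal ranges, and a short half, which reads off degradability
  from such operators (\<open>orthogonal_kraus_degradable\<close>).

  For the first half write \<open>\<Phi>(X) = \<Sum>\<^sub>k K\<^sub>k X K\<^sub>k\<^sup>*\<close> with linearly independent \<open>K\<^sub>1, \<dots>, K\<^sub>r\<close> and let \<open>\<A>\<close> be the
  algebra of those \<open>r \<times> r\<close> matrices by which left multiplication with some matrix \<open>S\<close> acts on the
  span of the \<open>K\<^sub>k\<close>.  For a weight \<open>0 < D < 1\<close> the sums \<open>\<Sum> D\<^sub>k\<^sub>l K\<^sub>k X K\<^sub>l\<^sup>*\<close> and \<open>\<Sum> (1 - D)\<^sub>k\<^sub>l K\<^sub>k X K\<^sub>l\<^sup>*\<close>,
  made unital, exhibit \<open>\<Phi>\<close> as a \<open>C\<^sup>*\<close>-convex combination.  Extremality makes the first of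
  them a unitary conjugate of \<open>\<Phi>\<close>, and comparing Kraus operators turns this into a factorisation
  \<open>D = B\<^sup>* B\<close> with \<open>B \<in> \<A>\<close> (\<open>Cstar_extreme_gram_complete\<close>).  So every invertible matrix is a unitary
  times an element of \<open>\<A>\<close>.

  This forces \<open>\<A>\<close> to contain the diagonal matrices of some orthonormal basis
  (\<open>diagonal_projections_in_algebra\<close>): the unitary group then acts transitively on the invertible
  matrices modulo those of \<open>\<A>\<close>, a compact homogeneous space, so that \<open>\<A>\<close> ought to be a block
  triangular algebra.  The argument below is elementary.  Take a vector \<open>e\<close> whose orbit \<open>\<A> e\<close> is
  minimal.  For a unit vector \<open>z\<close> in it, factorise \<open>z z\<^sup>* + \<epsilon>\<close> and let \<open>\<epsilon>\<close> tend to \<open>0\<close>; the limit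
  is some \<open>y z\<^sup>* \<in> \<A>\<close>, and minimality improves it to \<open>z z\<^sup>* \<in> \<A>\<close>.  Hence \<open>\<A>\<close> contains \<open>e e\<^sup>*\<close> and all
  the unitaries that rotate the orbit, with which the factorisation property passes to the commutant of
  \<open>e e\<^sup>*\<close> in \<open>\<A>\<close>.  Now repeat in the orthogonal complement of \<open>e\<close>.

  Finally, a projection \<open>f f\<^sup>* \<in> \<A>\<close> is implemented by a left multiplication that maps the Kraus
  operators to multiples of one combination \<open>K'\<close> and annihilates the combinations orthogonal to it.
  Since \<open>\<Phi>\<close> is unital, this multiplication is by \<open>K' K'\<^sup>*\<close>, and the ranges are orthogonal.
\<close>

section \<open>Matrix calculus with conditions on dimensions\<close>

abbreviation adj :: "complex mat \<Rightarrow> complex mat" where "adj \<equiv> mat_adjoint"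

lemma adj_dim [simp]: "dim_row (adj A) = dim_col A" "dim_col (adj A) = dim_row A"
  by (simp_all add: mat_adjoint_def)

lemma adj_carrier [simp]: "adj A \<in> carrier_mat n m \<longleftrightarrow> A \<in> carrier_mat m n"
  by (metis adj_dim carrier_matD carrier_matI)

lemma adj_index [simp]:
  assumes "i < dim_col A" "j < dim_row A"
  shows "adj A $$ (i, j) = cnj (A $$ (j, i))"
  using assms by (simp add: mat_adjoint_def mat_of_rows_index)

lemma mult_index:
  assumes "i < dim_row A" "j < dim_col B" "dim_col A = dim_row B"
  shows "(A * B) $$ (i, j) = (\<Sum>k<dim_row B. A $$ (i, k) * B $$ (k, j))"
  using assms by (simp add: scalar_prod_def atLeast0LessThan)

text \<open>Products are kept symbolic by default, and entries are expanded only on demand.\<close>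

declare index_mult_mat(1) [simp del]
declare assoc_mult_mat [simp del] assoc_add_mat [simp del]

lemma mult_assoc_dim:
  assumes "dim_col A = dim_row B" "dim_col B = dim_row C"
  shows "A * B * C = A * (B * C :: complex mat)"
  using assms by (intro assoc_mult_mat[of A "dim_row A" "dim_row B" B "dim_row C" C "dim_col C"]) auto

lemma add_mult_dim:
  assumes "dim_row A = dim_row B" "dim_col A = dim_col B" "dim_col A = dim_row C"
  shows "(A + B) * C = A * C + B * (C :: complex mat)"
  using assms by (intro add_mult_distrib_mat[of A "dim_row A" "dim_row C" B C "dim_col C"]) auto

lemma mult_add_dim:
  assumes "dim_row B = dim_row C" "dim_col B = dim_col C" "dim_col A = dim_row C"
  shows "A * (B + C) = A * B + A * (C :: complex mat)"
  using assms by (intro mult_add_distrib_mat[of A "dim_row A" "dim_row C" B "dim_col C" C]) auto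

lemma minus_mult_dim:
  assumes "dim_row A = dim_row B" "dim_col A = dim_col B" "dim_col A = dim_row C"
  shows "(A - B) * C = A * C - B * (C :: complex mat)"
  using assms by (intro minus_mult_distrib_mat[of A "dim_row A" "dim_row C" B C "dim_col C"]) auto

lemma mult_minus_dim:
  assumes "dim_row B = dim_row C" "dim_col B = dim_col C" "dim_col A = dim_row C"
  shows "A * (B - C) = A * B - A * (C :: complex mat)"
  using assms by (intro mult_minus_distrib_mat[of A "dim_row A" "dim_row C" B "dim_col C" C]) auto

lemma smult_mult_dim:
  "dim_col A = dim_row B \<Longrightarrow> (c \<cdot>\<^sub>m A) * B = c \<cdot>\<^sub>m (A * (B :: complex mat))"
  by (intro mult_smult_assoc_mat[of A "dim_row A" "dim_row B" B "dim_col B"]) auto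

lemma mult_smult_dim:
  "dim_col A = dim_row B \<Longrightarrow> A * (c \<cdot>\<^sub>m B) = c \<cdot>\<^sub>m (A * (B :: complex mat))"
  by (intro mult_smult_distrib[of A "dim_row A" "dim_row B" B "dim_col B"]) auto

lemma smult_smult_mat: "a \<cdot>\<^sub>m (b \<cdot>\<^sub>m A) = (a * b) \<cdot>\<^sub>m (A :: complex mat)"
  by (rule eq_matI) auto

lemma one_smult_mat: "1 \<cdot>\<^sub>m A = (A :: complex mat)"
  by (rule eq_matI) auto

lemma adj_adj [simp]: "adj (adj A) = A"
  by (rule eq_matI) auto

lemma adj_mult:
  assumes "dim_col A = dim_row B"
  shows "adj (A * B) = adj B * adj A"
  using assms by (intro eq_matI) (auto simp: mult_index mult.commute)

lemma adj_one [simp]: "adj (1\<^sub>m n) = 1\<^sub>m n"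
  by (rule eq_matI) auto

lemma adj_add: "dim_row A = dim_row B \<Longrightarrow> dim_col A = dim_col B \<Longrightarrow> adj (A + B) = adj A + adj B"
  by (rule eq_matI) auto

lemma adj_minus: "dim_row A = dim_row B \<Longrightarrow> dim_col A = dim_col B \<Longrightarrow> adj (A - B) = adj A - adj B"
  by (rule eq_matI) auto

lemma adj_smult: "adj (c \<cdot>\<^sub>m A) = cnj c \<cdot>\<^sub>m adj A"
  by (rule eq_matI) auto

lemmas mat_simps = mult_assoc_dim add_mult_dim mult_add_dim minus_mult_dim mult_minus_dim
  smult_mult_dim mult_smult_dim smult_smult_mat adj_mult adj_add adj_minus adj_smult

lemma adj_mult_self_diag:
  assumes "j < dim_col A"
  shows "(adj A * A) $$ (j, j) = of_real (\<Sum>i<dim_row A. (cmod (A $$ (i, j)))\<^sup>2)"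
  using assms by (simp add: mult_index mult.commute flip: complex_norm_square)

lemma adj_mult_self_eq_0:
  assumes "adj A * A = 0\<^sub>m (dim_col A) (dim_col A)"
  shows "A = 0\<^sub>m (dim_row A) (dim_col A)"
proof (rule eq_matI)
  fix i j assume ij: "i < dim_row (0\<^sub>m (dim_row A) (dim_col A))"
    "j < dim_col (0\<^sub>m (dim_row A) (dim_col A) :: complex mat)"
  then have "of_real (\<Sum>i<dim_row A. (cmod (A $$ (i, j)))\<^sup>2) = (0 :: complex)"
    by (subst adj_mult_self_diag[symmetric]) (auto simp: assms)
  then have "(\<Sum>i<dim_row A. (cmod (A $$ (i, j)))\<^sup>2) = 0"
    using of_real_eq_0_iff by blast
  then have "\<forall>i<dim_row A. (cmod (A $$ (i, j)))\<^sup>2 = 0"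
    by (subst (asm) sum_nonneg_eq_0_iff) auto
  then show "A $$ (i, j) = 0\<^sub>m (dim_row A) (dim_col A) $$ (i, j)" using ij by auto
qed auto

lemma mult_adj_self_eq_0:
  assumes "A * adj A = 0\<^sub>m (dim_row A) (dim_row A)"
  shows "A = 0\<^sub>m (dim_row A) (dim_col A)"
proof -
  have "adj A = 0\<^sub>m (dim_col A) (dim_row A)"
    using adj_mult_self_eq_0[of "adj A"] assms by simp
  then have "adj (adj A) = adj (0\<^sub>m (dim_col A) (dim_row A))" by simp
  also have "\<dots> = 0\<^sub>m (dim_row A) (dim_col A)" by (rule eq_matI) auto
  finally show ?thesis by simp
qed

lemma diff_eq_0_mat:
  assumes "A - B = 0\<^sub>m (dim_row A) (dim_col A)" "dim_row A = dim_row B" "dim_col A = dim_col B"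
  shows "A = (B :: complex mat)"
proof (rule eq_matI)
  fix i j assume "i < dim_row B" "j < dim_col B"
  then show "A $$ (i, j) = B $$ (i, j)"
    using arg_cong[OF assms(1), of "\<lambda>M. M $$ (i, j)"] assms(2,3) by simp
qed (use assms in auto)

text \<open>Padding with zero rows gives a square matrix of determinant \<open>0\<close>.  The coefficients are
  functions, ready to be used as a linear relation among the columns.\<close>

lemma wide_matrix_kernel:
  fixes a :: "nat \<Rightarrow> nat \<Rightarrow> complex"
  assumes "m < n"
  shows "\<exists>v. (\<exists>j<n. v j \<noteq> 0) \<and> (\<forall>i<m. (\<Sum>j<n. a i j * v j) = 0)"
proof -
  define A where "A = mat n n (\<lambda>(i, j). if i < m then a i j else 0)"
  have A: "A \<in> carrier_mat n n" by (simp add: A_def)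
  have "A = mat\<^sub>r n n (\<lambda>i. if i = m then 0\<^sub>v n else row A i)"
  proof (rule eq_rowI)
    fix i assume "i < dim_row (mat\<^sub>r n n (\<lambda>i. if i = m then 0\<^sub>v n else row A i))"
    then show "row A i = row (mat\<^sub>r n n (\<lambda>i. if i = m then 0\<^sub>v n else row A i)) i"
      using assms by (cases "i = m") (auto simp: A_def)
  qed (simp_all add: A_def)
  also have "det \<dots> = 0"
    by (rule det_row_0[OF assms]) (use A in auto)
  finally obtain v where v: "v \<in> carrier_vec n" "v \<noteq> 0\<^sub>v n" "A *\<^sub>v v = 0\<^sub>v n"
    using det_0_iff_vec_prod_zero_field[OF A] by auto
  have "\<exists>j<n. v $ j \<noteq> 0" using v(1,2) by auto
  moreover have "(\<Sum>j<n. a i j * v $ j) = 0" if "i < m" for i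
  proof -
    have "(A *\<^sub>v v) $ i = 0" using v(3) that assms by simp
    then show ?thesis using that assms v(1) by (simp add: scalar_prod_def A_def atLeast0LessThan)
  qed
  ultimately show ?thesis by blast
qed

lemma injective_square_has_inverse:
  fixes A :: "complex mat"
  assumes A: "A \<in> carrier_mat n n"
    and inj: "\<And>x. x \<in> carrier_mat n 1 \<Longrightarrow> A * x = 0\<^sub>m n 1 \<Longrightarrow> x = 0\<^sub>m n 1"
  shows "\<exists>B \<in> carrier_mat n n. B * A = 1\<^sub>m n \<and> A * B = 1\<^sub>m n"
proof -
  have "det A \<noteq> 0"
  proof
    assume "det A = 0"
    then obtain v where v: "v \<in> carrier_vec n" "v \<noteq> 0\<^sub>v n" "A *\<^sub>v v = 0\<^sub>v n"
      using det_0_iff_vec_prod_zero_field[OF A] by auto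
    define x where "x = mat n 1 (\<lambda>(i, j). v $ i)"
    have "A * x = 0\<^sub>m n 1"
    proof (rule eq_matI)
      fix i j assume ij: "i < dim_row (0\<^sub>m n 1 :: complex mat)" "j < dim_col (0\<^sub>m n 1 :: complex mat)"
      have "(A *\<^sub>v v) $ i = 0" using v(3) ij by simp
      then show "(A * x) $$ (i, j) = 0\<^sub>m n 1 $$ (i, j)"
        using ij A v(1) by (simp add: mult_index x_def scalar_prod_def atLeast0LessThan)
    qed (use A in \<open>auto simp: x_def\<close>)
    then have "x = 0\<^sub>m n 1" using inj by (simp add: x_def)
    then have "x $$ (i, 0) = 0" if "i < n" for i using that by simp
    then have "v = 0\<^sub>v n" using v(1) by (auto simp: x_def)
    then show False using v by simp
  qed
  from det_non_zero_imp_unit[OF A this, of "()"] show ?thesis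
    by (auto simp: Units_def ring_mat_def)
qed

text \<open>An injective matrix has the Moore-Penrose left inverse, because its Gram matrix is injective.\<close>

lemma injective_has_left_inverse:
  fixes G :: "complex mat"
  assumes G: "G \<in> carrier_mat n r"
    and inj: "\<And>x. x \<in> carrier_mat r 1 \<Longrightarrow> G * x = 0\<^sub>m n 1 \<Longrightarrow> x = 0\<^sub>m r 1"
  shows "\<exists>M \<in> carrier_mat r r. adj M = M \<and> M * adj G * G = 1\<^sub>m r"
proof -
  have GG: "adj G * G \<in> carrier_mat r r" using G by auto
  have "x = 0\<^sub>m r 1" if x: "x \<in> carrier_mat r 1" and "adj G * G * x = 0\<^sub>m r 1" for x
  proof -
    have "adj (G * x) * (G * x) = adj x * (adj G * G * x)"
      using G x by (simp add: mat_simps)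
    also have "\<dots> = 0\<^sub>m 1 1" using that by simp
    finally have "G * x = 0\<^sub>m n 1" using adj_mult_self_eq_0[of "G * x"] G x by simp
    then show ?thesis using inj x by simp
  qed
  then obtain M where M: "M \<in> carrier_mat r r" "M * (adj G * G) = 1\<^sub>m r" "adj G * G * M = 1\<^sub>m r"
    using injective_square_has_inverse[OF GG] by auto
  have "adj (adj G * G * M) = 1\<^sub>m r" using M(3) by simp
  then have *: "adj M * (adj G * G) = 1\<^sub>m r" using M(1) G by (simp add: mat_simps)
  have "adj M = adj M * (adj G * G * M)" using M by simp
  also have "\<dots> = adj M * (adj G * G) * M" using M(1) G by (simp add: mult_assoc_dim)
  also have "\<dots> = M" using * M(1) by simp
  finally show ?thesis using M G by (auto simp: mult_assoc_dim)
qed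

section \<open>Algebras of matrices that meet every coset of the unitary group\<close>

lemma bounded_complex_convergent_subseq:
  fixes z :: "nat \<Rightarrow> complex"
  assumes "\<And>n. cmod (z n) \<le> K"
  shows "\<exists>s l. strict_mono (s :: nat \<Rightarrow> nat) \<and> (\<lambda>n. z (s n)) \<longlonglongrightarrow> l"
proof -
  have real: "\<exists>s l. strict_mono (s :: nat \<Rightarrow> nat) \<and> (\<lambda>n. x (s n)) \<longlonglongrightarrow> l"
    if "\<And>n. \<bar>x n\<bar> \<le> K" for x :: "nat \<Rightarrow> real"
  proof -
    obtain s :: "nat \<Rightarrow> nat" where s: "strict_mono s" "monoseq (\<lambda>n. x (s n))"
      using seq_monosub by blast
    have "Bseq (\<lambda>n. x (s n))" using that by (intro BseqI'[of _ K]) auto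
    then have "convergent (\<lambda>n. x (s n))" using s(2) Bseq_monoseq_convergent by blast
    then show ?thesis using s(1) by (auto simp: convergent_def)
  qed
  obtain s l where s: "strict_mono (s :: nat \<Rightarrow> nat)" "(\<lambda>n. Re (z (s n))) \<longlonglongrightarrow> l"
    using real[of "\<lambda>n. Re (z n)"] assms abs_Re_le_cmod order_trans by meson
  obtain t m where t: "strict_mono (t :: nat \<Rightarrow> nat)" "(\<lambda>n. Im (z (s (t n)))) \<longlonglongrightarrow> m"
    using real[of "\<lambda>n. Im (z (s n))"] assms abs_Im_le_cmod order_trans by meson
  have "(\<lambda>n. Re (z (s (t n)))) \<longlonglongrightarrow> l"
    using LIMSEQ_subseq_LIMSEQ[OF s(2) t(1)] by (simp add: o_def)
  then have "(\<lambda>n. z (s (t n))) \<longlonglongrightarrow> Complex l m" using t(2) by (intro tendsto_complex_iff[THEN iffD2]) auto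
  moreover have "strict_mono (\<lambda>n. s (t n))" using s(1) t(1) by (simp add: strict_mono_def)
  ultimately show ?thesis by blast
qed

lemma bounded_family_convergent_subseq:
  fixes z :: "nat \<Rightarrow> 'i \<Rightarrow> complex"
  assumes "finite I" and bd: "\<And>n i. i \<in> I \<Longrightarrow> cmod (z n i) \<le> K"
  shows "\<exists>s l. strict_mono (s :: nat \<Rightarrow> nat) \<and> (\<forall>i\<in>I. (\<lambda>n. z (s n) i) \<longlonglongrightarrow> l i)"
  using assms
proof (induction I)
  case empty
  show ?case by (intro exI[of _ id]) (auto simp: strict_mono_def)
next
  case (insert a I)
  then obtain s l where s: "strict_mono (s :: nat \<Rightarrow> nat)" "\<forall>i\<in>I. (\<lambda>n. z (s n) i) \<longlonglongrightarrow> l i"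
    by auto
  obtain t m where t: "strict_mono (t :: nat \<Rightarrow> nat)" "(\<lambda>n. z (s (t n)) a) \<longlonglongrightarrow> m"
    using bounded_complex_convergent_subseq[of "\<lambda>n. z (s n) a" K] insert.prems by auto
  have "(\<lambda>n. z (s (t n)) i) \<longlonglongrightarrow> l i" if "i \<in> I" for i
    using LIMSEQ_subseq_LIMSEQ[OF s(2)[rule_format, OF that] t(1)] by (simp add: o_def)
  then have "\<forall>i\<in>insert a I. (\<lambda>n. z (s (t n)) i) \<longlonglongrightarrow> (l(a := m)) i"
    using t(2) insert.hyps by auto
  moreover have "strict_mono (\<lambda>n. s (t n))" using s(1) t(1) by (simp add: strict_mono_def)
  ultimately show ?case by (intro exI[of _ "\<lambda>n. s (t n)"]) blast
qed

lemma tendsto_mult_mat_index: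
  fixes A B :: "nat \<Rightarrow> complex mat"
  assumes A: "\<And>n. A n \<in> carrier_mat a b" "A' \<in> carrier_mat a b"
    and B: "\<And>n. B n \<in> carrier_mat b c" "B' \<in> carrier_mat b c"
    and "\<And>i j. i < a \<Longrightarrow> j < b \<Longrightarrow> (\<lambda>n. A n $$ (i, j)) \<longlonglongrightarrow> A' $$ (i, j)"
    and "\<And>i j. i < b \<Longrightarrow> j < c \<Longrightarrow> (\<lambda>n. B n $$ (i, j)) \<longlonglongrightarrow> B' $$ (i, j)"
    and ij: "i < a" "j < c"
  shows "(\<lambda>n. (A n * B n) $$ (i, j)) \<longlonglongrightarrow> (A' * B') $$ (i, j)"
proof -
  have "(A n * B n) $$ (i, j) = (\<Sum>k<b. A n $$ (i, k) * B n $$ (k, j))" for n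
    using A(1)[of n] B(1)[of n] ij by (simp add: mult_index)
  moreover have "(A' * B') $$ (i, j) = (\<Sum>k<b. A' $$ (i, k) * B' $$ (k, j))"
    using A(2) B(2) ij by (simp add: mult_index)
  moreover have "(\<lambda>n. \<Sum>k<b. A n $$ (i, k) * B n $$ (k, j)) \<longlonglongrightarrow> (\<Sum>k<b. A' $$ (i, k) * B' $$ (k, j))"
    by (intro tendsto_sum tendsto_mult) (use assms in auto)
  ultimately show ?thesis by simp
qed

lemma cmod_index_le_gram:
  assumes "i < dim_row A" "j < dim_col A"
  shows "(cmod (A $$ (i, j)))\<^sup>2 \<le> Re ((adj A * A) $$ (j, j))"
proof -
  have "(cmod (A $$ (i, j)))\<^sup>2 \<le> (\<Sum>i<dim_row A. (cmod (A $$ (i, j)))\<^sup>2)"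
    using assms by (intro member_le_sum[of i]) auto
  then show ?thesis using adj_mult_self_diag[of j A] assms by simp
qed

lemma one_by_one_mat:
  fixes X :: "complex mat"
  assumes "X \<in> carrier_mat 1 1"
  shows "X = X $$ (0, 0) \<cdot>\<^sub>m 1\<^sub>m 1"
  by (rule eq_matI) (use assms in auto)

lemma norm_square_column:
  fixes x :: "complex mat"
  assumes "x \<in> carrier_mat r 1" "x \<noteq> 0\<^sub>m r 1"
  shows "\<exists>n>0. adj x * x = complex_of_real n \<cdot>\<^sub>m 1\<^sub>m 1"
proof -
  define n where "n = (\<Sum>i<dim_row x. (cmod (x $$ (i, 0)))\<^sup>2)"
  have *: "adj x * x = complex_of_real n \<cdot>\<^sub>m 1\<^sub>m 1"
    using one_by_one_mat[of "adj x * x"] adj_mult_self_diag[of 0 x] assms(1)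
    by (simp add: n_def)
  have "n \<noteq> 0"
  proof
    assume "n = 0"
    then have "adj x * x = 0\<^sub>m 1 1" using * by (auto intro!: eq_matI)
    then show False using adj_mult_self_eq_0[of x] assms by simp
  qed
  moreover have "n \<ge> 0" by (auto simp: n_def intro: sum_nonneg)
  ultimately show ?thesis using * by (intro exI[of _ n]) auto
qed

lemma inverse_sqrt_scalar:
  assumes "n > (0 :: real)"
  shows "\<exists>c. c * c * complex_of_real n = 1 \<and> cnj c = c"
proof -
  have "complex_of_real (1 / sqrt n) * complex_of_real (1 / sqrt n) * complex_of_real n
    = complex_of_real (1 / sqrt n * (1 / sqrt n) * n)"
    by (simp only: of_real_mult)
  also have "1 / sqrt n * (1 / sqrt n) * n = 1" using assms by simp
  finally show ?thesis by (intro exI[of _ "complex_of_real (1 / sqrt n)"]) simp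
qed

lemma column_mult_scalar:
  fixes x :: "complex mat"
  assumes "x \<in> carrier_mat r 1"
  shows "x * (c \<cdot>\<^sub>m 1\<^sub>m 1) = c \<cdot>\<^sub>m x"
  using assms by (simp add: mat_simps)

locale closed_matrix_algebra =
  fixes r :: nat and \<A> :: "complex mat set"
  assumes in_carrier: "B \<in> \<A> \<Longrightarrow> B \<in> carrier_mat r r"
    and one: "1\<^sub>m r \<in> \<A>"
    and add: "B \<in> \<A> \<Longrightarrow> C \<in> \<A> \<Longrightarrow> B + C \<in> \<A>"
    and smult: "B \<in> \<A> \<Longrightarrow> c \<cdot>\<^sub>m B \<in> \<A>"
    and mult: "B \<in> \<A> \<Longrightarrow> C \<in> \<A> \<Longrightarrow> B * C \<in> \<A>"
    and limit: "(\<And>n. S n \<in> \<A>) \<Longrightarrow> L \<in> carrier_mat r r \<Longrightarrow>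
      (\<And>i j. i < r \<Longrightarrow> j < r \<Longrightarrow> (\<lambda>n. S n $$ (i, j)) \<longlonglongrightarrow> L $$ (i, j)) \<Longrightarrow> L \<in> \<A>"
begin

lemma minus: "B \<in> \<A> \<Longrightarrow> C \<in> \<A> \<Longrightarrow> B - C \<in> \<A>"
proof -
  assume BC: "B \<in> \<A>" "C \<in> \<A>"
  then have "B - C = B + (-1) \<cdot>\<^sub>m C"
    using in_carrier[of B] in_carrier[of C] by (intro eq_matI) auto
  then show ?thesis using BC add smult by metis
qed

lemma commutant_subalgebra:
  assumes F: "F \<subseteq> carrier_mat r r"
  shows "closed_matrix_algebra r {B \<in> \<A>. \<forall>P\<in>F. B * P = P * B}"
proof
  fix B C assume B: "B \<in> {B \<in> \<A>. \<forall>P\<in>F. B * P = P * B}"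
  then have Bc: "B \<in> carrier_mat r r" using in_carrier by auto
  then show "B \<in> carrier_mat r r" .
  show "c \<cdot>\<^sub>m B \<in> {B \<in> \<A>. \<forall>P\<in>F. B * P = P * B}" for c
    using B Bc smult F by (auto simp: mat_simps carrier_matD[OF subsetD[OF F]])
  assume C: "C \<in> {B \<in> \<A>. \<forall>P\<in>F. B * P = P * B}"
  then have Cc: "C \<in> carrier_mat r r" using in_carrier by auto
  show "B + C \<in> {B \<in> \<A>. \<forall>P\<in>F. B * P = P * B}"
    using B C Bc Cc add by (auto simp: mat_simps carrier_matD[OF subsetD[OF F]])
  have "B * C * P = P * (B * C)" if "P \<in> F" for P
  proof -
    have Pc: "P \<in> carrier_mat r r" using that F by auto
    have "B * C * P = B * (P * C)" using Bc Cc Pc C that by (simp add: mult_assoc_dim)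
    also have "\<dots> = (B * P) * C" using Bc Cc Pc by (simp add: mult_assoc_dim)
    also have "\<dots> = P * (B * C)" using Bc Cc Pc B that by (simp add: mult_assoc_dim)
    finally show ?thesis .
  qed
  then show "B * C \<in> {B \<in> \<A>. \<forall>P\<in>F. B * P = P * B}" using B C mult by auto
next
  show "1\<^sub>m r \<in> {B \<in> \<A>. \<forall>P\<in>F. B * P = P * B}"
    using one by (auto simp: carrier_matD[OF subsetD[OF F]])
next
  fix S L assume S: "\<And>n. S n \<in> {B \<in> \<A>. \<forall>P\<in>F. B * P = P * B}" and L: "L \<in> carrier_mat r r"
    and lim: "\<And>i j. i < r \<Longrightarrow> j < r \<Longrightarrow> (\<lambda>n. S n $$ (i, j)) \<longlonglongrightarrow> L $$ (i, j)"
  have Sc: "S n \<in> carrier_mat r r" for n using S in_carrier by auto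
  have "L * P = P * L" if "P \<in> F" for P
  proof (rule eq_matI)
    have Pc: "P \<in> carrier_mat r r" using that F by auto
    fix i j assume "i < dim_row (P * L)" "j < dim_col (P * L)"
    then have ij: "i < r" "j < r" using Pc L by auto
    have 1: "(\<lambda>n. (S n * P) $$ (i, j)) \<longlonglongrightarrow> (L * P) $$ (i, j)"
      by (rule tendsto_mult_mat_index[where a = r and b = r and c = r])
        (use Sc Pc L lim ij in auto)
    have 2: "(\<lambda>n. (P * S n) $$ (i, j)) \<longlonglongrightarrow> (P * L) $$ (i, j)"
      by (rule tendsto_mult_mat_index[where a = r and b = r and c = r])
        (use Sc Pc L lim ij in auto)
    have "S n * P = P * S n" for n using S that by auto
    then show "(L * P) $$ (i, j) = (P * L) $$ (i, j)" using LIMSEQ_unique[OF 1] 2 by simp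
  qed (use L F that in auto)
  moreover have "L \<in> \<A>" using limit[of S L] S L lim by auto
  ultimately show "L \<in> {B \<in> \<A>. \<forall>P\<in>F. B * P = P * B}" by auto
qed

lemma orbit_combination:
  fixes n :: nat
  assumes x: "x \<in> carrier_mat r 1" and "\<And>j. j < n \<Longrightarrow> \<exists>B\<in>\<A>. y j = B * x"
  shows "\<exists>B\<in>\<A>. \<forall>i<r. (\<Sum>j<n. c j * y j $$ (i, 0)) = (B * x) $$ (i, 0)"
  using assms(2)
proof (induction n)
  case 0
  have "0 \<cdot>\<^sub>m 1\<^sub>m r * x = 0\<^sub>m r 1" using x by (intro eq_matI) (auto simp: mat_simps)
  then show ?case using smult[OF one, of 0] by (intro bexI[of _ "0 \<cdot>\<^sub>m 1\<^sub>m r"]) auto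
next
  case (Suc n)
  then obtain B where B: "B \<in> \<A>" "\<forall>i<r. (\<Sum>j<n. c j * y j $$ (i, 0)) = (B * x) $$ (i, 0)"
    by auto
  obtain C where C: "C \<in> \<A>" "y n = C * x" using Suc.prems[of n] by auto
  have "(B + c n \<cdot>\<^sub>m C) * x = B * x + c n \<cdot>\<^sub>m (C * x)"
    using in_carrier[OF B(1)] in_carrier[OF C(1)] x by (simp add: mat_simps)
  then show ?case
    using B C in_carrier[OF B(1)] in_carrier[OF C(1)] x add smult
    by (intro bexI[of _ "B + c n \<cdot>\<^sub>m C"]) auto
qed

text \<open>Otherwise there would be a chain \<open>x\<^sub>0, x\<^sub>1, \<dots>\<close> with \<open>x\<^sub>j\<^sub>+\<^sub>1 \<in> \<A> x\<^sub>j\<close> but \<open>x\<^sub>j \<notin> \<A> x\<^sub>j\<^sub>+\<^sub>1\<close>; in a linear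
  relation among its first \<open>r + 1\<close> members the first nonzero coefficient would put some \<open>x\<^sub>j\<close>
  into \<open>\<A> x\<^sub>j\<^sub>+\<^sub>1\<close>.\<close>

lemma minimal_orbit_exists:
  assumes H: "H \<subseteq> carrier_mat r 1" and x0: "x0 \<in> H"
    and inv: "\<And>x B. x \<in> H \<Longrightarrow> B \<in> \<A> \<Longrightarrow> B * x \<noteq> 0\<^sub>m r 1 \<Longrightarrow> B * x \<in> H"
  shows "\<exists>e\<in>H. \<forall>B\<in>\<A>. B * e \<noteq> 0\<^sub>m r 1 \<longrightarrow> (\<exists>C\<in>\<A>. e = C * (B * e))"
proof (rule ccontr)
  assume "\<not> ?thesis"
  then have step: "\<exists>y. y \<in> H \<and> (\<exists>B\<in>\<A>. y = B * e) \<and> \<not> (\<exists>C\<in>\<A>. e = C * y)" if "e \<in> H" for e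
    using that inv by blast
  have "\<exists>x. \<forall>n. x n \<in> H \<and> ((\<exists>B\<in>\<A>. x (Suc n) = B * x n) \<and> \<not> (\<exists>C\<in>\<A>. x n = C * x (Suc n)))"
    by (rule dependent_nat_choice) (use x0 step in auto)
  then obtain x where xH: "\<And>n. x n \<in> H" and down: "\<And>n. \<exists>B\<in>\<A>. x (Suc n) = B * x n"
    and up: "\<And>n. \<not> (\<exists>C\<in>\<A>. x n = C * x (Suc n))" by blast
  have xc: "x n \<in> carrier_mat r 1" for n using xH H by auto
  have orbit: "\<exists>B\<in>\<A>. x (s + j) = B * x s" for s j
  proof (induction j)
    case 0
    show ?case using one xc[of s] by (intro bexI[of _ "1\<^sub>m r"]) auto
  next
    case (Suc j)
    then obtain B where B: "B \<in> \<A>" "x (s + j) = B * x s" by auto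
    obtain C where C: "C \<in> \<A>" "x (Suc (s + j)) = C * x (s + j)" using down by blast
    show ?case
      using B C mult[OF C(1) B(1)] in_carrier[OF B(1)] in_carrier[OF C(1)] xc[of s]
      by (intro bexI[of _ "C * B"]) (auto simp: mult_assoc_dim)
  qed
  have indep: "\<forall>j<n. v j = 0" if "\<And>i. i < r \<Longrightarrow> (\<Sum>j<n. v j * x (s + j) $$ (i, 0)) = 0" for n s :: nat and v
    using that
  proof (induction n arbitrary: s v)
    case (Suc n)
    obtain B where B: "B \<in> \<A>"
      "\<forall>i<r. (\<Sum>j<n. v (Suc j) * x (Suc s + j) $$ (i, 0)) = (B * x (Suc s)) $$ (i, 0)"
      using orbit_combination[OF xc, of n "\<lambda>j. x (Suc s + j)" "Suc s" "\<lambda>j. v (Suc j)"] orbit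
      by blast
    have split: "v 0 * x s $$ (i, 0) + (\<Sum>j<n. v (Suc j) * x (Suc s + j) $$ (i, 0)) = 0"
      if "i < r" for i
      using Suc.prems[OF that] by (subst (asm) sum.lessThan_Suc_shift) simp
    have v0: "v 0 = 0"
    proof (rule ccontr)
      assume nz: "v 0 \<noteq> 0"
      have "x s = (- inverse (v 0)) \<cdot>\<^sub>m B * x (Suc s)"
      proof (rule eq_matI)
        fix i j assume "i < dim_row (- inverse (v 0) \<cdot>\<^sub>m B * x (Suc s))"
          "j < dim_col (- inverse (v 0) \<cdot>\<^sub>m B * x (Suc s))"
        then have ij: "i < r" "j = 0" using in_carrier[OF B(1)] xc[of "Suc s"] by auto
        have "v 0 * x s $$ (i, 0) + (B * x (Suc s)) $$ (i, 0) = 0"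
          using split[OF ij(1)] B(2) ij by simp
        then have "x s $$ (i, 0) = - inverse (v 0) * (B * x (Suc s)) $$ (i, 0)"
          using nz by (simp add: field_simps add_eq_0_iff)
        then show "x s $$ (i, j) = (- inverse (v 0) \<cdot>\<^sub>m B * x (Suc s)) $$ (i, j)"
          using ij in_carrier[OF B(1)] xc[of "Suc s"] by (simp add: mat_simps)
      qed (use in_carrier[OF B(1)] xc[of s] xc[of "Suc s"] in auto)
      then show False using up[of s] smult[OF B(1)] by blast
    qed
    have "\<forall>j<n. v (Suc j) = 0"
      by (rule Suc.IH[of "\<lambda>j. v (Suc j)" "Suc s"]) (use split v0 in auto)
    then show ?case using v0 by (auto simp: less_Suc_eq_0_disj)
  qed simp
  obtain v where v: "\<exists>j<Suc r. v j \<noteq> 0" "\<forall>i<r. (\<Sum>j<Suc r. x j $$ (i, 0) * v j) = 0"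
    using wide_matrix_kernel[of r "Suc r" "\<lambda>i j. x j $$ (i, 0)"] by auto
  have "\<forall>j<Suc r. v j = 0"
    by (rule indep[where s = 0]) (use v(2) in \<open>auto simp: mult.commute\<close>)
  then show False using v(1) by auto
qed

end

text \<open>Square matrices with equal Gram matrices differ by a unitary on the left, so for empty \<open>F\<close> the
  condition says that every invertible matrix is a unitary times an element of \<open>\<A>\<close>.  The left
  inverse \<open>C'\<close> expresses invertibility.\<close>

definition gram_complete :: "nat \<Rightarrow> complex mat set \<Rightarrow> complex mat set \<Rightarrow> bool" where
  "gram_complete r F \<A> \<longleftrightarrow> (\<forall>C\<in>carrier_mat r r. \<forall>C'\<in>carrier_mat r r. C' * C = 1\<^sub>m r \<longrightarrow>
     (\<forall>P\<in>F. C * P = P * C) \<longrightarrow> (\<exists>B\<in>\<A>. adj B * B = adj C * C))"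

lemma projection_pencil_mult:
  fixes p :: "complex mat"
  assumes "p \<in> carrier_mat r r" "p * p = p"
  shows "(a \<cdot>\<^sub>m 1\<^sub>m r + b \<cdot>\<^sub>m p) * (c \<cdot>\<^sub>m 1\<^sub>m r + d \<cdot>\<^sub>m p)
    = (a * c) \<cdot>\<^sub>m 1\<^sub>m r + (a * d + b * c + b * d) \<cdot>\<^sub>m p"
  using assms by (intro eq_matI) (auto simp: mat_simps algebra_simps)

lemma column_projection:
  fixes z :: "complex mat"
  assumes z: "z \<in> carrier_mat r 1" "adj z * z = 1\<^sub>m 1"
  shows "z * adj z * (z * adj z) = z * adj z" "adj (z * adj z) = z * adj z" "z * adj z * z = z"
    "adj z * (z * adj z) = adj z"
proof -
  show 1: "z * adj z * z = z" using z by (simp add: mult_assoc_dim)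
  have "z * adj z * (z * adj z) = (z * adj z * z) * adj z" using z(1) by (simp add: mult_assoc_dim)
  then show "z * adj z * (z * adj z) = z * adj z" using 1 by simp
  show "adj (z * adj z) = z * adj z" using z by (simp add: mat_simps)
  have "adj z * (z * adj z) = (adj z * z) * adj z" using z(1) by (simp add: mult_assoc_dim)
  then show "adj z * (z * adj z) = adj z" using z by simp
qed

text \<open>\<open>\<epsilon> + z z\<^sup>*\<close> has the square root \<open>s + (t - s) z z\<^sup>*\<close> with \<open>s = \<surd>\<epsilon>\<close> and \<open>t = \<surd>(1 + \<epsilon>)\<close>.\<close>

lemma gram_complete_perturbed_projection:
  assumes gc: "gram_complete r F \<A>" and z: "z \<in> carrier_mat r 1" "adj z * z = 1\<^sub>m 1"
    and F: "F \<subseteq> carrier_mat r r" "\<And>P. P \<in> F \<Longrightarrow> z * adj z * P = P * (z * adj z)" and e: "e > (0 :: real)"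
  shows "\<exists>B\<in>\<A>. adj B * B = of_real e \<cdot>\<^sub>m 1\<^sub>m r + z * adj z"
proof -
  define p where "p = z * adj z"
  have p: "p \<in> carrier_mat r r" "p * p = p" "adj p = p"
    using column_projection[OF z] z by (auto simp: p_def)
  define s t where "s = sqrt e" and "t = sqrt (1 + e)"
  have st: "s > 0" "t > 0" "s * s = e" "t * t = 1 + e" using e by (auto simp: s_def t_def)
  define C where "C = complex_of_real s \<cdot>\<^sub>m 1\<^sub>m r + complex_of_real (t - s) \<cdot>\<^sub>m p"
  define C' where "C' = complex_of_real (1 / s) \<cdot>\<^sub>m 1\<^sub>m r + complex_of_real (1 / t - 1 / s) \<cdot>\<^sub>m p"
  have c: "C \<in> carrier_mat r r" "C' \<in> carrier_mat r r" using p by (auto simp: C_def C'_def)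
  have "complex_of_real (1 / s) * complex_of_real (t - s) + complex_of_real (1 / t - 1 / s) * complex_of_real s +
    complex_of_real (1 / t - 1 / s) * complex_of_real (t - s)
    = complex_of_real ((1 / s) * (t - s) + (1 / t - 1 / s) * s + (1 / t - 1 / s) * (t - s))"
    by (simp only: of_real_mult of_real_add)
  also have "(1 / s) * (t - s) + (1 / t - 1 / s) * s + (1 / t - 1 / s) * (t - s) = 0"
    using st by (simp add: field_simps)
  finally have "C' * C = (complex_of_real (1 / s) * complex_of_real s) \<cdot>\<^sub>m 1\<^sub>m r + 0 \<cdot>\<^sub>m p"
    using projection_pencil_mult[OF p(1,2)] by (simp add: C_def C'_def)
  also have "\<dots> = 1\<^sub>m r" using p(1) st by (intro eq_matI) auto
  finally have inv: "C' * C = 1\<^sub>m r" .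
  have adjC: "adj C = C" using p by (simp add: C_def mat_simps)
  have "complex_of_real s * complex_of_real (t - s) + complex_of_real (t - s) * complex_of_real s
    + complex_of_real (t - s) * complex_of_real (t - s)
    = complex_of_real (s * (t - s) + (t - s) * s + (t - s) * (t - s))"
    by (simp only: of_real_mult of_real_add)
  also have "s * (t - s) + (t - s) * s + (t - s) * (t - s) = 1"
    using st(3,4) by (simp add: algebra_simps)
  finally have "C * C = (complex_of_real s * complex_of_real s) \<cdot>\<^sub>m 1\<^sub>m r + 1 \<cdot>\<^sub>m p"
    using projection_pencil_mult[OF p(1,2)] by (simp add: C_def)
  then have CC: "adj C * C = of_real e \<cdot>\<^sub>m 1\<^sub>m r + z * adj z"
    using st(3) adjC by (simp add: one_smult_mat p_def flip: of_real_mult)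
  have "C * P = P * C" if "P \<in> F" for P
  proof -
    have "P \<in> carrier_mat r r" "p * P = P * p" using F that by (auto simp: p_def)
    then show ?thesis using p(1) by (simp add: C_def mat_simps)
  qed
  then show ?thesis using gc c inv CC unfolding gram_complete_def by metis
qed

text \<open>The unitary that moves \<open>g\<close> to \<open>e\<close> and is the identity on the orthogonal complement
  of \<open>v = g - e\<close>.  Its form \<open>1 + c v v\<^sup>*\<close> places it in every unital algebra that contains \<open>v v\<^sup>*\<close>.\<close>

lemma reflection_exists:
  assumes g: "g \<in> carrier_mat r 1" "adj g * g = 1\<^sub>m 1" and e: "e \<in> carrier_mat r 1" "adj e * e = 1\<^sub>m 1"
  shows "\<exists>c. let v = g - e; w = 1\<^sub>m r + c \<cdot>\<^sub>m (v * adj v) in adj w * w = 1\<^sub>m r \<and> w * g = e"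
proof -
  define v where "v = g - e"
  have v: "v \<in> carrier_mat r 1" using g e by (simp add: v_def minus_carrier_mat)
  define a where "a = (adj v * g) $$ (0, 0)"
  have vg: "adj v * g = a \<cdot>\<^sub>m 1\<^sub>m 1" using one_by_one_mat[of "adj v * g"] v g by (simp add: a_def)
  have gv: "adj g * v = cnj a \<cdot>\<^sub>m 1\<^sub>m 1"
    using arg_cong[OF vg, of adj] g v by (simp add: mat_simps)
  have "adj v * v = adj v * g + adj g * v - (adj g * g - adj e * e)"
    unfolding v_def using g(1) e(1) by (intro eq_matI) (auto simp: mat_simps)
  also have "\<dots> = (a + cnj a) \<cdot>\<^sub>m 1\<^sub>m 1" using g e vg gv by (intro eq_matI) auto
  finally have vv: "adj v * v = (a + cnj a) \<cdot>\<^sub>m 1\<^sub>m 1" .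
  show ?thesis
  proof (cases "a = 0")
    case True
    then have "adj v * v = 0\<^sub>m 1 1" using vv by (auto intro!: eq_matI)
    then have "v = 0\<^sub>m r 1" using adj_mult_self_eq_0[of v] v by simp
    then have "g = e" using diff_eq_0_mat[of g e] g e by (simp add: v_def)
    have "1\<^sub>m r + 0 \<cdot>\<^sub>m (v * adj v) = 1\<^sub>m r" using v by (intro eq_matI) auto
    then show ?thesis using \<open>g = e\<close> e by (intro exI[of _ 0]) (simp add: Let_def v_def)
  next
    case False
    define w where "w = 1\<^sub>m r + (- inverse a) \<cdot>\<^sub>m (v * adj v)"
    have vvg: "v * adj v * g = a \<cdot>\<^sub>m v"
      using v g vg column_mult_scalar[OF v] by (simp add: mult_assoc_dim)
    have "w * g = g - v"
      unfolding w_def using v g vvg False by (intro eq_matI) (auto simp: mat_simps)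
    also have "\<dots> = e" unfolding v_def using g e by (intro eq_matI) auto
    finally have wg: "w * g = e" .
    have "v * adj v * (v * adj v) = v * (adj v * v) * adj v" using v by (simp add: mult_assoc_dim)
    also have "\<dots> = (a + cnj a) \<cdot>\<^sub>m (v * adj v)"
      unfolding vv using v column_mult_scalar[OF v] by (simp add: mat_simps)
    finally have sq: "v * adj v * (v * adj v) = (a + cnj a) \<cdot>\<^sub>m (v * adj v)" .
    define q where "q = v * adj v"
    have q: "q \<in> carrier_mat r r" "adj q = q" "q * q = (a + cnj a) \<cdot>\<^sub>m q"
      using v sq by (auto simp: q_def mat_simps)
    have "adj w * w = 1\<^sub>m r + (- inverse a - inverse (cnj a) + inverse a * inverse (cnj a) * (a + cnj a)) \<cdot>\<^sub>m q"
      unfolding w_def q_def[symmetric] using q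
      by (intro eq_matI) (auto simp: mat_simps algebra_simps)
    also have "- inverse a - inverse (cnj a) + inverse a * inverse (cnj a) * (a + cnj a) = 0"
      using False by (simp add: field_simps)
    also have "1\<^sub>m r + 0 \<cdot>\<^sub>m q = 1\<^sub>m r" using q by (intro eq_matI) auto
    finally have "adj w * w = 1\<^sub>m r" .
    then show ?thesis using wg by (intro exI[of _ "- inverse a"]) (simp add: Let_def v_def w_def)
  qed
qed

context closed_matrix_algebra
begin

text \<open>Compactness turns the Gram matrices \<open>\<epsilon> + z z\<^sup>*\<close> into an element \<open>y z\<^sup>*\<close> of \<open>\<A>\<close> with
  \<open>y \<in> \<A> z\<close>; minimality of the orbit of \<open>e\<close> moves \<open>y\<close> back to \<open>z\<close>.\<close>

lemma unit_orbit_projection: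
  assumes e: "e \<in> carrier_mat r 1"
    and minimal: "\<And>B. B \<in> \<A> \<Longrightarrow> B * e \<noteq> 0\<^sub>m r 1 \<Longrightarrow> \<exists>C\<in>\<A>. e = C * (B * e)"
    and B1: "B1 \<in> \<A>" and z: "adj (B1 * e) * (B1 * e) = 1\<^sub>m 1"
    and gram: "\<And>\<epsilon>. \<epsilon> > 0 \<Longrightarrow> \<exists>B\<in>\<A>. adj B * B = of_real \<epsilon> \<cdot>\<^sub>m 1\<^sub>m r + (B1 * e) * adj (B1 * e)"
  shows "(B1 * e) * adj (B1 * e) \<in> \<A>"
proof -
  define z where "z = B1 * e"
  define p where "p = z * adj z"
  have z: "z \<in> carrier_mat r 1" "adj z * z = 1\<^sub>m 1" using assms in_carrier[OF B1] by (auto simp: z_def)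
  note proj = column_projection[OF z, folded p_def]
  have p: "p \<in> carrier_mat r r" using z by (simp add: p_def)
  have "\<forall>n. \<exists>B. B \<in> \<A> \<and> adj B * B = complex_of_real (1 / Suc n) \<cdot>\<^sub>m 1\<^sub>m r + p"
    using gram[of "1 / Suc n" for n] by (auto simp: p_def z_def)
  then obtain B where B: "\<And>n. B n \<in> \<A>"
    and BB: "\<And>n. adj (B n) * B n = complex_of_real (1 / Suc n) \<cdot>\<^sub>m 1\<^sub>m r + p" by metis
  have Bc: "B n \<in> carrier_mat r r" for n using B in_carrier by auto
  have idx: "(adj (B n) * B n) $$ (i, j) = complex_of_real (1 / Suc n) * (if i = j then 1 else 0) + p $$ (i, j)"
    if "i < r" "j < r" for n i j using that p by (simp add: BB)
  have bd: "cmod (B n $$ ij) \<le> 1 + (1 + (\<Sum>j<r. cmod (p $$ (j, j))))" if ij: "ij \<in> {..<r} \<times> {..<r}" for n ij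
  proof -
    obtain i j where ij': "ij = (i, j)" "i < r" "j < r" using ij by auto
    have "(cmod (B n $$ (i, j)))\<^sup>2 \<le> Re ((adj (B n) * B n) $$ (j, j))"
      by (rule cmod_index_le_gram) (use Bc[of n] ij' in auto)
    also have "\<dots> = 1 / Suc n + Re (p $$ (j, j))"
      unfolding idx[OF ij'(3,3)] by (simp add: Re_divide_of_nat)
    also have "\<dots> \<le> 1 + (\<Sum>j<r. cmod (p $$ (j, j)))"
    proof (rule add_mono)
      have "Re (p $$ (j, j)) \<le> cmod (p $$ (j, j))" by (rule complex_Re_le_cmod)
      also have "\<dots> \<le> (\<Sum>j<r. cmod (p $$ (j, j)))"
        using ij' by (intro member_le_sum[of j "{..<r}" "\<lambda>j. cmod (p $$ (j, j))"]) auto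
      finally show "Re (p $$ (j, j)) \<le> (\<Sum>j<r. cmod (p $$ (j, j)))" .
    qed (simp add: field_simps)
    finally have *: "(cmod (B n $$ (i, j)))\<^sup>2 \<le> 1 + (\<Sum>j<r. cmod (p $$ (j, j)))" .
    have "x \<le> 1 + x\<^sup>2" for x :: real using zero_le_power2[of "x - 1 / 2"] by (simp add: power2_eq_square algebra_simps)
    from this[of "cmod (B n $$ (i, j))"] * show ?thesis using ij' by simp
  qed
  obtain s l where s: "strict_mono (s :: nat \<Rightarrow> nat)"
    and lim: "\<forall>ij\<in>{..<r} \<times> {..<r}. (\<lambda>n. B (s n) $$ ij) \<longlonglongrightarrow> l ij"
    using bounded_family_convergent_subseq[of "{..<r} \<times> {..<r}" "\<lambda>n ij. B n $$ ij", OF _ bd] by blast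
  define L where "L = mat r r l"
  have Lc: "L \<in> carrier_mat r r" by (simp add: L_def)
  have lim: "(\<lambda>n. B (s n) $$ (i, j)) \<longlonglongrightarrow> L $$ (i, j)" if "i < r" "j < r" for i j
    using lim that by (auto simp: L_def)
  have L: "L \<in> \<A>" using limit[of "\<lambda>n. B (s n)", OF B Lc] lim by auto
  have LL: "adj L * L = p"
  proof (rule eq_matI)
    fix i j assume "i < dim_row p" "j < dim_col p"
    then have ij: "i < r" "j < r" using p by auto
    have 1: "(\<lambda>n. (adj (B (s n)) * B (s n)) $$ (i, j)) \<longlonglongrightarrow> (adj L * L) $$ (i, j)"
    proof (rule tendsto_mult_mat_index[where a = r and b = r and c = r])
      fix i j assume "i < r" "j < r"
      then show "(\<lambda>n. adj (B (s n)) $$ (i, j)) \<longlonglongrightarrow> adj L $$ (i, j)"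
        using tendsto_cnj[OF lim[of j i]] Bc Lc by (simp add: carrier_matD[OF Bc])
    qed (use Bc Lc lim ij in auto)
    have "(\<lambda>n. 1 / real (Suc (s n))) \<longlonglongrightarrow> 0"
      using LIMSEQ_subseq_LIMSEQ[OF LIMSEQ_Suc[OF lim_inverse_n'] s] by (simp add: o_def)
    then have "(\<lambda>n. complex_of_real (1 / Suc (s n)) * (if i = j then 1 else 0) + p $$ (i, j))
      \<longlonglongrightarrow> complex_of_real 0 * (if i = j then 1 else 0) + p $$ (i, j)"
      by (intro tendsto_add tendsto_mult tendsto_of_real tendsto_const)
    then have "(\<lambda>n. (adj (B (s n)) * B (s n)) $$ (i, j)) \<longlonglongrightarrow> p $$ (i, j)"
      using idx[OF ij] by simp
    then show "(adj L * L) $$ (i, j) = p $$ (i, j)" using 1 LIMSEQ_unique by blast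
  qed (use Lc p in auto)
  define y where "y = L * z"
  have y: "y \<in> carrier_mat r 1" using Lc z by (simp add: y_def)
  \<comment> \<open>\<open>L\<close> vanishes on the complement of \<open>z\<close>, because its Gram matrix does.\<close>
  have "adj (L - L * p) * (L - L * p) = adj L * L - p * (adj L * L) - (adj L * L * p - p * (adj L * L) * p)"
    using Lc p proj by (simp add: mat_simps)
  also have "\<dots> = 0\<^sub>m r r" unfolding LL using p proj by (intro eq_matI) auto
  finally have "L - L * p = 0\<^sub>m (dim_row L) (dim_col L)"
    using adj_mult_self_eq_0[of "L - L * p"] Lc p by simp
  then have "L = L * p" by (rule diff_eq_0_mat) (use Lc p in simp_all)
  also have "L * p = y * adj z" using Lc z by (simp add: y_def p_def mult_assoc_dim)
  finally have Lyz: "L = y * adj z" .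
  have "adj y * y = adj z * (adj L * L) * z" using Lc z by (simp add: y_def mat_simps)
  also have "\<dots> = 1\<^sub>m 1" unfolding LL using proj z by simp
  finally have yy: "adj y * y = 1\<^sub>m 1" .
  have "y \<noteq> 0\<^sub>m r 1"
  proof
    assume "y = 0\<^sub>m r 1"
    then have "adj y * y = 0\<^sub>m 1 1" by (simp only: right_mult_zero_mat') simp
    then have "(1\<^sub>m 1 :: complex mat) $$ (0, 0) = (0\<^sub>m 1 1 :: complex mat) $$ (0, 0)" using yy by simp
    then show False by simp
  qed
  have yB: "y = (L * B1) * e" using Lc in_carrier[OF B1] e by (simp add: y_def z_def mult_assoc_dim)
  then obtain C where C: "C \<in> \<A>" "e = C * y"
    using minimal[of "L * B1"] mult[OF L B1] \<open>y \<noteq> 0\<^sub>m r 1\<close> by metis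
  have "B1 * C * L = B1 * (C * y) * adj z"
    using in_carrier[OF B1] in_carrier[OF C(1)] y z by (simp add: Lyz mult_assoc_dim)
  also have "\<dots> = p" using C by (simp add: p_def z_def)
  finally show ?thesis using mult[OF mult[OF B1 C(1)] L] by (simp add: p_def z_def)
qed

text \<open>The preceding lemma, freed from the normalisation of the vector by rescaling.\<close>

lemma orbit_rank_one:
  assumes e: "e \<in> carrier_mat r 1"
    and minimal: "\<And>B. B \<in> \<A> \<Longrightarrow> B * e \<noteq> 0\<^sub>m r 1 \<Longrightarrow> \<exists>C\<in>\<A>. e = C * (B * e)"
    and gram: "\<And>B1 \<epsilon>. B1 \<in> \<A> \<Longrightarrow> adj (B1 * e) * (B1 * e) = 1\<^sub>m 1 \<Longrightarrow> \<epsilon> > 0 \<Longrightarrow>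
      \<exists>B\<in>\<A>. adj B * B = of_real \<epsilon> \<cdot>\<^sub>m 1\<^sub>m r + (B1 * e) * adj (B1 * e)"
    and B1: "B1 \<in> \<A>"
  shows "(B1 * e) * adj (B1 * e) \<in> \<A>"
proof (cases "B1 * e = 0\<^sub>m r 1")
  case True
  have "0\<^sub>m r 1 * adj (0\<^sub>m r 1) = 0\<^sub>m r r" by (subst left_mult_zero_mat') simp_all
  also have "\<dots> = 0 \<cdot>\<^sub>m 1\<^sub>m r" by (rule eq_matI) simp_all
  finally have "0\<^sub>m r 1 * adj (0\<^sub>m r 1) = 0 \<cdot>\<^sub>m 1\<^sub>m r" .
  then show ?thesis unfolding True using smult[OF one, of 0] by metis
next
  case False
  note B1c = in_carrier[OF B1]
  obtain n where n: "n > 0" "adj (B1 * e) * (B1 * e) = complex_of_real n \<cdot>\<^sub>m 1\<^sub>m 1"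
    using norm_square_column[OF mult_carrier_mat[OF B1c e] False] by blast
  obtain c where cc: "c * c * complex_of_real n = 1" "cnj c = c"
    using inverse_sqrt_scalar[OF n(1)] by blast
  have eq: "c \<cdot>\<^sub>m B1 * e = c \<cdot>\<^sub>m (B1 * e)" using B1c e by (simp add: smult_mult_dim)
  have "adj (c \<cdot>\<^sub>m B1 * e) * (c \<cdot>\<^sub>m B1 * e) = (c * c) \<cdot>\<^sub>m (adj (B1 * e) * (B1 * e))"
    unfolding eq adj_smult cc(2) using B1c e
    by (simp add: smult_mult_dim mult_smult_dim smult_smult_mat)
  also have "\<dots> = 1\<^sub>m 1" unfolding n(2) smult_smult_mat cc(1) by (rule one_smult_mat)
  finally have unit: "adj (c \<cdot>\<^sub>m B1 * e) * (c \<cdot>\<^sub>m B1 * e) = 1\<^sub>m 1" .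
  have "(c \<cdot>\<^sub>m B1 * e) * adj (c \<cdot>\<^sub>m B1 * e) \<in> \<A>"
    by (rule unit_orbit_projection[OF e minimal smult[OF B1] unit gram[OF smult[OF B1] unit]])
  then have "complex_of_real n \<cdot>\<^sub>m ((c \<cdot>\<^sub>m B1 * e) * adj (c \<cdot>\<^sub>m B1 * e)) \<in> \<A>" by (rule smult)
  also have "complex_of_real n \<cdot>\<^sub>m ((c \<cdot>\<^sub>m B1 * e) * adj (c \<cdot>\<^sub>m B1 * e))
    = (complex_of_real n * (c * c)) \<cdot>\<^sub>m ((B1 * e) * adj (B1 * e))"
    unfolding eq adj_smult cc(2) using B1c e
    by (simp add: smult_mult_dim mult_smult_dim smult_smult_mat)
  also have "complex_of_real n * (c * c) = 1" using cc(1) by (simp only: mult.commute)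
  finally show ?thesis by (simp only: one_smult_mat)
qed

text \<open>If the Gram matrix of \<open>B\<close> is that of a matrix commuting with \<open>e e\<^sup>*\<close>, then the unitary
  in \<open>\<A>\<close> that rotates \<open>B e\<close> back to a multiple of \<open>e\<close> makes \<open>B\<close> commute with \<open>e e\<^sup>*\<close> without
  changing the Gram matrix.\<close>

lemma gram_complete_insert:
  assumes e: "e \<in> carrier_mat r 1" "adj e * e = 1\<^sub>m 1"
    and rank1: "\<And>B. B \<in> \<A> \<Longrightarrow> (B * e) * adj (B * e) \<in> \<A>"
    and gc: "gram_complete r F \<A>"
  shows "gram_complete r (insert (e * adj e) F) {B \<in> \<A>. B * (e * adj e) = e * adj e * B}"
  unfolding gram_complete_def
proof (intro ballI impI)
  define q where "q = e * adj e"
  have q: "q \<in> carrier_mat r r" using e by (simp add: q_def)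
  have qe: "q * e = e" "adj e * q = adj e" "adj q = q" using column_projection[OF e] by (auto simp: q_def)
  fix C C' assume C: "C \<in> carrier_mat r r" and C': "C' \<in> carrier_mat r r" "C' * C = 1\<^sub>m r"
    and comm: "\<forall>P\<in>insert (e * adj e) F. C * P = P * C"
  then have qC: "C * q = q * C" by (simp add: q_def)
  obtain B where B: "B \<in> \<A>" "adj B * B = adj C * C"
    using gc C C' comm unfolding gram_complete_def by blast
  note Bc = in_carrier[OF B(1)]
  define c where "c = (adj e * (C * e)) $$ (0, 0)"
  have c: "adj e * (C * e) = c \<cdot>\<^sub>m 1\<^sub>m 1" using one_by_one_mat[of "adj e * (C * e)"] e C by (simp add: c_def)
  have "C * e = C * q * e" using C q qe e by (simp add: mult_assoc_dim)
  also have "\<dots> = e * (adj e * (C * e))" unfolding qC using C e by (simp add: q_def mult_assoc_dim)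
  also have "\<dots> = c \<cdot>\<^sub>m e" unfolding c by (rule column_mult_scalar[OF e(1)])
  finally have Ce: "C * e = c \<cdot>\<^sub>m e" .
  have "adj C * q = adj (q * C)" using C q qe by (simp add: adj_mult)
  also have "\<dots> = q * adj C" unfolding qC[symmetric] using C q qe by (simp add: adj_mult)
  finally have qC': "adj C * q = q * adj C" .
  have "adj C * e = adj C * q * e" using C q qe e by (simp add: mult_assoc_dim)
  also have "\<dots> = e * adj (adj e * (C * e))" unfolding qC' using C e by (simp add: q_def mat_simps)
  also have "\<dots> = cnj c \<cdot>\<^sub>m e" unfolding c adj_smult adj_one by (rule column_mult_scalar[OF e(1)])
  finally have Ce': "adj C * e = cnj c \<cdot>\<^sub>m e" .
  have c0: "c \<noteq> 0"
  proof
    assume "c = 0"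
    then have 0: "C * e = 0\<^sub>m r 1" using Ce e by (auto intro!: eq_matI)
    have "e = C' * (C * e)" using C C' e by (simp flip: mult_assoc_dim)
    also have "\<dots> = 0\<^sub>m r 1" unfolding 0 using C' by simp
    finally have "adj e * e = 0\<^sub>m 1 1" using e(1) by (simp only: right_mult_zero_mat') simp
    then have "(1\<^sub>m 1 :: complex mat) $$ (0, 0) = (0\<^sub>m 1 1 :: complex mat) $$ (0, 0)" using e(2) by simp
    then show False by simp
  qed
  define g where "g = inverse c \<cdot>\<^sub>m (B * e)"
  have g: "g \<in> carrier_mat r 1" using Bc e by (simp add: g_def)
  have Be: "B * e = c \<cdot>\<^sub>m g" using c0 by (simp add: g_def smult_smult_mat one_smult_mat)
  have "adj (B * e) * (B * e) = adj e * (adj B * B) * e" using Bc e(1) by (simp add: mat_simps)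
  also have "\<dots> = adj (C * e) * (C * e)" unfolding B(2) using C e(1) by (simp add: mat_simps)
  also have "\<dots> = (c * cnj c) \<cdot>\<^sub>m 1\<^sub>m 1" unfolding Ce using e by (simp add: mat_simps)
  finally have BeBe: "adj (B * e) * (B * e) = (c * cnj c) \<cdot>\<^sub>m 1\<^sub>m 1" .
  have "adj g * g = (inverse c * cnj (inverse c)) \<cdot>\<^sub>m (adj (B * e) * (B * e))"
    unfolding g_def using Bc e(1) by (simp add: adj_smult smult_mult_dim mult_smult_dim smult_smult_mat)
  also have "\<dots> = (inverse c * cnj (inverse c) * (c * cnj c)) \<cdot>\<^sub>m 1\<^sub>m 1"
    unfolding BeBe by (rule smult_smult_mat)
  also have "inverse c * cnj (inverse c) * (c * cnj c) = 1" using c0 by (simp add: field_simps)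
  also have "1 \<cdot>\<^sub>m 1\<^sub>m 1 = (1\<^sub>m 1 :: complex mat)" by (rule one_smult_mat)
  finally have gg: "adj g * g = 1\<^sub>m 1" .
  define v where "v = g - e"
  obtain a where a: "adj (1\<^sub>m r + a \<cdot>\<^sub>m (v * adj v)) * (1\<^sub>m r + a \<cdot>\<^sub>m (v * adj v)) = 1\<^sub>m r"
      "(1\<^sub>m r + a \<cdot>\<^sub>m (v * adj v)) * g = e"
    using reflection_exists[OF g gg e] unfolding Let_def v_def by auto
  define w where "w = 1\<^sub>m r + a \<cdot>\<^sub>m (v * adj v)"
  have v: "v = (inverse c \<cdot>\<^sub>m B - 1\<^sub>m r) * e"
    unfolding v_def g_def using Bc e(1) by (simp add: minus_mult_dim smult_mult_dim)
  have "v * adj v \<in> \<A>" unfolding v by (rule rank1) (use B(1) one minus smult in auto)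
  then have w: "w \<in> \<A>" unfolding w_def by (intro add one smult)
  note wc = in_carrier[OF w]
  have ww: "adj w * w = 1\<^sub>m r" "w * g = e" using a by (simp_all add: w_def)
  \<comment> \<open>\<open>D\<close> has \<open>e\<close> as an eigenvector with the eigenvalue \<open>c\<close> of \<open>C\<close>, so \<open>D\<^sup>* D = C\<^sup>* C\<close> makes \<open>e\<close> an
    eigenvector of \<open>D\<^sup>*\<close> too.\<close>
  define D where "D = w * B"
  have D: "D \<in> \<A>" unfolding D_def by (rule mult[OF w B(1)])
  note Dc = in_carrier[OF D]
  have "adj D * D = adj B * (adj w * w) * B" unfolding D_def using wc Bc by (simp add: mat_simps)
  also have "\<dots> = adj C * C" unfolding ww using Bc B(2) by simp
  finally have DD: "adj D * D = adj C * C" .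
  have "D * e = w * (B * e)" unfolding D_def using wc Bc e by (simp add: mult_assoc_dim)
  also have "\<dots> = c \<cdot>\<^sub>m e" unfolding Be using wc g ww(2) by (simp add: mult_smult_dim)
  finally have De: "D * e = c \<cdot>\<^sub>m e" .
  have "c \<cdot>\<^sub>m (adj D * e) = adj D * (D * e)" unfolding De using Dc e by (simp add: mult_smult_dim)
  also have "\<dots> = adj C * (C * e)" using DD Dc C e(1) by (simp flip: mult_assoc_dim)
  also have "\<dots> = c \<cdot>\<^sub>m (cnj c \<cdot>\<^sub>m e)" unfolding Ce using C e(1) by (simp add: mult_smult_dim Ce')
  finally have "inverse c \<cdot>\<^sub>m (c \<cdot>\<^sub>m (adj D * e)) = inverse c \<cdot>\<^sub>m (c \<cdot>\<^sub>m (cnj c \<cdot>\<^sub>m e))" by simp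
  then have De': "adj D * e = cnj c \<cdot>\<^sub>m e" using c0 by (simp add: smult_smult_mat one_smult_mat flip: mult.assoc)
  have "adj e * D = adj (adj D * e)" using Dc e by (simp add: adj_mult)
  also have "\<dots> = c \<cdot>\<^sub>m adj e" unfolding De' by (simp add: adj_smult)
  finally have eD: "adj e * D = c \<cdot>\<^sub>m adj e" .
  have "D * q = D * e * adj e" using Dc e(1) by (simp add: q_def mult_assoc_dim)
  also have "\<dots> = e * (adj e * D)" unfolding De eD using e(1) by (simp add: smult_mult_dim mult_smult_dim)
  also have "\<dots> = q * D" using Dc e(1) by (simp add: q_def mult_assoc_dim)
  finally have "D * q = q * D" .
  then show "\<exists>B\<in>{B \<in> \<A>. B * (e * adj e) = e * adj e * B}. adj B * B = adj C * C"
    using D DD by (auto simp: q_def)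
qed

lemma orthogonal_column_exists:
  fixes f :: "nat \<Rightarrow> complex mat"
  assumes "m < r" and f: "\<And>k. k < m \<Longrightarrow> f k \<in> carrier_mat r 1"
  shows "\<exists>x\<in>carrier_mat r 1. x \<noteq> 0\<^sub>m r 1 \<and> (\<forall>k<m. adj (f k) * x = 0\<^sub>m 1 1)"
proof -
  obtain v where v: "\<exists>j<r. v j \<noteq> 0" "\<And>k. k < m \<Longrightarrow> (\<Sum>j<r. cnj (f k $$ (j, 0)) * v j) = 0"
    using wide_matrix_kernel[OF assms(1), of "\<lambda>k j. cnj (f k $$ (j, 0))"] by auto
  define x where "x = mat r 1 (\<lambda>(j, _). v j)"
  have x: "x \<in> carrier_mat r 1" by (simp add: x_def)
  have "adj (f k) * x = 0\<^sub>m 1 1" if k: "k < m" for k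
  proof (rule eq_matI)
    fix i j assume "i < dim_row (0\<^sub>m 1 1 :: complex mat)" "j < dim_col (0\<^sub>m 1 1 :: complex mat)"
    then have "i = 0" "j = 0" by auto
    then show "(adj (f k) * x) $$ (i, j) = 0\<^sub>m 1 1 $$ (i, j)"
      using f[OF k] v(2)[OF k] by (simp add: mult_index x_def)
  qed (use f[OF k] x in auto)
  moreover have "x \<noteq> 0\<^sub>m r 1"
  proof
    assume "x = 0\<^sub>m r 1"
    then have "x $$ (j, 0) = 0" if "j < r" for j using that by simp
    then show False using v(1) by (auto simp: x_def)
  qed
  ultimately show ?thesis using x by blast
qed

text \<open>The step of the induction: \<open>\<A>\<close> already commutes with the projections onto \<open>f\<^sub>0, \<dots>, f\<^sub>m\<^sub>-\<^sub>1\<close>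
  and therefore acts on their common orthogonal complement, where a minimal orbit is chosen.\<close>

lemma next_orthogonal_projection:
  fixes f :: "nat \<Rightarrow> complex mat"
  assumes m: "m < r" and f: "\<And>k. k < m \<Longrightarrow> f k \<in> carrier_mat r 1" "\<And>k. k < m \<Longrightarrow> adj (f k) * f k = 1\<^sub>m 1"
    and comm: "\<And>B k. B \<in> \<A> \<Longrightarrow> k < m \<Longrightarrow> B * (f k * adj (f k)) = f k * adj (f k) * B"
    and gc: "gram_complete r ((\<lambda>k. f k * adj (f k)) ` {..<m}) \<A>"
  shows "\<exists>e\<in>carrier_mat r 1. adj e * e = 1\<^sub>m 1 \<and> (\<forall>k<m. adj (f k) * e = 0\<^sub>m 1 1) \<and> e * adj e \<in> \<A> \<and>
    gram_complete r (insert (e * adj e) ((\<lambda>k. f k * adj (f k)) ` {..<m})) {B \<in> \<A>. B * (e * adj e) = e * adj e * B}"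
proof -
  define H where "H = {x \<in> carrier_mat r 1. x \<noteq> 0\<^sub>m r 1 \<and> (\<forall>k<m. adj (f k) * x = 0\<^sub>m 1 1)}"
  have orth: "adj (f k) * (B * x) = 0\<^sub>m 1 1"
    if x: "x \<in> carrier_mat r 1" "adj (f k) * x = 0\<^sub>m 1 1" and B: "B \<in> \<A>" and k: "k < m" for B x k
  proof -
    note fk = f[OF k] and Bc = in_carrier[OF B]
    have "adj (f k) * (B * x) = adj (f k) * f k * adj (f k) * B * x"
      using fk Bc x(1) by (simp add: mult_assoc_dim)
    also have "\<dots> = adj (f k) * (f k * adj (f k) * B) * x" using fk(1) Bc x(1) by (simp add: mult_assoc_dim)
    also have "\<dots> = adj (f k) * B * f k * (adj (f k) * x)"
      unfolding comm[OF B k, symmetric] using fk(1) Bc x(1) by (simp add: mult_assoc_dim)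
    also have "\<dots> = 0\<^sub>m 1 1" unfolding x(2) using fk Bc by simp
    finally show ?thesis .
  qed
  obtain x0 where "x0 \<in> H" using orthogonal_column_exists[of m f] m f(1) unfolding H_def by blast
  moreover have "H \<subseteq> carrier_mat r 1" by (auto simp: H_def)
  moreover have "B * x \<in> H" if "x \<in> H" "B \<in> \<A>" "B * x \<noteq> 0\<^sub>m r 1" for x B
    using that orth[OF _ _ that(2)] in_carrier[OF that(2)] by (auto simp: H_def)
  ultimately obtain e0 where e0: "e0 \<in> H"
    and min0: "\<And>B. B \<in> \<A> \<Longrightarrow> B * e0 \<noteq> 0\<^sub>m r 1 \<Longrightarrow> \<exists>C\<in>\<A>. e0 = C * (B * e0)"
    using minimal_orbit_exists[of H x0] by blast
  have e0c: "e0 \<in> carrier_mat r 1" "e0 \<noteq> 0\<^sub>m r 1" and e0f: "\<And>k. k < m \<Longrightarrow> adj (f k) * e0 = 0\<^sub>m 1 1"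
    using e0 by (auto simp: H_def)
  obtain n where n: "n > 0" "adj e0 * e0 = complex_of_real n \<cdot>\<^sub>m 1\<^sub>m 1"
    using norm_square_column[OF e0c] by blast
  obtain c where cc: "c * c * complex_of_real n = 1" "cnj c = c"
    using inverse_sqrt_scalar[OF n(1)] by blast
  have c0: "c \<noteq> 0" using cc by auto
  define e where "e = c \<cdot>\<^sub>m e0"
  have e: "e \<in> carrier_mat r 1" using e0c by (simp add: e_def)
  have "adj e * e = (c * c) \<cdot>\<^sub>m (adj e0 * e0)"
    unfolding e_def adj_smult cc(2) using e0c by (simp add: smult_mult_dim mult_smult_dim smult_smult_mat)
  also have "\<dots> = 1\<^sub>m 1" unfolding n(2) smult_smult_mat cc(1) by (rule one_smult_mat)
  finally have ee: "adj e * e = 1\<^sub>m 1" .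
  have ef: "adj (f k) * e = 0\<^sub>m 1 1" if k: "k < m" for k
    unfolding e_def using e0f[OF k] e0c f(1)[OF k] by (simp add: mult_smult_dim)
  have minimal: "\<exists>C\<in>\<A>. e = C * (B * e)" if B: "B \<in> \<A>" "B * e \<noteq> 0\<^sub>m r 1" for B
  proof -
    have eq: "B * e = c \<cdot>\<^sub>m (B * e0)" unfolding e_def using in_carrier[OF B(1)] e0c by (simp add: mult_smult_dim)
    have "B * e0 \<noteq> 0\<^sub>m r 1" using B(2) unfolding eq by auto
    then obtain C where C: "C \<in> \<A>" "e0 = C * (B * e0)" using min0[OF B(1)] by blast
    have "C * (B * e) = c \<cdot>\<^sub>m (C * (B * e0))"
      unfolding eq using in_carrier[OF B(1)] in_carrier[OF C(1)] e0c by (simp add: mult_smult_dim)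
    also have "\<dots> = e" unfolding C(2)[symmetric] e_def ..
    finally show ?thesis using C(1) by metis
  qed
  have gram: "\<exists>B\<in>\<A>. adj B * B = of_real \<epsilon> \<cdot>\<^sub>m 1\<^sub>m r + (B1 * e) * adj (B1 * e)"
    if B1: "B1 \<in> \<A>" "adj (B1 * e) * (B1 * e) = 1\<^sub>m 1" and eps: "\<epsilon> > 0" for B1 \<epsilon>
  proof (rule gram_complete_perturbed_projection[OF gc _ B1(2) _ _ eps])
    define z where "z = B1 * e"
    show z: "B1 * e \<in> carrier_mat r 1" using in_carrier[OF B1(1)] e by simp
    then have zc: "z \<in> carrier_mat r 1" by (simp add: z_def)
    show "(\<lambda>k. f k * adj (f k)) ` {..<m} \<subseteq> carrier_mat r r" using f(1) by fastforce
    fix P assume "P \<in> (\<lambda>k. f k * adj (f k)) ` {..<m}"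
    then obtain k where k: "k < m" "P = f k * adj (f k)" by auto
    have fz: "adj (f k) * z = 0\<^sub>m 1 1" unfolding z_def by (rule orth[OF e ef[OF k(1)] B1(1) k(1)])
    have "adj (adj (f k) * z) = 0\<^sub>m 1 1" unfolding fz by (rule eq_matI) auto
    then have zf: "adj z * f k = 0\<^sub>m 1 1" using zc f(1)[OF k(1)] by (simp add: adj_mult)
    have "z * adj z * P = z * (adj z * f k) * adj (f k)"
      unfolding k(2) using zc f(1)[OF k(1)] by (simp add: mult_assoc_dim)
    also have "\<dots> = 0\<^sub>m r r" unfolding zf using zc f(1)[OF k(1)] by simp
    finally have 1: "z * adj z * P = 0\<^sub>m r r" .
    have "P * (z * adj z) = f k * (adj (f k) * z) * adj z"
      unfolding k(2) using zc f(1)[OF k(1)] by (simp add: mult_assoc_dim)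
    also have "\<dots> = 0\<^sub>m r r" unfolding fz using zc f(1)[OF k(1)] by simp
    finally show "B1 * e * adj (B1 * e) * P = P * (B1 * e * adj (B1 * e))" using 1 by (simp add: z_def)
  qed
  have rank1: "(B * e) * adj (B * e) \<in> \<A>" if "B \<in> \<A>" for B
    by (rule orbit_rank_one[OF e minimal gram that])
  have "e * adj e \<in> \<A>" using rank1[OF one] e by simp
  then show ?thesis using e ee ef gram_complete_insert[OF e ee rank1 gc] by blast
qed

text \<open>One projection is split off at a time.  The induction runs over the number of projections
  found rather than over the size of the matrices: the commutant of the projections so far plays
  the part of a smaller matrix algebra.\<close>

lemma diagonal_projections_in_algebra:
  assumes "gram_complete r {} \<A>"
  shows "\<exists>f. (\<forall>k<r. f k \<in> carrier_mat r 1 \<and> f k * adj (f k) \<in> \<A>) \<and>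
    (\<forall>k<r. \<forall>l<r. adj (f k) * f l = (if k = l then 1\<^sub>m 1 else 0\<^sub>m 1 1))"
proof -
  have "\<exists>f. (\<forall>k<m. f k \<in> carrier_mat r 1 \<and> f k * adj (f k) \<in> \<A>) \<and>
    (\<forall>k<m. \<forall>l<m. adj (f k) * f l = (if k = l then 1\<^sub>m 1 else 0\<^sub>m 1 1)) \<and>
    gram_complete r ((\<lambda>k. f k * adj (f k)) ` {..<m})
      {B \<in> \<A>. \<forall>P\<in>(\<lambda>k. f k * adj (f k)) ` {..<m}. B * P = P * B}" if "m \<le> r" for m
    using that
  proof (induction m)
    case 0
    then show ?case using assms by simp
  next
    case (Suc m)
    then obtain f where f: "\<And>k. k < m \<Longrightarrow> f k \<in> carrier_mat r 1" "\<And>k. k < m \<Longrightarrow> f k * adj (f k) \<in> \<A>"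
      "\<And>k l. k < m \<Longrightarrow> l < m \<Longrightarrow> adj (f k) * f l = (if k = l then 1\<^sub>m 1 else 0\<^sub>m 1 1)"
      "gram_complete r ((\<lambda>k. f k * adj (f k)) ` {..<m})
        {B \<in> \<A>. \<forall>P\<in>(\<lambda>k. f k * adj (f k)) ` {..<m}. B * P = P * B}" by auto
    interpret sub: closed_matrix_algebra r "{B \<in> \<A>. \<forall>P\<in>(\<lambda>k. f k * adj (f k)) ` {..<m}. B * P = P * B}"
      by (rule commutant_subalgebra) (use f(1) in fastforce)
    have "\<exists>e\<in>carrier_mat r 1. adj e * e = 1\<^sub>m 1 \<and> (\<forall>k<m. adj (f k) * e = 0\<^sub>m 1 1) \<and>
      e * adj e \<in> {B \<in> \<A>. \<forall>P\<in>(\<lambda>k. f k * adj (f k)) ` {..<m}. B * P = P * B} \<and>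
      gram_complete r (insert (e * adj e) ((\<lambda>k. f k * adj (f k)) ` {..<m}))
        {B \<in> {B \<in> \<A>. \<forall>P\<in>(\<lambda>k. f k * adj (f k)) ` {..<m}. B * P = P * B}. B * (e * adj e) = e * adj e * B}"
      by (rule sub.next_orthogonal_projection) (use Suc.prems f in auto)
    then obtain e where e: "e \<in> carrier_mat r 1" "adj e * e = 1\<^sub>m 1" "\<And>k. k < m \<Longrightarrow> adj (f k) * e = 0\<^sub>m 1 1"
      "e * adj e \<in> \<A>"
      "gram_complete r (insert (e * adj e) ((\<lambda>k. f k * adj (f k)) ` {..<m}))
        {B \<in> {B \<in> \<A>. \<forall>P\<in>(\<lambda>k. f k * adj (f k)) ` {..<m}. B * P = P * B}. B * (e * adj e) = e * adj e * B}"
      by blast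
    define f' where "f' = f(m := e)"
    have im: "(\<lambda>k. f' k * adj (f' k)) ` {..<Suc m} = insert (e * adj e) ((\<lambda>k. f k * adj (f k)) ` {..<m})"
      unfolding f'_def lessThan_Suc by (auto simp: image_iff)
    have set: "{B \<in> \<A>. \<forall>P\<in>insert (e * adj e) ((\<lambda>k. f k * adj (f k)) ` {..<m}). B * P = P * B}
      = {B \<in> {B \<in> \<A>. \<forall>P\<in>(\<lambda>k. f k * adj (f k)) ` {..<m}. B * P = P * B}. B * (e * adj e) = e * adj e * B}"
      by blast
    have ef: "adj e * f k = 0\<^sub>m 1 1" if k: "k < m" for k
    proof -
      have "adj e * f k = adj (adj (f k) * e)" using e(1) f(1)[OF k] by (simp add: adj_mult)
      also have "\<dots> = 0\<^sub>m 1 1" unfolding e(3)[OF k] by (rule eq_matI) auto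
      finally show ?thesis .
    qed
    show ?case
    proof (intro exI[of _ f'] conjI allI impI)
      fix k l assume kl: "k < Suc m" "l < Suc m"
      show "adj (f' k) * f' l = (if k = l then 1\<^sub>m 1 else 0\<^sub>m 1 1)"
        using kl f(3)[of k l] e(2,3) ef by (auto simp: f'_def less_Suc_eq)
    next
      fix k assume "k < Suc m"
      then show "f' k \<in> carrier_mat r 1" "f' k * adj (f' k) \<in> \<A>"
        using f e by (auto simp: f'_def less_Suc_eq)
    next
      show "gram_complete r ((\<lambda>k. f' k * adj (f' k)) ` {..<Suc m})
        {B \<in> \<A>. \<forall>P\<in>(\<lambda>k. f' k * adj (f' k)) ` {..<Suc m}. B * P = P * B}"
        unfolding im set by (rule e(5))
    qed
  qed
  from this[of r] show ?thesis by blast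
qed

end

section \<open>Positive semidefinite matrices as Gram matrices\<close>

lemma psd_iff_columns:
  "psd n A \<longleftrightarrow> A \<in> carrier_mat n n \<and> (\<forall>x\<in>carrier_mat n 1. 0 \<le> (adj x * A * x) $$ (0, 0))"
proof -
  have eq: "(A *\<^sub>v v) \<bullet>c v = (adj x * A * x) $$ (0, 0)"
    if A: "A \<in> carrier_mat n n" and v: "v \<in> carrier_vec n" and x: "x \<in> carrier_mat n 1"
      and vx: "\<And>i. i < n \<Longrightarrow> v $ i = x $$ (i, 0)" for x v
  proof -
    have "(adj x * A * x) $$ (0, 0) = (adj x * (A * x)) $$ (0, 0)" using A x by (simp add: mult_assoc_dim)
    also have "\<dots> = (\<Sum>i<n. cnj (x $$ (i, 0)) * (\<Sum>j<n. A $$ (i, j) * x $$ (j, 0)))"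
      using A x by (simp add: mult_index)
    also have "\<dots> = (A *\<^sub>v v) \<bullet>c v"
      using A v vx by (simp add: scalar_prod_def atLeast0LessThan mult.commute)
    finally show ?thesis by simp
  qed
  show ?thesis
  proof
    assume *: "psd n A"
    then have A: "A \<in> carrier_mat n n" by (simp add: psd_def)
    have "0 \<le> (adj x * A * x) $$ (0, 0)" if x: "x \<in> carrier_mat n 1" for x
    proof -
      have "0 \<le> (A *\<^sub>v vec n (\<lambda>i. x $$ (i, 0))) \<bullet>c vec n (\<lambda>i. x $$ (i, 0))"
        using * vec_carrier unfolding psd_def by blast
      then show ?thesis using eq[OF A _ x, of "vec n (\<lambda>i. x $$ (i, 0))"] by simp
    qed
    then show "A \<in> carrier_mat n n \<and> (\<forall>x\<in>carrier_mat n 1. 0 \<le> (adj x * A * x) $$ (0, 0))" using A by blast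
  next
    assume *: "A \<in> carrier_mat n n \<and> (\<forall>x\<in>carrier_mat n 1. 0 \<le> (adj x * A * x) $$ (0, 0))"
    then have A: "A \<in> carrier_mat n n" by simp
    have "0 \<le> (A *\<^sub>v v) \<bullet>c v" if v: "v \<in> carrier_vec n" for v
      using * eq[OF A v, of "mat n 1 (\<lambda>(i, _). v $ i)"] by auto
    then show "psd n A" using A by (auto simp: psd_def)
  qed
qed

lemma mult_carrier_iff [simp]:
  "A * B \<in> carrier_mat m n \<longleftrightarrow> dim_row A = m \<and> dim_col (B :: complex mat) = n"
  by (metis carrier_matD carrier_matI index_mult_mat(2,3))

lemma psd_carrier: "psd n A \<Longrightarrow> A \<in> carrier_mat n n"
  by (simp add: psd_def)

lemma psd_gram: "M \<in> carrier_mat s n \<Longrightarrow> psd n (adj M * M)"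
  unfolding psd_iff_columns
proof (intro conjI ballI)
  fix x :: "complex mat" assume M: "M \<in> carrier_mat s n" and x: "x \<in> carrier_mat n 1"
  have "adj x * (adj M * M) * x = adj (M * x) * (M * x)" using M x by (simp add: mat_simps)
  then show "0 \<le> (adj x * (adj M * M) * x) $$ (0, 0)"
    using adj_mult_self_diag[of 0 "M * x"] x by (simp add: less_eq_complex_def sum_nonneg)
qed simp

lemma psd_congruence:
  assumes "psd n A" "M \<in> carrier_mat n m"
  shows "psd m (adj M * A * M)"
  unfolding psd_iff_columns
proof (intro conjI ballI)
  note A = psd_carrier[OF assms(1)] and M = assms(2)
  show "adj M * A * M \<in> carrier_mat m m" using A M by simp
  fix x :: "complex mat" assume x: "x \<in> carrier_mat m 1"
  have "adj x * (adj M * A * M) * x = adj (M * x) * A * (M * x)" using A M x by (simp add: mat_simps)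
  then show "0 \<le> (adj x * (adj M * A * M) * x) $$ (0, 0)"
    using assms(1) M x unfolding psd_iff_columns by simp
qed

lemma psd_add:
  assumes "psd n A" "psd n B"
  shows "psd n (A + B)"
proof -
  note c = psd_carrier[OF assms(1)] psd_carrier[OF assms(2)]
  have "adj x * (A + B) * x = adj x * A * x + adj x * B * x" if "x \<in> carrier_mat n 1" for x
    using that c by (simp add: mult_add_dim add_mult_dim)
  then show ?thesis using assms c unfolding psd_iff_columns by auto
qed

lemma psd_smult:
  assumes "psd n A" "0 \<le> c"
  shows "psd n (c \<cdot>\<^sub>m A)"
proof -
  note A = psd_carrier[OF assms(1)]
  have "adj x * (c \<cdot>\<^sub>m A) * x = c \<cdot>\<^sub>m (adj x * A * x)" if "x \<in> carrier_mat n 1" for x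
    using that A by (simp add: smult_mult_dim mult_smult_dim)
  then show ?thesis using assms A unfolding psd_iff_columns by (auto intro: mult_nonneg_nonneg)
qed

definition unit_column :: "nat \<Rightarrow> nat \<Rightarrow> complex mat" where
  "unit_column n i = mat n 1 (\<lambda>(a, _). if a = i then 1 else 0)"

lemma unit_column_carrier [simp]: "unit_column n i \<in> carrier_mat n (Suc 0)"
  by (simp add: unit_column_def)

lemma unit_column_dim [simp]: "dim_row (unit_column n i) = n" "dim_col (unit_column n i) = Suc 0"
  by (simp_all add: unit_column_def)

lemma mult_unit_column:
  assumes "A \<in> carrier_mat m n" "a < m" "j < n"
  shows "(A * unit_column n j) $$ (a, 0) = A $$ (a, j)"
proof -
  have "(A * unit_column n j) $$ (a, 0) = (\<Sum>k<n. A $$ (a, k) * unit_column n j $$ (k, 0))"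
    using assms by (simp add: mult_index)
  also have "\<dots> = (\<Sum>k<n. if k = j then A $$ (a, k) else 0)"
    by (rule sum.cong) (auto simp: unit_column_def)
  finally show ?thesis using assms by simp
qed

lemma unit_column_mult:
  assumes "A \<in> carrier_mat n m" "a < m" "i < n"
  shows "(adj (unit_column n i) * A) $$ (0, a) = A $$ (i, a)"
proof -
  have "(adj (unit_column n i) * A) $$ (0, a) = (\<Sum>k<n. cnj (unit_column n i $$ (k, 0)) * A $$ (k, a))"
    using assms by (simp add: mult_index)
  also have "\<dots> = (\<Sum>k<n. if k = i then A $$ (k, a) else 0)"
    by (rule sum.cong) (auto simp: unit_column_def)
  finally show ?thesis using assms by simp
qed

lemma matrix_coefficient:
  assumes "A \<in> carrier_mat n n" "i < n" "j < n"
  shows "adj (unit_column n i) * A * unit_column n j = A $$ (i, j) \<cdot>\<^sub>m 1\<^sub>m 1"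
proof -
  have "adj (unit_column n i) * A \<in> carrier_mat 1 n" using assms by simp
  then have "(adj (unit_column n i) * A * unit_column n j) $$ (0, 0) = A $$ (i, j)"
    using mult_unit_column[of "adj (unit_column n i) * A" 1 n 0 j] unit_column_mult[of A n n j i] assms by simp
  then show ?thesis using one_by_one_mat[of "adj (unit_column n i) * A * unit_column n j"] assms by simp
qed

text \<open>Testing on vectors with two nonzero entries yields the relations between entries that
  positivity implies.\<close>

lemma psd_two_point:
  assumes A: "psd n A" and ij: "i < n" "j < n"
  shows "0 \<le> cnj a * a * A $$ (i, i) + cnj a * b * A $$ (i, j) + cnj b * a * A $$ (j, i) + cnj b * b * A $$ (j, j)"
proof -
  note Ac = psd_carrier[OF A]
  define x where "x = a \<cdot>\<^sub>m unit_column n i + b \<cdot>\<^sub>m unit_column n j"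
  have "adj x * A * x = (cnj a * a) \<cdot>\<^sub>m (adj (unit_column n i) * A * unit_column n i)
      + (cnj a * b) \<cdot>\<^sub>m (adj (unit_column n i) * A * unit_column n j)
      + (cnj b * a) \<cdot>\<^sub>m (adj (unit_column n j) * A * unit_column n i)
      + (cnj b * b) \<cdot>\<^sub>m (adj (unit_column n j) * A * unit_column n j)"
    unfolding x_def using Ac by (intro eq_matI) (auto simp: mat_simps algebra_simps)
  moreover have "0 \<le> (adj x * A * x) $$ (0, 0)" 
    using A unfolding psd_iff_columns by (simp add: x_def)
  ultimately show ?thesis unfolding matrix_coefficient[OF Ac ij(1) ij(1)] matrix_coefficient[OF Ac ij(1) ij(2)]
      matrix_coefficient[OF Ac ij(2) ij(1)] matrix_coefficient[OF Ac ij(2) ij(2)]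
    by simp
qed

lemma psd_diag_nonneg: "psd n A \<Longrightarrow> i < n \<Longrightarrow> 0 \<le> A $$ (i, i)"
  using psd_two_point[of n A i i 1 0] by simp

lemma psd_hermitian:
  assumes A: "psd n A"
  shows "adj A = A"
proof (rule eq_matI)
  note Ac = psd_carrier[OF A]
  fix i j assume "i < dim_row A" "j < dim_col A"
  then have ij: "i < n" "j < n" using Ac by auto
  have im: "Im (A $$ (i, i)) = 0" "Im (A $$ (j, j)) = 0"
    using psd_diag_nonneg[OF A] ij by (auto simp: less_eq_complex_def)
  have "A $$ (j, i) = cnj (A $$ (i, j))"
    using psd_two_point[OF A ij, of 1 1] psd_two_point[OF A ij, of 1 \<i>] im
    by (simp add: complex_eq_iff less_eq_complex_def)
  then show "adj A $$ (i, j) = A $$ (i, j)" using ij Ac by simp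
qed (use psd_carrier[OF A] in auto)

lemma psd_zero_diag:
  assumes A: "psd n A" and "\<And>i. i < n \<Longrightarrow> A $$ (i, i) = 0"
  shows "A = 0\<^sub>m n n"
proof (rule eq_matI)
  note Ac = psd_carrier[OF A]
  fix i j assume "i < dim_row (0\<^sub>m n n :: complex mat)" "j < dim_col (0\<^sub>m n n :: complex mat)"
  then have ij: "i < n" "j < n" by auto
  have ji: "A $$ (j, i) = cnj (A $$ (i, j))"
    using arg_cong[OF psd_hermitian[OF A], of "\<lambda>M. M $$ (j, i)"] ij Ac by simp
  have "0 \<le> - (A $$ (i, j) * cnj (A $$ (i, j))) - A $$ (i, j) * cnj (A $$ (i, j))"
    using psd_two_point[OF A ij, of 1 "- cnj (A $$ (i, j))"] assms(2)[OF ij(1)] assms(2)[OF ij(2)] ji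
    by (simp add: mult.commute)
  then have "(cmod (A $$ (i, j)))\<^sup>2 \<le> 0"
    by (simp add: less_eq_complex_def flip: complex_norm_square)
  then show "A $$ (i, j) = 0\<^sub>m n n $$ (i, j)" using ij by simp
qed (use psd_carrier[OF A] in auto)

text \<open>Subtracting \<open>A e\<^sub>i e\<^sub>i\<^sup>* A / A\<^sub>i\<^sub>i\<close> keeps a matrix positive semidefinite and clears its \<open>i\<close>-th row; after
  finitely many such steps the diagonal is gone.  The new column is the only one with a
  nonzero \<open>i\<close>-th entry, which keeps the columns independent.\<close>

lemma psd_injective_factor:
  assumes "psd n A"
  shows "\<exists>r. \<exists>G\<in>carrier_mat n r. A = G * adj G \<and> (\<forall>x\<in>carrier_mat r 1. G * x = 0\<^sub>m n 1 \<longrightarrow> x = 0\<^sub>m r 1)"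
  using assms
proof (induction "card {j. j < n \<and> A $$ (j, j) \<noteq> 0}" arbitrary: A rule: less_induct)
  case less
  note A = less.prems
  note Ac = psd_carrier[OF A]
  show ?case
  proof (cases "\<exists>i<n. A $$ (i, i) \<noteq> 0")
    case False
    then have "A = 0\<^sub>m n n" using psd_zero_diag[OF A] by auto
    moreover have "0\<^sub>m n 0 * adj (0\<^sub>m n 0) = (0\<^sub>m n n :: complex mat)" by (subst left_mult_zero_mat') auto
    ultimately show ?thesis by (intro exI[of _ 0] bexI[of _ "0\<^sub>m n 0"]) auto
  next
    case True
    then obtain i where i: "i < n" "A $$ (i, i) \<noteq> 0" by blast
    define d where "d = Re (A $$ (i, i))"
    have Aii: "A $$ (i, i) = complex_of_real d"
      using psd_diag_nonneg[OF A i(1)] by (simp add: complex_eq_iff d_def less_eq_complex_def)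
    have d: "d > 0" using psd_diag_nonneg[OF A i(1)] i(2) Aii by (simp add: less_eq_complex_def less_le)
    define u where "u = unit_column n i"
    have u: "u \<in> carrier_mat n 1" by (simp add: u_def)
    have uAu: "adj u * A * u = complex_of_real d \<cdot>\<^sub>m 1\<^sub>m 1"
      using matrix_coefficient[OF Ac i(1) i(1)] Aii by (simp add: u_def)
    define e where "e = complex_of_real (1 / d)"
    have e: "cnj e = e" "e * complex_of_real d = 1" using d by (simp_all add: e_def)
    \<comment> \<open>Congruence with \<open>M\<close> produces the Schur complement of the \<open>i\<close>-th diagonal entry.\<close>
    define M where "M = 1\<^sub>m n - e \<cdot>\<^sub>m (u * (adj u * A))"
    have M: "M \<in> carrier_mat n n" using u Ac by (simp add: M_def minus_carrier_mat)
    define g where "g = complex_of_real (1 / sqrt d) \<cdot>\<^sub>m (A * u)"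
    have g: "g \<in> carrier_mat n 1" using u Ac by (simp add: g_def)
    note herm = psd_hermitian[OF A]
    define P where "P = A * u * (adj u * A)"
    have P: "P \<in> carrier_mat n n" using u Ac by (simp add: P_def)
    have "complex_of_real (1 / sqrt d) * cnj (complex_of_real (1 / sqrt d)) = e"
      using d by (simp add: e_def flip: of_real_mult)
    then have gg: "g * adj g = e \<cdot>\<^sub>m P"
      unfolding g_def P_def adj_smult using u Ac herm
      by (simp add: adj_mult smult_mult_dim mult_smult_dim smult_smult_mat)
    define A' where "A' = A - g * adj g"
    have A'c: "A' \<in> carrier_mat n n" using Ac g by (simp add: A'_def minus_carrier_mat)
    have adjM: "adj M = 1\<^sub>m n - e \<cdot>\<^sub>m (A * u * adj u)"
      unfolding M_def using u Ac herm e(1) by (simp add: mat_simps)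
    have AM: "A * M = A - e \<cdot>\<^sub>m P"
      unfolding M_def P_def using u Ac by (simp add: mult_minus_dim mult_smult_dim mult_assoc_dim)
    have "A * u * adj u * P = A * u * (adj u * A * u) * (adj u * A)"
      unfolding P_def using u Ac by (simp add: mult_assoc_dim)
    also have "\<dots> = complex_of_real d \<cdot>\<^sub>m P"
      unfolding uAu P_def using u Ac by (simp add: smult_mult_dim mult_smult_dim)
    finally have uP: "A * u * adj u * P = complex_of_real d \<cdot>\<^sub>m P" .
    have uA: "A * u * adj u * A = P" unfolding P_def using u Ac by (simp add: mult_assoc_dim)
    have "adj M * A * M = adj M * (A * M)" using M Ac by (simp add: mult_assoc_dim)
    also have "\<dots> = A - e \<cdot>\<^sub>m (A * u * adj u * A) - e \<cdot>\<^sub>m (P - e \<cdot>\<^sub>m (A * u * adj u * P))"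
      unfolding adjM AM using Ac u P by (simp add: minus_mult_dim mult_minus_dim smult_mult_dim mult_smult_dim mult_assoc_dim smult_smult_mat)
    also have "\<dots> = A'" unfolding uP uA A'_def gg smult_smult_mat e(2) using Ac P
      by (intro eq_matI) (auto simp: e(2))
    finally have psd': "psd n A'" using psd_congruence[OF A M] by simp
    have idx: "A' $$ (j, j) = A $$ (j, j) - of_real ((cmod (g $$ (j, 0)))\<^sup>2)" if "j < n" for j
      unfolding A'_def using that Ac g by (simp add: mult_index flip: complex_norm_square)
    have "complex_of_real (1 / sqrt d) * complex_of_real d = complex_of_real (1 / sqrt d * d)"
      by (simp only: of_real_mult)
    also have "1 / sqrt d * d = sqrt d" using d real_div_sqrt[of d] by simp
    finally have sq: "complex_of_real (1 / sqrt d) * complex_of_real d = complex_of_real (sqrt d)" .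
    have gi: "g $$ (i, 0) = complex_of_real (sqrt d)"
      unfolding g_def using mult_unit_column[OF Ac i(1) i(1)] Ac i(1) Aii sq by (simp add: u_def)
    have A'ii: "A' $$ (i, i) = 0" using idx[OF i(1)] gi Aii d by simp
    have zero: "A' $$ (j, j) = 0" if "j < n" "A $$ (j, j) = 0" for j
      using idx[OF that(1)] psd_diag_nonneg[OF psd' that(1)] that(2)
      by (simp add: less_eq_complex_def complex_eq_iff)
    have "{j. j < n \<and> A' $$ (j, j) \<noteq> 0} \<subset> {j. j < n \<and> A $$ (j, j) \<noteq> 0}"
      using zero A'ii i by blast
    then have "card {j. j < n \<and> A' $$ (j, j) \<noteq> 0} < card {j. j < n \<and> A $$ (j, j) \<noteq> 0}"
      by (intro psubset_card_mono) auto
    from less.hyps[OF this psd'] obtain r G where G: "G \<in> carrier_mat n r" "A' = G * adj G"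
      and inj: "\<And>x. x \<in> carrier_mat r 1 \<Longrightarrow> G * x = 0\<^sub>m n 1 \<Longrightarrow> x = 0\<^sub>m r 1" by blast
    have Gi: "G $$ (i, k) = 0" if k: "k < r" for k
    proof -
      have "(cmod (G $$ (i, k)))\<^sup>2 \<le> Re ((G * adj G) $$ (i, i))"
        using cmod_index_le_gram[of k "adj G" i] G i k by simp
      then show ?thesis using A'ii G(2) by simp
    qed
    define H where "H = mat n (Suc r) (\<lambda>(a, k). if k < r then G $$ (a, k) else g $$ (a, 0))"
    have H: "H \<in> carrier_mat n (Suc r)" by (simp add: H_def)
    have "A = A' + g * adj g" unfolding A'_def using Ac g by (intro eq_matI) auto
    also have "\<dots> = H * adj H"
      unfolding G(2) by (rule eq_matI) (use G g H in \<open>auto simp: mult_index H_def\<close>)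
    finally have AH: "A = H * adj H" .
    have "x = 0\<^sub>m (Suc r) 1" if x: "x \<in> carrier_mat (Suc r) 1" and Hx: "H * x = 0\<^sub>m n 1" for x
    proof -
      have row: "(\<Sum>k<r. G $$ (a, k) * x $$ (k, 0)) + g $$ (a, 0) * x $$ (r, 0) = 0" if a: "a < n" for a
        using arg_cong[OF Hx, of "\<lambda>M. M $$ (a, 0)"] a x H by (simp add: mult_index H_def)
      have xr: "x $$ (r, 0) = 0" using row[OF i(1)] Gi gi d by simp
      define y where "y = mat r 1 (\<lambda>(k, _). x $$ (k, 0))"
      have "G * y = 0\<^sub>m n 1"
        by (rule eq_matI) (use G row xr in \<open>auto simp: mult_index y_def\<close>)
      then have "y = 0\<^sub>m r 1" using inj by (simp add: y_def)
      then have "y $$ (k, 0) = 0" if "k < r" for k using that by simp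
      then have "x $$ (k, 0) = 0" if "k < r" for k using that by (simp add: y_def)
      then show ?thesis using xr x by (intro eq_matI) (auto simp: less_Suc_eq)
    qed
    then show ?thesis using H AH by blast
  qed
qed

lemma injective_imp_tall:
  fixes G :: "complex mat"
  assumes G: "G \<in> carrier_mat n r" and inj: "\<And>x. x \<in> carrier_mat r 1 \<Longrightarrow> G * x = 0\<^sub>m n 1 \<Longrightarrow> x = 0\<^sub>m r 1"
  shows "r \<le> n"
proof (rule ccontr)
  assume "\<not> r \<le> n"
  then obtain v where v: "\<exists>j<r. v j \<noteq> 0" "\<And>i. i < n \<Longrightarrow> (\<Sum>j<r. G $$ (i, j) * v j) = 0"
    using wide_matrix_kernel[of n r "\<lambda>i j. G $$ (i, j)"] by auto
  define x where "x = mat r 1 (\<lambda>(j, _). v j)"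
  have "G * x = 0\<^sub>m n 1" by (rule eq_matI) (use G v(2) in \<open>auto simp: mult_index x_def\<close>)
  then have "x = 0\<^sub>m r 1" using inj by (simp add: x_def)
  then have "x $$ (j, 0) = 0" if "j < r" for j using that by simp
  then show False using v(1) by (auto simp: x_def)
qed

text \<open>An injective factor of an injective matrix is square, by comparing dimensions in both
  directions.\<close>

lemma psd_invertible_factor:
  assumes P: "psd n P" and inj: "\<And>x. x \<in> carrier_mat n 1 \<Longrightarrow> P * x = 0\<^sub>m n 1 \<Longrightarrow> x = 0\<^sub>m n 1"
  shows "\<exists>T\<in>carrier_mat n n. \<exists>T'\<in>carrier_mat n n. adj T * T = P \<and> T' * T = 1\<^sub>m n \<and> T * T' = 1\<^sub>m n"
proof -
  obtain r G where G: "G \<in> carrier_mat n r" "P = G * adj G"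
    and Ginj: "\<And>x. x \<in> carrier_mat r 1 \<Longrightarrow> G * x = 0\<^sub>m n 1 \<Longrightarrow> x = 0\<^sub>m r 1"
    using psd_injective_factor[OF P] by blast
  have inj': "x = 0\<^sub>m n 1" if "x \<in> carrier_mat n 1" "adj G * x = 0\<^sub>m r 1" for x
    by (rule inj) (use that G in \<open>simp_all add: mult_assoc_dim\<close>)
  have "r \<le> n" by (rule injective_imp_tall[OF G(1) Ginj])
  moreover have "n \<le> r" by (rule injective_imp_tall[of "adj G"]) (use G(1) inj' in simp_all)
  ultimately have "r = n" by simp
  then have Gn: "adj G \<in> carrier_mat n n" using G(1) by simp
  have "\<exists>B\<in>carrier_mat n n. B * adj G = 1\<^sub>m n \<and> adj G * B = 1\<^sub>m n"
    by (rule injective_square_has_inverse[OF Gn]) (use inj' \<open>r = n\<close> in blast)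
  then obtain T' where T': "T' \<in> carrier_mat n n" "T' * adj G = 1\<^sub>m n" "adj G * T' = 1\<^sub>m n" by blast
  moreover have "adj (adj G) * adj G = P" unfolding G(2) by simp
  ultimately show ?thesis using Gn by blast
qed

text \<open>By the Cauchy-Schwarz inequality, with \<open>c\<close> a bound for the square of the Hilbert-Schmidt norm.
  Applied to an inverse it also bounds a Gram matrix from below.\<close>

lemma gram_le_scalar:
  assumes M: "M \<in> carrier_mat s n"
  shows "\<exists>c>0. psd n (complex_of_real c \<cdot>\<^sub>m 1\<^sub>m n - adj M * M)"
proof -
  define c where "c = 1 + (\<Sum>i<s. \<Sum>j<n. (cmod (M $$ (i, j)))\<^sup>2)"
  have "c > 0" unfolding c_def by (intro add_pos_nonneg sum_nonneg) auto
  moreover have "psd n (complex_of_real c \<cdot>\<^sub>m 1\<^sub>m n - adj M * M)"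
    unfolding psd_iff_columns
  proof (intro conjI ballI)
    show "complex_of_real c \<cdot>\<^sub>m 1\<^sub>m n - adj M * M \<in> carrier_mat n n" using M by (simp add: minus_carrier_mat)
    fix x :: "complex mat" assume x: "x \<in> carrier_mat n 1"
    define N where "N = (\<Sum>j<n. (cmod (x $$ (j, 0)))\<^sup>2)"
    have "adj x * (complex_of_real c \<cdot>\<^sub>m 1\<^sub>m n - adj M * M) * x
      = complex_of_real c \<cdot>\<^sub>m (adj x * x) - adj (M * x) * (M * x)" using M x by (simp add: mat_simps)
    then have val: "(adj x * (complex_of_real c \<cdot>\<^sub>m 1\<^sub>m n - adj M * M) * x) $$ (0, 0)
      = of_real (c * N - (\<Sum>i<s. (cmod ((M * x) $$ (i, 0)))\<^sup>2))"
      using adj_mult_self_diag[of 0 x] adj_mult_self_diag[of 0 "M * x"] M x by (simp add: N_def)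
    have "(cmod ((M * x) $$ (i, 0)))\<^sup>2 \<le> (\<Sum>j<n. (cmod (M $$ (i, j)))\<^sup>2) * N" if "i < s" for i
    proof -
      have "cmod ((M * x) $$ (i, 0)) \<le> (\<Sum>j<n. cmod (M $$ (i, j)) * cmod (x $$ (j, 0)))"
        using M x that by (simp add: mult_index) (rule sum_norm_le, simp add: norm_mult)
      then have "(cmod ((M * x) $$ (i, 0)))\<^sup>2 \<le> (\<Sum>j<n. cmod (M $$ (i, j)) * cmod (x $$ (j, 0)))\<^sup>2"
        by (intro power_mono) auto
      also have "\<dots> \<le> (\<Sum>j<n. (cmod (M $$ (i, j)))\<^sup>2) * N"
      proof -
        have "(\<Sum>j<n. cmod (M $$ (i, j)) * cmod (x $$ (j, 0)))
          \<le> L2_set (\<lambda>j. cmod (M $$ (i, j))) {..<n} * L2_set (\<lambda>j. cmod (x $$ (j, 0))) {..<n}"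
          using L2_set_mult_ineq[of "\<lambda>j. cmod (M $$ (i, j))" "\<lambda>j. cmod (x $$ (j, 0))" "{..<n}"] by simp
        then have "(\<Sum>j<n. cmod (M $$ (i, j)) * cmod (x $$ (j, 0)))\<^sup>2
          \<le> (L2_set (\<lambda>j. cmod (M $$ (i, j))) {..<n} * L2_set (\<lambda>j. cmod (x $$ (j, 0))) {..<n})\<^sup>2"
          by (intro power_mono sum_nonneg) auto
        then show ?thesis by (simp add: L2_set_def N_def power_mult_distrib sum_nonneg)
      qed
      finally show ?thesis .
    qed
    then have "(\<Sum>i<s. (cmod ((M * x) $$ (i, 0)))\<^sup>2) \<le> (\<Sum>i<s. (\<Sum>j<n. (cmod (M $$ (i, j)))\<^sup>2) * N)"
      by (intro sum_mono) auto
    also have "\<dots> = (c - 1) * N" by (simp add: c_def sum_distrib_right)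
    also have "\<dots> \<le> c * N" by (simp add: N_def sum_nonneg algebra_simps)
    finally show "0 \<le> (adj x * (complex_of_real c \<cdot>\<^sub>m 1\<^sub>m n - adj M * M) * x) $$ (0, 0)"
      unfolding val by (simp add: less_eq_complex_def)
  qed
  ultimately show ?thesis by blast
qed

section \<open>Kraus decompositions\<close>

definition kraus :: "nat \<Rightarrow> nat \<Rightarrow> (nat \<Rightarrow> complex mat) \<Rightarrow> complex mat \<Rightarrow> complex mat" where
  "kraus d r K X = mat d d (\<lambda>(a, b). \<Sum>k<r. (K k * X * adj (K k)) $$ (a, b))"

definition mat_comb :: "nat \<Rightarrow> nat \<Rightarrow> nat \<Rightarrow> (nat \<Rightarrow> complex mat) \<Rightarrow> (nat \<Rightarrow> complex) \<Rightarrow> complex mat" where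
  "mat_comb d1 d2 r K c = mat d2 d1 (\<lambda>(a, i). \<Sum>l<r. c l * K l $$ (a, i))"

definition mat_independent :: "nat \<Rightarrow> nat \<Rightarrow> nat \<Rightarrow> (nat \<Rightarrow> complex mat) \<Rightarrow> bool" where
  "mat_independent d1 d2 r K \<longleftrightarrow> (\<forall>c. mat_comb d1 d2 r K c = 0\<^sub>m d2 d1 \<longrightarrow> (\<forall>l<r. c l = 0))"

lemma kraus_carrier [simp]: "kraus d r K X \<in> carrier_mat d d"
  by (simp add: kraus_def)

lemma kraus_dim [simp]: "dim_row (kraus d r K X) = d" "dim_col (kraus d r K X) = d"
  by (simp_all add: kraus_def)

lemma mat_comb_carrier [simp]: "mat_comb d1 d2 r K c \<in> carrier_mat d2 d1"
  by (simp add: mat_comb_def)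

lemma mat_comb_dim [simp]: "dim_row (mat_comb d1 d2 r K c) = d2" "dim_col (mat_comb d1 d2 r K c) = d1"
  by (simp_all add: mat_comb_def)

lemma sandwich_index:
  assumes "K \<in> carrier_mat d2 d1" "L \<in> carrier_mat d2 d1" "X \<in> carrier_mat d1 d1" "a < d2" "b < d2"
  shows "(K * X * adj L) $$ (a, b) = (\<Sum>i<d1. \<Sum>j<d1. K $$ (a, i) * X $$ (i, j) * cnj (L $$ (b, j)))"
proof -
  have "(K * X * adj L) $$ (a, b) = (\<Sum>j<d1. (\<Sum>i<d1. K $$ (a, i) * X $$ (i, j)) * cnj (L $$ (b, j)))"
    using assms by (simp add: mult_index)
  also have "\<dots> = (\<Sum>j<d1. \<Sum>i<d1. K $$ (a, i) * X $$ (i, j) * cnj (L $$ (b, j)))"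
    by (simp add: sum_distrib_right)
  also have "\<dots> = (\<Sum>i<d1. \<Sum>j<d1. K $$ (a, i) * X $$ (i, j) * cnj (L $$ (b, j)))"
    by (rule sum.swap)
  finally show ?thesis .
qed

lemma kraus_Suc:
  assumes "K r \<in> carrier_mat d2 d1"
  shows "kraus d2 (Suc r) K X = kraus d2 r K X + K r * X * adj (K r)"
  using assms by (intro eq_matI) (auto simp: kraus_def)

lemma kraus_psd:
  assumes K: "\<And>k. K k \<in> carrier_mat d2 d1" and X: "psd d1 X"
  shows "psd d2 (kraus d2 r K X)"
proof (induction r)
  case 0
  show ?case unfolding psd_iff_columns
  proof (intro conjI ballI)
    fix x :: "complex mat" assume x: "x \<in> carrier_mat d2 1"
    have "kraus d2 0 K X = 0\<^sub>m d2 d2" by (intro eq_matI) (auto simp: kraus_def)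
    then show "0 \<le> (adj x * kraus d2 0 K X * x) $$ (0, 0)" using x by simp
  qed simp
next
  case (Suc r)
  have "psd d2 (adj (adj (K r)) * X * adj (K r))"
    by (rule psd_congruence[OF X]) (use K in simp)
  then show ?case unfolding kraus_Suc[of K r, OF K] by (intro psd_add[OF Suc]) simp
qed

lemma kraus_linear:
  assumes K: "\<And>k. K k \<in> carrier_mat d2 d1"
  shows "linear_mat_map d1 d2 (kraus d2 r K)"
  unfolding linear_mat_map_def
proof (intro conjI ballI allI)
  fix X Y :: "complex mat" assume X: "X \<in> carrier_mat d1 d1" and Y: "Y \<in> carrier_mat d1 d1"
  have "K k * (X + Y) * adj (K k) = K k * X * adj (K k) + K k * Y * adj (K k)" for k
    using X Y K[of k] by (simp add: mult_add_dim add_mult_dim)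
  then show "kraus d2 r K (X + Y) = kraus d2 r K X + kraus d2 r K Y"
    using X Y K by (intro eq_matI) (auto simp: kraus_def sum.distrib carrier_matD[OF K])
next
  fix c and X :: "complex mat" assume X: "X \<in> carrier_mat d1 d1"
  have "K k * (c \<cdot>\<^sub>m X) * adj (K k) = c \<cdot>\<^sub>m (K k * X * adj (K k))" for k
    using X K[of k] by (simp add: mult_smult_dim smult_mult_dim)
  then show "kraus d2 r K (c \<cdot>\<^sub>m X) = c \<cdot>\<^sub>m kraus d2 r K X"
    by (intro eq_matI) (auto simp: kraus_def sum_distrib_left carrier_matD[OF K])
qed simp

lemma block_index_less:
  assumes "i < s" "a < d"
  shows "i * d + a < s * (d :: nat)"
proof -
  have "i * d + a < Suc i * d" using assms by simp
  also have "\<dots> \<le> s * d" using assms by (intro mult_right_mono) auto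
  finally show ?thesis .
qed

lemma sum_over_block:
  fixes h :: "nat \<Rightarrow> complex"
  assumes "i < s"
  shows "(\<Sum>u<s * d. if u div d = i then h u else 0) = (\<Sum>a<d. h (i * d + a))"
proof (cases "d = 0")
  case False
  have "(\<Sum>a<d. h (i * d + a)) = (\<Sum>u\<in>(\<lambda>a. i * d + a) ` {..<d}. h u)"
    by (subst sum.reindex) (auto simp: inj_on_def)
  also have "(\<lambda>a. i * d + a) ` {..<d} = {u \<in> {..<s * d}. u div d = i}"
  proof (intro equalityI subsetI)
    fix u assume u: "u \<in> {u \<in> {..<s * d}. u div d = i}"
    then have "u = i * d + u mod d" by (auto simp: mult.commute)
    then show "u \<in> (\<lambda>a. i * d + a) ` {..<d}" using False by (metis imageI lessThan_iff mod_less_divisor neq0_conv)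
  qed (use assms block_index_less in auto)
  also have "(\<Sum>u\<in>{u \<in> {..<s * d}. u div d = i}. h u) = (\<Sum>u<s * d. if u div d = i then h u else 0)"
    by (rule sum.inter_filter) simp
  finally show ?thesis ..
qed simp

text \<open>This is \<open>1\<^sub>s \<otimes> M\<close>: the ampliation of \<open>X \<mapsto> M X M\<^sup>*\<close> is conjugation with it, so ampliations of
  Kraus sums are Kraus sums again.\<close>

definition block_diagonal :: "nat \<Rightarrow> nat \<Rightarrow> nat \<Rightarrow> complex mat \<Rightarrow> complex mat" where
  "block_diagonal s d1 d2 M = mat (s * d2) (s * d1)
     (\<lambda>(p, q). if p div d2 = q div d1 then M $$ (p mod d2, q mod d1) else 0)"

lemma ampliation_sandwich:
  assumes M: "M \<in> carrier_mat d2 d1" and X: "X \<in> carrier_mat (s * d1) (s * d1)"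
    and pq: "p < s * d2" "q < s * d2"
  shows "(block_diagonal s d1 d2 M * X * adj (block_diagonal s d1 d2 M)) $$ (p, q)
    = (M * mat_block d1 X (p div d2) (q div d2) * adj M) $$ (p mod d2, q mod d2)"
proof -
  let ?B = "block_diagonal s d1 d2 M"
  have B: "?B \<in> carrier_mat (s * d2) (s * d1)" by (simp add: block_diagonal_def)
  have d2: "d2 > 0" using pq by (cases d2) auto
  have pd: "p div d2 < s" "q div d2 < s" "p mod d2 < d2" "q mod d2 < d2"
    using pq d2 by (auto simp: less_mult_imp_div_less)
  have "(?B * X * adj ?B) $$ (p, q) = (\<Sum>u<s * d1. \<Sum>v<s * d1. ?B $$ (p, u) * X $$ (u, v) * cnj (?B $$ (q, v)))"
    by (rule sandwich_index[OF B B X pq])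
  also have "\<dots> = (\<Sum>u<s * d1. if u div d1 = p div d2 then
      (\<Sum>v<s * d1. if v div d1 = q div d2 then M $$ (p mod d2, u mod d1) * X $$ (u, v) * cnj (M $$ (q mod d2, v mod d1)) else 0) else 0)"
    using pq by (intro sum.cong) (auto simp: block_diagonal_def intro!: sum.cong)
  also have "\<dots> = (\<Sum>i<d1. \<Sum>j<d1. M $$ (p mod d2, i) * X $$ (p div d2 * d1 + i, q div d2 * d1 + j) * cnj (M $$ (q mod d2, j)))"
    by (simp add: sum_over_block[OF pd(1)] sum_over_block[OF pd(2)])
  also have "\<dots> = (M * mat_block d1 X (p div d2) (q div d2) * adj M) $$ (p mod d2, q mod d2)"
    by (subst sandwich_index[OF M M _ pd(3,4)]) (auto simp: mat_block_def)
  finally show ?thesis .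
qed

lemma kraus_cp:
  assumes K: "\<And>k. K k \<in> carrier_mat d2 d1"
  shows "cp_map d1 d2 (kraus d2 r K)"
  unfolding cp_map_def
proof (intro conjI allI impI)
  fix s X assume X: "psd (s * d1) X"
  have "ampliation s d1 d2 (kraus d2 r K) X = kraus (s * d2) r (\<lambda>k. block_diagonal s d1 d2 (K k)) X"
  proof (rule eq_matI)
    fix p q assume "p < dim_row (kraus (s * d2) r (\<lambda>k. block_diagonal s d1 d2 (K k)) X)"
      "q < dim_col (kraus (s * d2) r (\<lambda>k. block_diagonal s d1 d2 (K k)) X)"
    then have pq: "p < s * d2" "q < s * d2" by auto
    then have "d2 > 0" by (cases d2) auto
    then show "ampliation s d1 d2 (kraus d2 r K) X $$ (p, q)
      = kraus (s * d2) r (\<lambda>k. block_diagonal s d1 d2 (K k)) X $$ (p, q)"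
      using pq ampliation_sandwich[OF K psd_carrier[OF X] pq] by (simp add: ampliation_def kraus_def)
  qed (auto simp: ampliation_def)
  also have "psd (s * d2) \<dots>"
    by (rule kraus_psd[OF _ X]) (simp add: block_diagonal_def)
  finally show "psd (s * d2) (ampliation s d1 d2 (kraus d2 r K) X)" .
qed (rule kraus_linear[OF K])

lemma cp_map_compose:
  assumes F: "cp_map d1 d2 \<Phi>" and G: "cp_map d2 d3 \<Gamma>"
  shows "cp_map d1 d3 (\<Gamma> \<circ> \<Phi>)"
  unfolding cp_map_def
proof (intro conjI allI impI)
  show "linear_mat_map d1 d3 (\<Gamma> \<circ> \<Phi>)" using F G by (auto simp: cp_map_def linear_mat_map_def)
  fix s X assume X: "psd (s * d1) X"
  have "psd (s * d3) (ampliation s d2 d3 \<Gamma> (ampliation s d1 d2 \<Phi> X))"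
    using F G X by (auto simp: cp_map_def)
  also have "ampliation s d2 d3 \<Gamma> (ampliation s d1 d2 \<Phi> X) = ampliation s d1 d3 (\<Gamma> \<circ> \<Phi>) X"
  proof (rule eq_matI)
    fix p q assume "p < dim_row (ampliation s d1 d3 (\<Gamma> \<circ> \<Phi>) X)" "q < dim_col (ampliation s d1 d3 (\<Gamma> \<circ> \<Phi>) X)"
    then have pq: "p < s * d3" "q < s * d3" by (auto simp: ampliation_def)
    then have pd: "p div d3 < s" "q div d3 < s" by (auto simp: less_mult_imp_div_less)
    have Y: "mat_block d1 X (p div d3) (q div d3) \<in> carrier_mat d1 d1" by (simp add: mat_block_def)
    have "\<Phi> (mat_block d1 X (p div d3) (q div d3)) \<in> carrier_mat d2 d2"
      using F Y unfolding cp_map_def linear_mat_map_def by blast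
    then have "mat_block d2 (ampliation s d1 d2 \<Phi> X) (p div d3) (q div d3) = \<Phi> (mat_block d1 X (p div d3) (q div d3))"
      using pd block_index_less by (intro eq_matI) (auto simp: mat_block_def ampliation_def)
    then show "ampliation s d2 d3 \<Gamma> (ampliation s d1 d2 \<Phi> X) $$ (p, q) = ampliation s d1 d3 (\<Gamma> \<circ> \<Phi>) X $$ (p, q)"
      using pq by (simp add: ampliation_def)
  qed (auto simp: ampliation_def)
  finally show "psd (s * d3) (ampliation s d1 d3 (\<Gamma> \<circ> \<Phi>) X)" .
qed

definition matrix_unit :: "nat \<Rightarrow> nat \<Rightarrow> nat \<Rightarrow> complex mat" where
  "matrix_unit n i j = mat n n (\<lambda>(p, q). if p = i \<and> q = j then 1 else 0)"

lemma linear_mat_map_expand: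
  assumes lin: "linear_mat_map d1 d2 \<Phi>" and X: "X \<in> carrier_mat d1 d1" and ab: "a < d2" "b < d2"
  shows "\<Phi> X $$ (a, b) = (\<Sum>i<d1. \<Sum>j<d1. X $$ (i, j) * \<Phi> (matrix_unit d1 i j) $$ (a, b))"
proof -
  define R where "R I = mat d1 d1 (\<lambda>pq. if pq \<in> I then X $$ pq else 0)" for I
  have \<Phi>c: "\<Phi> Y \<in> carrier_mat d2 d2" if "Y \<in> carrier_mat d1 d1" for Y
    using lin that by (auto simp: linear_mat_map_def)
  have uc: "matrix_unit d1 i j \<in> carrier_mat d1 d1" for i j by (simp add: matrix_unit_def)
  have Rc: "R I \<in> carrier_mat d1 d1" for I by (simp add: R_def)
  have "\<Phi> (R I) $$ (a, b) = (\<Sum>(i, j)\<in>I. X $$ (i, j) * \<Phi> (matrix_unit d1 i j) $$ (a, b))"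
    if "finite I" "I \<subseteq> {..<d1} \<times> {..<d1}" for I
    using that
  proof (induction I)
    case empty
    have "R {} = 0 \<cdot>\<^sub>m R {}" by (rule eq_matI) (auto simp: R_def)
    then have "\<Phi> (R {}) = 0 \<cdot>\<^sub>m \<Phi> (R {})" using lin Rc unfolding linear_mat_map_def by metis
    then have "\<Phi> (R {}) $$ (a, b) = (0 \<cdot>\<^sub>m \<Phi> (R {})) $$ (a, b)" by simp
    also have "\<dots> = 0" using \<Phi>c[OF Rc, of "{}"] ab by simp
    finally show ?case by simp
  next
    case (insert ij I)
    obtain i j where ij: "ij = (i, j)" by (cases ij)
    have "R (insert ij I) = X $$ (i, j) \<cdot>\<^sub>m matrix_unit d1 i j + R I"
      using insert.hyps unfolding ij by (intro eq_matI) (auto simp: R_def matrix_unit_def)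
    then have "\<Phi> (R (insert ij I)) = X $$ (i, j) \<cdot>\<^sub>m \<Phi> (matrix_unit d1 i j) + \<Phi> (R I)"
      using lin Rc uc unfolding linear_mat_map_def by (metis smult_carrier_mat)
    then show ?case
      using insert \<Phi>c[OF Rc] \<Phi>c[OF uc] ab by (simp add: ij carrier_matD[OF \<Phi>c[OF Rc]] carrier_matD[OF \<Phi>c[OF uc]])
  qed
  from this[of "{..<d1} \<times> {..<d1}"] have "\<Phi> (R ({..<d1} \<times> {..<d1})) $$ (a, b)
      = (\<Sum>i<d1. \<Sum>j<d1. X $$ (i, j) * \<Phi> (matrix_unit d1 i j) $$ (a, b))"
    by (simp add: sum.cartesian_product)
  moreover have "R ({..<d1} \<times> {..<d1}) = X" using X by (intro eq_matI) (auto simp: R_def)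
  ultimately show ?thesis by simp
qed

text \<open>Choi's theorem.  Independence of the Kraus operators is what the injectivity of the Gram
  factor of the Choi matrix says.\<close>

lemma kraus_decomposition:
  assumes cp: "cp_map d1 d2 \<Phi>"
  shows "\<exists>r K. (\<forall>k. K k \<in> carrier_mat d2 d1) \<and> mat_independent d1 d2 r K \<and>
    (\<forall>X\<in>carrier_mat d1 d1. \<Phi> X = kraus d2 r K X)"
proof -
  have lin: "linear_mat_map d1 d2 \<Phi>" using cp by (simp add: cp_map_def)
  have \<Phi>c: "\<Phi> Y \<in> carrier_mat d2 d2" if "Y \<in> carrier_mat d1 d1" for Y
    using lin that by (auto simp: linear_mat_map_def)
  \<comment> \<open>\<open>w\<^sup>* w = \<Sum> E\<^sub>i\<^sub>j \<otimes> E\<^sub>i\<^sub>j\<close>, whose ampliation is the Choi matrix.\<close>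
  define w :: "complex mat" where "w = mat 1 (d1 * d1) (\<lambda>(_, p). if p div d1 = p mod d1 then 1 else 0)"
  have "w \<in> carrier_mat 1 (d1 * d1)" by (simp add: w_def)
  then have psdw: "psd (d1 * d1) (adj w * w)" by (rule psd_gram)
  define C where "C = ampliation d1 d1 d2 \<Phi> (adj w * w)"
  have psdC: "psd (d1 * d2) C" using cp psdw by (auto simp: cp_map_def C_def)
  have block: "mat_block d1 (adj w * w) i j = matrix_unit d1 i j" if "i < d1" "j < d1" for i j
    using that block_index_less[of i d1 _ d1] block_index_less[of j d1 _ d1]
    by (intro eq_matI) (auto simp: mat_block_def matrix_unit_def mult_index w_def)
  obtain r G where G: "G \<in> carrier_mat (d1 * d2) r" "C = G * adj G"
    and inj: "\<And>x. x \<in> carrier_mat r 1 \<Longrightarrow> G * x = 0\<^sub>m (d1 * d2) 1 \<Longrightarrow> x = 0\<^sub>m r 1"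
    using psd_injective_factor[OF psdC] by blast
  define K where "K k = mat d2 d1 (\<lambda>(a, i). G $$ (i * d2 + a, k))" for k
  have K: "K k \<in> carrier_mat d2 d1" for k by (simp add: K_def)
  have choi: "\<Phi> (matrix_unit d1 i j) $$ (a, b) = (\<Sum>k<r. K k $$ (a, i) * cnj (K k $$ (b, j)))"
    if ij: "i < d1" "j < d1" and ab: "a < d2" "b < d2" for i j a b
  proof -
    have lt: "i * d2 + a < d1 * d2" "j * d2 + b < d1 * d2" using block_index_less ij ab by auto
    have "\<Phi> (matrix_unit d1 i j) $$ (a, b) = C $$ (i * d2 + a, j * d2 + b)"
      unfolding C_def ampliation_def using lt ij ab block[OF ij] by simp
    also have "\<dots> = (\<Sum>k<r. G $$ (i * d2 + a, k) * cnj (G $$ (j * d2 + b, k)))"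
      unfolding G(2) using G(1) lt by (simp add: mult_index)
    finally show ?thesis using ij ab by (simp add: K_def)
  qed
  have "\<Phi> X = kraus d2 r K X" if X: "X \<in> carrier_mat d1 d1" for X
  proof (rule eq_matI)
    fix a b assume "a < dim_row (kraus d2 r K X)" "b < dim_col (kraus d2 r K X)"
    then have ab: "a < d2" "b < d2" by auto
    have "\<Phi> X $$ (a, b) = (\<Sum>i<d1. \<Sum>j<d1. X $$ (i, j) * (\<Sum>k<r. K k $$ (a, i) * cnj (K k $$ (b, j))))"
      unfolding linear_mat_map_expand[OF lin X ab] by (intro sum.cong) (auto simp: choi ab)
    also have "\<dots> = (\<Sum>i<d1. \<Sum>j<d1. \<Sum>k<r. K k $$ (a, i) * X $$ (i, j) * cnj (K k $$ (b, j)))"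
      by (simp add: sum_distrib_left mult.assoc mult.left_commute)
    also have "\<dots> = (\<Sum>k<r. \<Sum>i<d1. \<Sum>j<d1. K k $$ (a, i) * X $$ (i, j) * cnj (K k $$ (b, j)))"
      by (subst sum.swap[of _ "{..<r}"], subst sum.swap[of _ "{..<r}"]) (rule refl)
    also have "\<dots> = kraus d2 r K X $$ (a, b)"
      using ab by (simp add: kraus_def sandwich_index[OF K K X ab])
    finally show "\<Phi> X $$ (a, b) = kraus d2 r K X $$ (a, b)" .
  qed (use \<Phi>c[OF X] in auto)
  moreover have "mat_independent d1 d2 r K"
    unfolding mat_independent_def
  proof (intro allI impI)
    fix c l assume 0: "mat_comb d1 d2 r K c = 0\<^sub>m d2 d1" and l: "l < r"
    define x where "x = mat r 1 (\<lambda>(k, _). c k)"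
    have "G * x = 0\<^sub>m (d1 * d2) 1"
    proof (rule eq_matI)
      fix p q assume "p < dim_row (0\<^sub>m (d1 * d2) 1 :: complex mat)" "q < dim_col (0\<^sub>m (d1 * d2) 1 :: complex mat)"
      then have pq: "p < d1 * d2" "q = 0" by auto
      then have d2: "d2 > 0" by (cases d2) auto
      have p: "p div d2 < d1" "p mod d2 < d2" "p div d2 * d2 + p mod d2 = p"
        using pq d2 by (auto simp: less_mult_imp_div_less)
      have "mat_comb d1 d2 r K c $$ (p mod d2, p div d2) = 0" using 0 p by simp
      then have "(\<Sum>k<r. c k * G $$ (p, k)) = 0" using p by (simp add: mat_comb_def K_def)
      then show "(G * x) $$ (p, q) = 0\<^sub>m (d1 * d2) 1 $$ (p, q)"
        using pq G(1) by (simp add: mult_index x_def mult.commute)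
    qed (use G(1) in \<open>auto simp: x_def\<close>)
    then have "x = 0\<^sub>m r 1" using inj by (simp add: x_def)
    then have "x $$ (l, 0) = 0" using l by simp
    then show "c l = 0" using l by (simp add: x_def)
  qed
  ultimately show ?thesis using K by blast
qed

section \<open>Weighted Kraus sums\<close>

definition weighted_kraus :: "nat \<Rightarrow> nat \<Rightarrow> (nat \<Rightarrow> complex mat) \<Rightarrow> complex mat \<Rightarrow> complex mat \<Rightarrow> complex mat" where
  "weighted_kraus d r K D X = mat d d (\<lambda>(a, b). \<Sum>k<r. \<Sum>l<r. D $$ (k, l) * (K k * X * adj (K l)) $$ (a, b))"

lemma weighted_kraus_add:
  assumes "D \<in> carrier_mat r r" "E \<in> carrier_mat r r"
  shows "weighted_kraus d r K (D + E) X = weighted_kraus d r K D X + weighted_kraus d r K E X"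
  using assms by (intro eq_matI) (auto simp: weighted_kraus_def algebra_simps sum.distrib)

lemma weighted_kraus_smult:
  assumes "D \<in> carrier_mat r r"
  shows "weighted_kraus d r K (c \<cdot>\<^sub>m D) X = c \<cdot>\<^sub>m weighted_kraus d r K D X"
  using assms by (intro eq_matI) (auto simp: weighted_kraus_def sum_distrib_left mult.assoc)

lemma weighted_kraus_one: "weighted_kraus d r K (1\<^sub>m r) X = kraus d r K X"
proof (rule eq_matI)
  fix a b assume "a < dim_row (kraus d r K X)" "b < dim_col (kraus d r K X)"
  then have ab: "a < d" "b < d" by auto
  have "(\<Sum>l<r. 1\<^sub>m r $$ (k, l) * (K k * X * adj (K l)) $$ (a, b)) = (K k * X * adj (K k)) $$ (a, b)"
    if "k < r" for k
  proof -
    have "(\<Sum>l<r. 1\<^sub>m r $$ (k, l) * (K k * X * adj (K l)) $$ (a, b))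
      = (\<Sum>l<r. if l = k then (K k * X * adj (K l)) $$ (a, b) else 0)"
      using that by (intro sum.cong) auto
    then show ?thesis using that by simp
  qed
  then show "weighted_kraus d r K (1\<^sub>m r) X $$ (a, b) = kraus d r K X $$ (a, b)"
    using ab by (simp add: weighted_kraus_def kraus_def)
qed (auto simp: weighted_kraus_def)

lemma sum_sandwich_distrib:
  fixes u v :: "nat \<Rightarrow> nat \<Rightarrow> complex"
  shows "(\<Sum>i<n. \<Sum>j<m. (\<Sum>k<r. u k i) * x i j * (\<Sum>l<s. v l j))
    = (\<Sum>k<r. \<Sum>l<s. \<Sum>i<n. \<Sum>j<m. u k i * x i j * v l j)"
proof -
  have "(\<Sum>i<n. \<Sum>j<m. (\<Sum>k<r. u k i) * x i j * (\<Sum>l<s. v l j))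
    = (\<Sum>i<n. \<Sum>j<m. \<Sum>k<r. \<Sum>l<s. u k i * x i j * v l j)"
    by (simp add: sum_distrib_right sum_distrib_left) (simp add: sum.swap[of _ "{..<s}" "{..<r}"])
  also have "\<dots> = (\<Sum>(i, j, k, l)\<in>{..<n} \<times> {..<m} \<times> {..<r} \<times> {..<s}. u k i * x i j * v l j)"
    by (simp add: sum.cartesian_product)
  also have "\<dots> = (\<Sum>(k, l, i, j)\<in>{..<r} \<times> {..<s} \<times> {..<n} \<times> {..<m}. u k i * x i j * v l j)"
    by (rule sum.reindex_bij_witness[of _ "\<lambda>(k, l, i, j). (i, j, k, l)" "\<lambda>(i, j, k, l). (k, l, i, j)"]) auto
  also have "\<dots> = (\<Sum>k<r. \<Sum>l<s. \<Sum>i<n. \<Sum>j<m. u k i * x i j * v l j)"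
    by (simp add: sum.cartesian_product)
  finally show ?thesis .
qed

lemma mat_comb_sandwich:
  assumes K: "\<And>k. K k \<in> carrier_mat d2 d1" and X: "X \<in> carrier_mat d1 d1" and ab: "a < d2" "b < d2"
  shows "(mat_comb d1 d2 r K c * X * adj (mat_comb d1 d2 r K c')) $$ (a, b)
    = (\<Sum>k<r. \<Sum>l<r. c k * cnj (c' l) * (K k * X * adj (K l)) $$ (a, b))"
proof -
  have "(mat_comb d1 d2 r K c * X * adj (mat_comb d1 d2 r K c')) $$ (a, b)
    = (\<Sum>i<d1. \<Sum>j<d1. (\<Sum>k<r. c k * K k $$ (a, i)) * X $$ (i, j) * (\<Sum>l<r. cnj (c' l) * cnj (K l $$ (b, j))))"
    by (subst sandwich_index[OF mat_comb_carrier mat_comb_carrier X ab]) (auto simp: mat_comb_def ab)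
  also have "\<dots> = (\<Sum>k<r. \<Sum>l<r. \<Sum>i<d1. \<Sum>j<d1. c k * K k $$ (a, i) * X $$ (i, j) * (cnj (c' l) * cnj (K l $$ (b, j))))"
    by (rule sum_sandwich_distrib)
  also have "\<dots> = (\<Sum>k<r. \<Sum>l<r. c k * cnj (c' l) * (K k * X * adj (K l)) $$ (a, b))"
    by (simp add: sandwich_index[OF K K X ab] sum_distrib_left mult.assoc mult.left_commute)
  finally show ?thesis .
qed

lemma kraus_of_combinations:
  assumes K: "\<And>k. K k \<in> carrier_mat d2 d1" and X: "X \<in> carrier_mat d1 d1" and C: "C \<in> carrier_mat s r"
  shows "kraus d2 s (\<lambda>m. mat_comb d1 d2 r K (\<lambda>k. cnj (C $$ (m, k)))) X = weighted_kraus d2 r K (adj C * C) X"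
proof (rule eq_matI)
  fix a b assume "a < dim_row (weighted_kraus d2 r K (adj C * C) X)" "b < dim_col (weighted_kraus d2 r K (adj C * C) X)"
  then have ab: "a < d2" "b < d2" by (auto simp: weighted_kraus_def)
  have "kraus d2 s (\<lambda>m. mat_comb d1 d2 r K (\<lambda>k. cnj (C $$ (m, k)))) X $$ (a, b)
    = (\<Sum>m<s. \<Sum>k<r. \<Sum>l<r. cnj (C $$ (m, k)) * C $$ (m, l) * (K k * X * adj (K l)) $$ (a, b))"
    using ab by (simp add: kraus_def mat_comb_sandwich[OF K X ab])
  also have "\<dots> = (\<Sum>k<r. \<Sum>m<s. \<Sum>l<r. cnj (C $$ (m, k)) * C $$ (m, l) * (K k * X * adj (K l)) $$ (a, b))"
    by (rule sum.swap)
  also have "\<dots> = (\<Sum>k<r. \<Sum>l<r. \<Sum>m<s. cnj (C $$ (m, k)) * C $$ (m, l) * (K k * X * adj (K l)) $$ (a, b))"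
    by (rule sum.cong[OF refl]) (rule sum.swap)
  also have "\<dots> = weighted_kraus d2 r K (adj C * C) X $$ (a, b)"
    using ab C by (simp add: weighted_kraus_def mult_index sum_distrib_right)
  finally show "kraus d2 s (\<lambda>m. mat_comb d1 d2 r K (\<lambda>k. cnj (C $$ (m, k)))) X $$ (a, b)
    = weighted_kraus d2 r K (adj C * C) X $$ (a, b)" .
qed (auto simp: weighted_kraus_def)

lemma mult_kraus_mult_index:
  assumes K: "\<And>k. K k \<in> carrier_mat d2 d1" and S: "S \<in> carrier_mat n d2" "R \<in> carrier_mat d2 m"
    and X: "X \<in> carrier_mat d1 d1" and ab: "a < n" "b < m"
  shows "(S * kraus d2 r K X * R) $$ (a, b) = (\<Sum>k<r. (S * (K k * X * adj (K k)) * R) $$ (a, b))"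
proof (induction r)
  case 0
  have "kraus d2 0 K X = 0\<^sub>m d2 d2" by (intro eq_matI) (auto simp: kraus_def)
  then show ?case using S ab by simp
next
  case (Suc r)
  have "S * kraus d2 (Suc r) K X * R = S * kraus d2 r K X * R + S * (K r * X * adj (K r)) * R"
    unfolding kraus_Suc[of K r, OF K] using S K[of r] X by (simp add: mult_add_dim add_mult_dim)
  then show ?case using Suc S K[of r] ab by simp
qed

lemma kraus_conjugate:
  assumes K: "\<And>k. K k \<in> carrier_mat d2 d1" and S: "S \<in> carrier_mat d2 d2" and X: "X \<in> carrier_mat d1 d1"
  shows "S * kraus d2 r K X * adj S = kraus d2 r (\<lambda>k. S * K k) X"
proof (rule eq_matI)
  fix a b assume "a < dim_row (kraus d2 r (\<lambda>k. S * K k) X)" "b < dim_col (kraus d2 r (\<lambda>k. S * K k) X)"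
  then have ab: "a < d2" "b < d2" by auto
  have "S * (K k * X * adj (K k)) * adj S = S * K k * X * adj (S * K k)" for k
    using S K[of k] X by (simp add: mult_assoc_dim adj_mult)
  then show "(S * kraus d2 r K X * adj S) $$ (a, b) = kraus d2 r (\<lambda>k. S * K k) X $$ (a, b)"
    using mult_kraus_mult_index[where S = S and R = "adj S", OF K S _ X ab] S ab by (simp add: kraus_def)
qed (use S in auto)

text \<open>A weight \<open>D \<ge> \<epsilon> > 0\<close> makes the value \<open>P\<close> at the identity invertible, so that
  conjugation with \<open>T\<^sup>-\<^sup>1\<close>, where \<open>P = T\<^sup>* T\<close>, makes the weighted sum unital.\<close>

lemma weighted_kraus_normalized:
  assumes K: "\<And>k. K k \<in> carrier_mat d2 d1" and unital: "kraus d2 r K (1\<^sub>m d1) = 1\<^sub>m d2"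
    and D: "D \<in> carrier_mat r r" and e: "\<epsilon> > 0" and psdD: "psd r (D - complex_of_real \<epsilon> \<cdot>\<^sub>m 1\<^sub>m r)"
  shows "\<exists>T\<in>carrier_mat d2 d2. \<exists>T'\<in>carrier_mat d2 d2. \<exists>\<Psi>\<in>UCP d1 d2. T' * T = 1\<^sub>m d2 \<and> T * T' = 1\<^sub>m d2 \<and>
    adj T * T = weighted_kraus d2 r K D (1\<^sub>m d1) \<and>
    (\<forall>X\<in>carrier_mat d1 d1. Ad T (\<Psi> X) = weighted_kraus d2 r K D X)"
proof -
  have psd1: "psd n (1\<^sub>m n)" for n using psd_gram[of "1\<^sub>m n" n n] by simp
  have gram: "\<exists>s C. C \<in> carrier_mat s r \<and> E = adj C * C" if E: "psd r E" for E
  proof -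
    obtain s G where "G \<in> carrier_mat r s" "E = G * adj G" using psd_injective_factor[OF E] by blast
    then show ?thesis by (intro exI[of _ s] exI[of _ "adj G"]) simp
  qed
  have Dsplit: "D = complex_of_real \<epsilon> \<cdot>\<^sub>m 1\<^sub>m r + (D - complex_of_real \<epsilon> \<cdot>\<^sub>m 1\<^sub>m r)"
    using D by (intro eq_matI) auto
  have "psd r D" by (subst Dsplit, rule psd_add[OF psd_smult[OF psd1] psdD]) (use e in \<open>simp add: less_eq_complex_def\<close>)
  then obtain s C where C: "C \<in> carrier_mat s r" "D = adj C * C" using gram by blast
  obtain s' M where M: "M \<in> carrier_mat s' r" "D - complex_of_real \<epsilon> \<cdot>\<^sub>m 1\<^sub>m r = adj M * M"
    using gram[OF psdD] by blast
  define L where "L m = mat_comb d1 d2 r K (\<lambda>k. cnj (C $$ (m, k)))" for m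
  have Lc: "L m \<in> carrier_mat d2 d1" for m by (simp add: L_def)
  have LD: "kraus d2 s L X = weighted_kraus d2 r K D X" if "X \<in> carrier_mat d1 d1" for X
    unfolding L_def C(2) by (rule kraus_of_combinations[OF K that C(1)])
  define P where "P = weighted_kraus d2 r K D (1\<^sub>m d1)"
  have P: "P = kraus d2 s L (1\<^sub>m d1)" by (simp add: P_def LD)
  have psdP: "psd d2 P" unfolding P by (rule kraus_psd[OF Lc psd1])
  define R where "R = kraus d2 s' (\<lambda>m. mat_comb d1 d2 r K (\<lambda>k. cnj (M $$ (m, k)))) (1\<^sub>m d1)"
  have psdR: "psd d2 R" unfolding R_def by (rule kraus_psd[OF _ psd1]) simp
  have "P = weighted_kraus d2 r K (complex_of_real \<epsilon> \<cdot>\<^sub>m 1\<^sub>m r + adj M * M) (1\<^sub>m d1)"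
    unfolding P_def by (subst Dsplit) (simp only: M(2))
  also have "\<dots> = complex_of_real \<epsilon> \<cdot>\<^sub>m 1\<^sub>m d2 + R"
    unfolding R_def kraus_of_combinations[OF K one_carrier_mat M(1)] using M(1)
    by (simp add: weighted_kraus_add weighted_kraus_smult weighted_kraus_one unital)
  finally have PR: "P = complex_of_real \<epsilon> \<cdot>\<^sub>m 1\<^sub>m d2 + R" .
  have inj: "x = 0\<^sub>m d2 1" if x: "x \<in> carrier_mat d2 1" and Px: "P * x = 0\<^sub>m d2 1" for x
  proof (rule ccontr)
    assume "x \<noteq> 0\<^sub>m d2 1"
    then obtain n where n: "n > 0" "adj x * x = complex_of_real n \<cdot>\<^sub>m 1\<^sub>m 1" using norm_square_column[OF x] by blast
    have "adj x * (P * x) = complex_of_real \<epsilon> \<cdot>\<^sub>m (adj x * x) + adj x * R * x"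
      unfolding PR using x psd_carrier[OF psdR] by (simp add: mat_simps)
    then have eq0: "complex_of_real \<epsilon> \<cdot>\<^sub>m (adj x * x) + adj x * R * x = 0\<^sub>m 1 1"
      unfolding Px using x by simp
    have "complex_of_real (\<epsilon> * n) + (adj x * R * x) $$ (0, 0) = 0"
      using arg_cong[OF eq0[unfolded n(2)], of "\<lambda>M. M $$ (0, 0)"] x psd_carrier[OF psdR] by simp
    moreover have "0 \<le> (adj x * R * x) $$ (0, 0)" using psdR x unfolding psd_iff_columns by blast
    moreover have "\<epsilon> * n > 0" using e n by simp
    ultimately show False by (auto simp: less_eq_complex_def complex_eq_iff)
  qed
  obtain T T' where T: "T \<in> carrier_mat d2 d2" "T' \<in> carrier_mat d2 d2" "adj T * T = P" "T' * T = 1\<^sub>m d2" "T * T' = 1\<^sub>m d2"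
    using psd_invertible_factor[OF psdP inj] by blast
  have TT: "adj T * adj T' = 1\<^sub>m d2" "adj T' * adj T = 1\<^sub>m d2"
    using arg_cong[OF T(4), of adj] arg_cong[OF T(5), of adj] T(1,2) by (simp_all add: adj_mult)
  define \<Psi> where "\<Psi> = kraus d2 s (\<lambda>m. adj T' * L m)"
  have \<Psi>: "\<Psi> X = adj T' * kraus d2 s L X * T'" if "X \<in> carrier_mat d1 d1" for X
    unfolding \<Psi>_def using kraus_conjugate[of L d2 d1 "adj T'", OF Lc _ that] T(2) by simp
  have "\<Psi> (1\<^sub>m d1) = adj T' * (adj T * T) * T'" unfolding T(3) P by (rule \<Psi>) simp
  also have "\<dots> = (adj T' * adj T) * (T * T')" using T(1,2) by (simp add: mult_assoc_dim)
  also have "\<dots> = 1\<^sub>m d2" by (simp add: TT T)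
  finally have "\<Psi> (1\<^sub>m d1) = 1\<^sub>m d2" .
  moreover have "cp_map d1 d2 \<Psi>" unfolding \<Psi>_def by (rule kraus_cp) (use T(2) carrier_matD[OF Lc] in simp)
  ultimately have "\<Psi> \<in> UCP d1 d2" by (simp add: UCP_def)
  moreover have "Ad T (\<Psi> X) = weighted_kraus d2 r K D X" if X: "X \<in> carrier_mat d1 d1" for X
  proof -
    have "Ad T (\<Psi> X) = (adj T * adj T') * kraus d2 s L X * (T' * T)"
      unfolding Ad_def \<Psi>[OF X] using T(1,2) by (simp add: mult_assoc_dim)
    also have "\<dots> = kraus d2 s L X" unfolding TT T(4) by simp
    finally show ?thesis using LD[OF X] by simp
  qed
  ultimately show ?thesis using T P_def by blast
qed

text \<open>Two Kraus families of the same map differ by a matrix acting on the index.  In terms of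
  the matrices \<open>F\<close> and \<open>G\<close> whose columns list the entries of the operators the hypothesis reads
  \<open>F F\<^sup>* = G D G\<^sup>*\<close>; since \<open>G\<close> is injective, this determines a \<open>B\<close> with \<open>F = G B\<^sup>*\<close>.\<close>

lemma kraus_comparison:
  assumes K: "\<And>k. K k \<in> carrier_mat d2 d1" and indep: "mat_independent d1 d2 r K"
    and L: "\<And>k. L k \<in> carrier_mat d2 d1" and D: "D \<in> carrier_mat r r"
    and eq: "\<And>X. X \<in> carrier_mat d1 d1 \<Longrightarrow> kraus d2 r L X = weighted_kraus d2 r K D X"
  shows "\<exists>B\<in>carrier_mat r r. adj B * B = D \<and> (\<forall>k<r. L k = mat_comb d1 d2 r K (\<lambda>l. cnj (B $$ (k, l))))"
proof -
  define vecs where "vecs N = mat (d2 * d1) r (\<lambda>(p, k). N k $$ (p div d1, p mod d1))" for N :: "nat \<Rightarrow> complex mat"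
  define F where "F = vecs L"
  define G where "G = vecs K"
  have c: "F \<in> carrier_mat (d2 * d1) r" "G \<in> carrier_mat (d2 * d1) r" by (simp_all add: F_def G_def vecs_def)
  have pos: "p div d1 < d2" "p mod d1 < d1" if "p < d2 * d1" for p
    using that by (auto simp: less_mult_imp_div_less intro!: mod_less_divisor Nat.gr0I)
  have unit_sandwich: "(N * matrix_unit d1 i j * adj N') $$ (a, b) = N $$ (a, i) * cnj (N' $$ (b, j))"
    if N: "N \<in> carrier_mat d2 d1" "N' \<in> carrier_mat d2 d1" and ij: "i < d1" "j < d1" and ab: "a < d2" "b < d2"
    for N N' i j a b
  proof -
    have "(N * matrix_unit d1 i j * adj N') $$ (a, b)
      = (\<Sum>i'<d1. \<Sum>j'<d1. N $$ (a, i') * matrix_unit d1 i j $$ (i', j') * cnj (N' $$ (b, j')))"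
      by (rule sandwich_index[OF N _ ab]) (simp add: matrix_unit_def)
    also have "\<dots> = (\<Sum>i'<d1. \<Sum>j'<d1. if j' = j then (if i' = i then N $$ (a, i') * cnj (N' $$ (b, j')) else 0) else 0)"
      by (intro sum.cong refl) (auto simp: matrix_unit_def)
    also have "\<dots> = N $$ (a, i) * cnj (N' $$ (b, j))" using ij by simp
    finally show ?thesis .
  qed
  have FF: "F * adj F = G * D * adj G"
  proof (rule eq_matI)
    fix p q assume "p < dim_row (G * D * adj G)" "q < dim_col (G * D * adj G)"
    then have pq: "p < d2 * d1" "q < d2 * d1" using c by auto
    note pp = pos[OF pq(1)] pos[OF pq(2)]
    define i j a b where "i = p mod d1" and "j = q mod d1" and "a = p div d1" and "b = q div d1"
    have ij: "i < d1" "j < d1" "a < d2" "b < d2" using pp by (simp_all add: i_def j_def a_def b_def)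
    have Fi: "F $$ (p, k) = L k $$ (a, i)" "F $$ (q, k) = L k $$ (b, j)" if "k < r" for k
      using that pq by (simp_all add: F_def vecs_def i_def j_def a_def b_def)
    have Gi: "G $$ (p, k) = K k $$ (a, i)" "G $$ (q, k) = K k $$ (b, j)" if "k < r" for k
      using that pq by (simp_all add: G_def vecs_def i_def j_def a_def b_def)
    have "(F * adj F) $$ (p, q) = (\<Sum>k<r. L k $$ (a, i) * cnj (L k $$ (b, j)))"
      using c pq by (simp add: mult_index Fi)
    also have "\<dots> = kraus d2 r L (matrix_unit d1 i j) $$ (a, b)"
      using ij by (simp add: kraus_def unit_sandwich[OF L L ij])
    also have "\<dots> = weighted_kraus d2 r K D (matrix_unit d1 i j) $$ (a, b)"
      by (subst eq) (simp_all add: matrix_unit_def)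
    also have "\<dots> = (\<Sum>k<r. \<Sum>l<r. D $$ (k, l) * (K k $$ (a, i) * cnj (K l $$ (b, j))))"
      using ij by (simp add: weighted_kraus_def unit_sandwich[OF K K ij])
    also have "\<dots> = (\<Sum>k<r. \<Sum>l<r. G $$ (p, k) * D $$ (k, l) * cnj (G $$ (q, l)))"
      by (intro sum.cong refl) (simp add: Gi mult.assoc mult.left_commute)
    also have "\<dots> = (G * D * adj G) $$ (p, q)"
      by (rule sandwich_index[OF c(2) c(2) D pq, symmetric])
    finally show "(F * adj F) $$ (p, q) = (G * D * adj G) $$ (p, q)" .
  qed (use c in auto)
  have "x = 0\<^sub>m r 1" if x: "x \<in> carrier_mat r 1" and Gx: "G * x = 0\<^sub>m (d2 * d1) 1" for x
  proof -
    have "mat_comb d1 d2 r K (\<lambda>k. x $$ (k, 0)) = 0\<^sub>m d2 d1"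
    proof (rule eq_matI)
      fix a i assume "a < dim_row (0\<^sub>m d2 d1 :: complex mat)" "i < dim_col (0\<^sub>m d2 d1 :: complex mat)"
      then have ai: "a < d2" "i < d1" by auto
      then have lt: "a * d1 + i < d2 * d1" by (rule block_index_less)
      have "(G * x) $$ (a * d1 + i, 0) = 0" using Gx lt by simp
      then have "(\<Sum>k<r. K k $$ (a, i) * x $$ (k, 0)) = 0"
        using c(2) x lt ai by (simp add: mult_index) (simp add: G_def vecs_def)
      then show "mat_comb d1 d2 r K (\<lambda>k. x $$ (k, 0)) $$ (a, i) = 0\<^sub>m d2 d1 $$ (a, i)"
        using ai by (simp add: mat_comb_def mult.commute)
    qed auto
    then have "\<forall>k<r. x $$ (k, 0) = 0" using indep unfolding mat_independent_def by blast
    then show ?thesis using x by (intro eq_matI) auto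
  qed
  then obtain M where M: "M \<in> carrier_mat r r" "adj M = M" "M * adj G * G = 1\<^sub>m r"
    using injective_has_left_inverse[OF c(2)] by blast
  have M': "adj G * G * M = 1\<^sub>m r"
    using arg_cong[OF M(3), of adj] M(1,2) c by (simp add: mat_simps)
  define H where "H = M * adj G"
  have H: "H \<in> carrier_mat r (d2 * d1)" "H * G = 1\<^sub>m r" "adj G * adj H = 1\<^sub>m r" "adj H = G * M"
    using M M' c by (auto simp: H_def adj_mult mult_assoc_dim)
  define B where "B = adj (H * F)"
  have B: "B \<in> carrier_mat r r" using H c by (simp add: B_def)
  have "adj B * B = H * (F * adj F) * adj H" unfolding B_def using H(1) c by (simp add: mat_simps)
  also have "\<dots> = (H * G) * D * (adj G * adj H)" unfolding FF using H(1) c D by (simp add: mult_assoc_dim)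
  also have "\<dots> = D" unfolding H(2,3) using D by simp
  finally have BB: "adj B * B = D" .
  define W where "W = F * adj F"
  have W: "W \<in> carrier_mat (d2 * d1) (d2 * d1)" using c by (simp add: W_def)
  \<comment> \<open>The orthogonal projection onto the range of \<open>G\<close>, which contains that of \<open>F\<close>.\<close>
  define Q where "Q = G * H"
  have Q: "Q \<in> carrier_mat (d2 * d1) (d2 * d1)" "adj Q = Q"
    using H(1,4) c M by (simp_all add: Q_def adj_mult H_def mult_assoc_dim)
  have "Q * W = G * (H * G) * D * adj G" unfolding W_def FF Q_def using H(1) c D by (simp add: mult_assoc_dim)
  also have "\<dots> = W" unfolding H(2) W_def FF using c D by simp
  finally have QW: "Q * W = W" .
  have "adj W = W" using c by (simp add: W_def adj_mult)
  moreover have "adj (Q * W) = adj W * Q" using Q W by (simp add: adj_mult)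
  ultimately have WQ: "W * Q = W" unfolding QW by simp
  have "(F - Q * F) * adj (F - Q * F) = W - Q * W - (W * Q - Q * (W * Q))"
    unfolding W_def using Q c by (simp add: mat_simps)
  also have "\<dots> = 0\<^sub>m (d2 * d1) (d2 * d1)" unfolding WQ QW using W by (intro eq_matI) auto
  finally have "F - Q * F = 0\<^sub>m (dim_row F) (dim_col F)"
    using mult_adj_self_eq_0[of "F - Q * F"] c Q(1) by simp
  then have "F = Q * F" by (rule diff_eq_0_mat) (use c Q(1) in simp_all)
  also have "Q * F = G * H * F" by (simp add: Q_def)
  also have "G * H * F = G * adj B" using c H(1) by (simp add: B_def mult_assoc_dim)
  finally have FG: "F = G * adj B" .
  have "L k = mat_comb d1 d2 r K (\<lambda>l. cnj (B $$ (k, l)))" if k: "k < r" for k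
  proof (rule eq_matI)
    fix a i assume "a < dim_row (mat_comb d1 d2 r K (\<lambda>l. cnj (B $$ (k, l))))" "i < dim_col (mat_comb d1 d2 r K (\<lambda>l. cnj (B $$ (k, l))))"
    then have ai: "a < d2" "i < d1" by auto
    then have lt: "a * d1 + i < d2 * d1" by (rule block_index_less)
    have "L k $$ (a, i) = F $$ (a * d1 + i, k)" using lt ai k by (simp add: F_def vecs_def)
    also have "\<dots> = (\<Sum>l<r. G $$ (a * d1 + i, l) * cnj (B $$ (k, l)))"
      unfolding FG using c(2) B lt k by (simp add: mult_index)
    also have "\<dots> = (\<Sum>l<r. cnj (B $$ (k, l)) * K l $$ (a, i))"
      using lt ai by (intro sum.cong) (auto simp: G_def vecs_def)
    finally show "L k $$ (a, i) = mat_comb d1 d2 r K (\<lambda>l. cnj (B $$ (k, l))) $$ (a, i)"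
      using ai by (simp add: mat_comb_def)
  qed (use L[of k] in auto)
  then show ?thesis using B BB by blast
qed

section \<open>The algebra attached to a Kraus family\<close>

text \<open>The entries of \<open>B\<close> are conjugated so that the weight belonging to the family \<open>S K\<^sub>k\<close> is
  \<open>B\<^sup>* B\<close> and not \<open>B B\<^sup>*\<close>.\<close>

definition index_algebra :: "nat \<Rightarrow> nat \<Rightarrow> nat \<Rightarrow> (nat \<Rightarrow> complex mat) \<Rightarrow> complex mat set" where
  "index_algebra d1 d2 r K = {B \<in> carrier_mat r r.
     \<exists>S\<in>carrier_mat d2 d2. \<forall>k<r. S * K k = mat_comb d1 d2 r K (\<lambda>l. cnj (B $$ (k, l)))}"

lemma mult_mat_comb_index:
  assumes K: "\<And>k. K k \<in> carrier_mat d2 d1" and S: "S \<in> carrier_mat n d2" and ai: "a < n" "i < d1"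
  shows "(S * mat_comb d1 d2 r K c) $$ (a, i) = (\<Sum>l<r. c l * (S * K l) $$ (a, i))"
proof -
  have "(S * mat_comb d1 d2 r K c) $$ (a, i) = (\<Sum>b<d2. \<Sum>l<r. S $$ (a, b) * (c l * K l $$ (b, i)))"
    using S ai by (simp add: mult_index) (simp add: mat_comb_def sum_distrib_left)
  also have "\<dots> = (\<Sum>l<r. \<Sum>b<d2. S $$ (a, b) * (c l * K l $$ (b, i)))" by (rule sum.swap)
  also have "\<dots> = (\<Sum>l<r. c l * (S * K l) $$ (a, i))"
    using S ai by (simp add: mult_index carrier_matD[OF K] sum_distrib_left mult.left_commute)
  finally show ?thesis .
qed

text \<open>Unitality makes \<open>S\<close> a function of its action on the Kraus operators, which gives the
  closedness of the index algebra.\<close>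

lemma unital_reconstruct:
  assumes K: "\<And>k. K k \<in> carrier_mat d2 d1" and unital: "kraus d2 r K (1\<^sub>m d1) = 1\<^sub>m d2"
    and S: "S \<in> carrier_mat d2 d2" and ab: "a < d2" "b < d2"
  shows "S $$ (a, b) = (\<Sum>k<r. \<Sum>i<d1. (S * K k) $$ (a, i) * cnj (K k $$ (b, i)))"
proof -
  have "S $$ (a, b) = (S * kraus d2 r K (1\<^sub>m d1) * 1\<^sub>m d2) $$ (a, b)" unfolding unital using S ab by simp
  also have "\<dots> = (\<Sum>k<r. (S * (K k * 1\<^sub>m d1 * adj (K k)) * 1\<^sub>m d2) $$ (a, b))"
    by (rule mult_kraus_mult_index[OF K S _ _ ab]) simp_all
  also have "\<dots> = (\<Sum>k<r. (S * K k * adj (K k)) $$ (a, b))"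
    using S by (intro sum.cong refl) (simp add: mult_assoc_dim carrier_matD[OF K])
  also have "\<dots> = (\<Sum>k<r. \<Sum>i<d1. (S * K k) $$ (a, i) * cnj (K k $$ (b, i)))"
    using S ab by (simp add: mult_index[where A = "S * M" and B = "adj M" for M] carrier_matD[OF K])
  finally show ?thesis .
qed

lemma index_algebra_closed:
  assumes K: "\<And>k. K k \<in> carrier_mat d2 d1" and unital: "kraus d2 r K (1\<^sub>m d1) = 1\<^sub>m d2"
  shows "closed_matrix_algebra r (index_algebra d1 d2 r K)"
proof
  fix B assume B: "B \<in> index_algebra d1 d2 r K"
  then obtain S where Bc: "B \<in> carrier_mat r r" and S: "S \<in> carrier_mat d2 d2"
    "\<And>k. k < r \<Longrightarrow> S * K k = mat_comb d1 d2 r K (\<lambda>l. cnj (B $$ (k, l)))" by (auto simp: index_algebra_def)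
  show "B \<in> carrier_mat r r" by (rule Bc)
  fix c
  have "(cnj c \<cdot>\<^sub>m S) * K k = mat_comb d1 d2 r K (\<lambda>l. cnj ((c \<cdot>\<^sub>m B) $$ (k, l)))" if "k < r" for k
  proof -
    have "(cnj c \<cdot>\<^sub>m S) * K k = cnj c \<cdot>\<^sub>m (S * K k)" using S(1) K[of k] by (simp add: smult_mult_dim)
    also have "\<dots> = mat_comb d1 d2 r K (\<lambda>l. cnj ((c \<cdot>\<^sub>m B) $$ (k, l)))"
      unfolding S(2)[OF that] using that Bc by (intro eq_matI) (auto simp: mat_comb_def sum_distrib_left mult.assoc)
    finally show ?thesis .
  qed
  then show "c \<cdot>\<^sub>m B \<in> index_algebra d1 d2 r K"
    unfolding index_algebra_def using Bc S(1) by (auto intro!: bexI[of _ "cnj c \<cdot>\<^sub>m S"])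
next
  fix B C assume B: "B \<in> index_algebra d1 d2 r K" and C: "C \<in> index_algebra d1 d2 r K"
  from B obtain S where Bc: "B \<in> carrier_mat r r" and S: "S \<in> carrier_mat d2 d2"
    "\<And>k. k < r \<Longrightarrow> S * K k = mat_comb d1 d2 r K (\<lambda>l. cnj (B $$ (k, l)))" by (auto simp: index_algebra_def)
  from C obtain R where Cc: "C \<in> carrier_mat r r" and R: "R \<in> carrier_mat d2 d2"
    "\<And>k. k < r \<Longrightarrow> R * K k = mat_comb d1 d2 r K (\<lambda>l. cnj (C $$ (k, l)))" by (auto simp: index_algebra_def)
  have "(S + R) * K k = mat_comb d1 d2 r K (\<lambda>l. cnj ((B + C) $$ (k, l)))" if "k < r" for k
  proof -
    have "(S + R) * K k = S * K k + R * K k" using S(1) R(1) K[of k] by (simp add: add_mult_dim)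
    also have "\<dots> = mat_comb d1 d2 r K (\<lambda>l. cnj ((B + C) $$ (k, l)))"
      unfolding S(2)[OF that] R(2)[OF that] using that Bc Cc
      by (intro eq_matI) (auto simp: mat_comb_def sum.distrib algebra_simps)
    finally show ?thesis .
  qed
  then show "B + C \<in> index_algebra d1 d2 r K"
    unfolding index_algebra_def using Bc Cc S(1) R(1) by (auto intro!: bexI[of _ "S + R"])
  have "(R * S) * K k = mat_comb d1 d2 r K (\<lambda>l. cnj ((B * C) $$ (k, l)))" if k: "k < r" for k
  proof (rule eq_matI)
    fix a i assume "a < dim_row (mat_comb d1 d2 r K (\<lambda>l. cnj ((B * C) $$ (k, l))))"
      "i < dim_col (mat_comb d1 d2 r K (\<lambda>l. cnj ((B * C) $$ (k, l))))"
    then have ai: "a < d2" "i < d1" by auto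
    have "(R * S) * K k = R * mat_comb d1 d2 r K (\<lambda>l. cnj (B $$ (k, l)))"
      using R(1) S K[of k] k by (simp add: mult_assoc_dim)
    then have "((R * S) * K k) $$ (a, i) = (\<Sum>l<r. cnj (B $$ (k, l)) * (\<Sum>m<r. cnj (C $$ (l, m)) * K m $$ (a, i)))"
      using mult_mat_comb_index[where K = K, OF K R(1) ai, of r] ai by (simp add: R(2)) (simp add: mat_comb_def)
    also have "\<dots> = (\<Sum>m<r. \<Sum>l<r. cnj (B $$ (k, l)) * (cnj (C $$ (l, m)) * K m $$ (a, i)))"
      unfolding sum_distrib_left by (rule sum.swap)
    also have "\<dots> = mat_comb d1 d2 r K (\<lambda>l. cnj ((B * C) $$ (k, l))) $$ (a, i)"
      using ai Bc Cc k by (simp add: mat_comb_def mult_index sum_distrib_right mult.assoc)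
    finally show "((R * S) * K k) $$ (a, i) = mat_comb d1 d2 r K (\<lambda>l. cnj ((B * C) $$ (k, l))) $$ (a, i)" .
  qed (use R(1) K[of k] in auto)
  then show "B * C \<in> index_algebra d1 d2 r K"
    unfolding index_algebra_def using Bc Cc S(1) R(1) by (auto intro!: bexI[of _ "R * S"])
next
  have "1\<^sub>m d2 * K k = mat_comb d1 d2 r K (\<lambda>l. cnj (1\<^sub>m r $$ (k, l)))" if k: "k < r" for k
  proof (rule eq_matI)
    fix a i assume "a < dim_row (mat_comb d1 d2 r K (\<lambda>l. cnj (1\<^sub>m r $$ (k, l))))"
      "i < dim_col (mat_comb d1 d2 r K (\<lambda>l. cnj (1\<^sub>m r $$ (k, l))))"
    then have ai: "a < d2" "i < d1" by auto
    have "(\<Sum>l<r. cnj (1\<^sub>m r $$ (k, l)) * K l $$ (a, i)) = (\<Sum>l<r. if l = k then K l $$ (a, i) else 0)"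
      using k by (intro sum.cong) auto
    then show "(1\<^sub>m d2 * K k) $$ (a, i) = mat_comb d1 d2 r K (\<lambda>l. cnj (1\<^sub>m r $$ (k, l))) $$ (a, i)"
      using ai k by (simp add: mat_comb_def carrier_matD[OF K])
  qed (use K[of k] in auto)
  then show "1\<^sub>m r \<in> index_algebra d1 d2 r K"
    unfolding index_algebra_def by (auto intro!: bexI[of _ "1\<^sub>m d2"])
next
  fix Bs B assume Bs: "\<And>n. Bs n \<in> index_algebra d1 d2 r K" and B: "B \<in> carrier_mat r r"
    and lim: "\<And>i j. i < r \<Longrightarrow> j < r \<Longrightarrow> (\<lambda>n. Bs n $$ (i, j)) \<longlonglongrightarrow> B $$ (i, j)"
  have "\<forall>n. \<exists>S. S \<in> carrier_mat d2 d2 \<and> (\<forall>k<r. S * K k = mat_comb d1 d2 r K (\<lambda>l. cnj (Bs n $$ (k, l))))"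
    using Bs by (auto simp: index_algebra_def)
  then obtain S where S: "\<And>n. S n \<in> carrier_mat d2 d2"
    "\<And>n k. k < r \<Longrightarrow> S n * K k = mat_comb d1 d2 r K (\<lambda>l. cnj (Bs n $$ (k, l)))" by metis
  have comb_lim: "(\<lambda>n. mat_comb d1 d2 r K (\<lambda>l. cnj (Bs n $$ (k, l))) $$ (a, i))
    \<longlonglongrightarrow> mat_comb d1 d2 r K (\<lambda>l. cnj (B $$ (k, l))) $$ (a, i)" if "k < r" "a < d2" "i < d1" for k a i
    using that unfolding mat_comb_def by (auto intro!: tendsto_sum tendsto_mult tendsto_cnj lim)
  define R where "R = mat d2 d2 (\<lambda>(a, b). \<Sum>k<r. \<Sum>i<d1.
    mat_comb d1 d2 r K (\<lambda>l. cnj (B $$ (k, l))) $$ (a, i) * cnj (K k $$ (b, i)))"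
  have R: "R \<in> carrier_mat d2 d2" by (simp add: R_def)
  have Slim: "(\<lambda>n. S n $$ (a, b)) \<longlonglongrightarrow> R $$ (a, b)" if ab: "a < d2" "b < d2" for a b
  proof -
    have "S n $$ (a, b) = (\<Sum>k<r. \<Sum>i<d1. mat_comb d1 d2 r K (\<lambda>l. cnj (Bs n $$ (k, l))) $$ (a, i) * cnj (K k $$ (b, i)))" for n
      using unital_reconstruct[where K = K, OF K unital S(1) ab, of n] by (simp add: S(2))
    moreover have "(\<lambda>n. \<Sum>k<r. \<Sum>i<d1. mat_comb d1 d2 r K (\<lambda>l. cnj (Bs n $$ (k, l))) $$ (a, i) * cnj (K k $$ (b, i)))
      \<longlonglongrightarrow> R $$ (a, b)"
      using ab unfolding R_def by (auto intro!: tendsto_sum tendsto_mult comb_lim)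
    ultimately show ?thesis by simp
  qed
  have "R * K k = mat_comb d1 d2 r K (\<lambda>l. cnj (B $$ (k, l)))" if k: "k < r" for k
  proof (rule eq_matI)
    fix a i assume "a < dim_row (mat_comb d1 d2 r K (\<lambda>l. cnj (B $$ (k, l))))"
      "i < dim_col (mat_comb d1 d2 r K (\<lambda>l. cnj (B $$ (k, l))))"
    then have ai: "a < d2" "i < d1" by auto
    have "(\<lambda>n. (S n * K k) $$ (a, i)) \<longlonglongrightarrow> (R * K k) $$ (a, i)"
      by (rule tendsto_mult_mat_index[where a = d2 and b = d2 and c = d1]) (use S(1) R K Slim ai in auto)
    then have "(\<lambda>n. mat_comb d1 d2 r K (\<lambda>l. cnj (Bs n $$ (k, l))) $$ (a, i)) \<longlonglongrightarrow> (R * K k) $$ (a, i)"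
      unfolding S(2)[OF k] .
    then show "(R * K k) $$ (a, i) = mat_comb d1 d2 r K (\<lambda>l. cnj (B $$ (k, l))) $$ (a, i)"
      using comb_lim[OF k ai] LIMSEQ_unique by blast
  qed (use R K[of k] in auto)
  then show "B \<in> index_algebra d1 d2 r K" unfolding index_algebra_def using B R by blast
qed

lemma mat_fsum_two:
  assumes "F 0 \<in> carrier_mat d d" "F 1 \<in> carrier_mat d d"
  shows "mat_fsum d F 2 = F 0 + F (Suc 0)"
proof -
  interpret abelian_group "module_mat TYPE(complex) d d" by (rule abelian_group_mat)
  have F: "F (Suc 0) \<in> carrier (module_mat TYPE(complex) d d)" "F 0 \<in> carrier (module_mat TYPE(complex) d d)"
    using assms by (simp_all add: module_mat_simps)
  have set: "{..<2 :: nat} = insert 0 (insert (Suc 0) {})" by auto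
  have "finsum (module_mat TYPE(complex) d d) F (insert (Suc 0) {}) = F (Suc 0)"
    using F finsum_insert[of "{}" "Suc 0" F] assms by (simp add: module_mat_simps)
  then have "mat_fsum d F 2 = F 0 \<oplus>\<^bsub>module_mat TYPE(complex) d d\<^esub> F (Suc 0)"
    unfolding set using F finsum_insert[of "{Suc 0}" 0 F] by auto
  then show ?thesis by (simp add: module_mat_simps)
qed

text \<open>This is where extremality enters.  Scale \<open>D = C\<^sup>* C\<close> so that \<open>D\<close> and \<open>1 - D\<close> are bounded
  below; then \<open>\<Phi>\<close> is the \<open>C\<^sup>*\<close>-convex combination of the normalised weighted sums with weights
  \<open>D\<close> and \<open>1 - D\<close>.  Extremality makes the first one a conjugate of \<open>\<Phi>\<close>, that is, the Kraus
  operators \<open>S K\<^sub>k\<close> give the \<open>D\<close>-weighted sum for some invertible \<open>S\<close>.\<close>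

lemma Cstar_extreme_gram_complete:
  assumes ext: "Cstar_extreme d1 d2 \<Phi>"
    and K: "\<And>k. K k \<in> carrier_mat d2 d1" and indep: "mat_independent d1 d2 r K"
    and \<Phi>: "\<And>X. X \<in> carrier_mat d1 d1 \<Longrightarrow> \<Phi> X = kraus d2 r K X"
  shows "gram_complete r {} (index_algebra d1 d2 r K)"
  unfolding gram_complete_def
proof (intro ballI impI)
  have unital: "kraus d2 r K (1\<^sub>m d1) = 1\<^sub>m d2"
    using ext \<Phi>[of "1\<^sub>m d1"] by (simp add: Cstar_extreme_def UCP_def)
  interpret closed_matrix_algebra r "index_algebra d1 d2 r K" by (rule index_algebra_closed[OF K unital])
  fix C C' :: "complex mat" assume C: "C \<in> carrier_mat r r" and C': "C' \<in> carrier_mat r r" "C' * C = 1\<^sub>m r"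
  obtain c where c: "c > 0" "psd r (complex_of_real c \<cdot>\<^sub>m 1\<^sub>m r - adj C * C)" using gram_le_scalar[OF C] by blast
  obtain c' where c': "c' > 0" "psd r (complex_of_real c' \<cdot>\<^sub>m 1\<^sub>m r - adj C' * C')" using gram_le_scalar[OF C'(1)] by blast
  \<comment> \<open>\<open>C\<^sup>* C \<le> c\<close>, so this factor keeps \<open>D \<le> 1/2\<close> and hence \<open>1 - D \<ge> 1/2\<close>.\<close>
  define t where "t = 1 / (2 * c)"
  have t: "t > 0" "complex_of_real t * complex_of_real c = 1 / 2" using c by (simp_all add: t_def)
  define D where "D = complex_of_real t \<cdot>\<^sub>m (adj C * C)"
  define E where "E = 1\<^sub>m r - D"
  have D: "D \<in> carrier_mat r r" and E: "E \<in> carrier_mat r r" and DE: "D + E = 1\<^sub>m r"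
    using C by (auto simp: D_def E_def minus_carrier_mat intro!: eq_matI)
  have "E - complex_of_real (1 / 2) \<cdot>\<^sub>m 1\<^sub>m r = complex_of_real t \<cdot>\<^sub>m (complex_of_real c \<cdot>\<^sub>m 1\<^sub>m r - adj C * C)"
    using C t(2) by (intro eq_matI) (auto simp: E_def D_def algebra_simps)
  then have psdE: "psd r (E - complex_of_real (1 / 2) \<cdot>\<^sub>m 1\<^sub>m r)"
    using psd_smult[OF c(2), of "complex_of_real t"] t(1) by (simp add: less_eq_complex_def)
  have CC': "adj C * (adj C' * C') * C = 1\<^sub>m r"
  proof -
    have "adj C * (adj C' * C') * C = adj (C' * C) * (C' * C)" using C C'(1) by (simp add: mat_simps)
    then show ?thesis unfolding C'(2) by simp
  qed
  have "adj C * (complex_of_real c' \<cdot>\<^sub>m 1\<^sub>m r - adj C' * C') * C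
    = complex_of_real c' \<cdot>\<^sub>m (adj C * C) - adj C * (adj C' * C') * C"
    using C C'(1) by (simp add: mult_minus_dim minus_mult_dim mult_smult_dim smult_mult_dim mult_assoc_dim)
  also have "\<dots> = complex_of_real (c' / t) \<cdot>\<^sub>m (D - complex_of_real (t / c') \<cdot>\<^sub>m 1\<^sub>m r)"
    unfolding CC' D_def using C t(1) c'(1) by (intro eq_matI) (auto simp: field_simps)
  finally have "complex_of_real (t / c') \<cdot>\<^sub>m (adj C * (complex_of_real c' \<cdot>\<^sub>m 1\<^sub>m r - adj C' * C') * C)
    = (complex_of_real (t / c') * complex_of_real (c' / t)) \<cdot>\<^sub>m (D - complex_of_real (t / c') \<cdot>\<^sub>m 1\<^sub>m r)"
    by (simp add: smult_smult_mat)
  also have "complex_of_real (t / c') * complex_of_real (c' / t) = 1" using t(1) c'(1) by (simp flip: of_real_mult)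
  finally have "D - complex_of_real (t / c') \<cdot>\<^sub>m 1\<^sub>m r
    = complex_of_real (t / c') \<cdot>\<^sub>m (adj C * (complex_of_real c' \<cdot>\<^sub>m 1\<^sub>m r - adj C' * C') * C)"
    by (simp add: one_smult_mat)
  then have psdD: "psd r (D - complex_of_real (t / c') \<cdot>\<^sub>m 1\<^sub>m r)"
    using psd_smult[OF psd_congruence[OF c'(2) C], of "complex_of_real (t / c')"] t(1) c'(1)
    by (simp add: less_eq_complex_def)
  have tc': "t / c' > 0" using t(1) c'(1) by simp
  obtain T T' \<Psi> where T: "T \<in> carrier_mat d2 d2" "T' \<in> carrier_mat d2 d2" "\<Psi> \<in> UCP d1 d2" "T' * T = 1\<^sub>m d2" "T * T' = 1\<^sub>m d2"
    "adj T * T = weighted_kraus d2 r K D (1\<^sub>m d1)" "\<And>X. X \<in> carrier_mat d1 d1 \<Longrightarrow> Ad T (\<Psi> X) = weighted_kraus d2 r K D X"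
    using weighted_kraus_normalized[OF K unital D tc' psdD] by blast
  obtain R R' \<Theta> where R: "R \<in> carrier_mat d2 d2" "R' \<in> carrier_mat d2 d2" "\<Theta> \<in> UCP d1 d2" "R' * R = 1\<^sub>m d2" "R * R' = 1\<^sub>m d2"
    "adj R * R = weighted_kraus d2 r K E (1\<^sub>m d1)" "\<And>X. X \<in> carrier_mat d1 d1 \<Longrightarrow> Ad R (\<Theta> X) = weighted_kraus d2 r K E X"
    using weighted_kraus_normalized[OF K unital E _ psdE] by auto
  have wsum: "weighted_kraus d2 r K D X + weighted_kraus d2 r K E X = kraus d2 r K X" for X
    unfolding weighted_kraus_add[OF D E, symmetric] DE by (rule weighted_kraus_one)
  have wc: "weighted_kraus d2 r K Q X \<in> carrier_mat d2 d2" for Q X by (simp add: weighted_kraus_def)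
  define Ts where "Ts i = (if i = (0 :: nat) then T else R)" for i
  define \<Psi>s where "\<Psi>s i = (if i = (0 :: nat) then \<Psi> else \<Theta>)" for i
  have "\<forall>i<2. Ts i \<in> carrier_mat d2 d2 \<and> invertible_mat (Ts i)"
    using T R unfolding invertible_mat_def inverts_mat_def by (auto simp: Ts_def)
  moreover have "mat_fsum d2 (\<lambda>i. mat_adjoint (Ts i) * Ts i) 2 = 1\<^sub>m d2"
    using T(1,6) R(1,6) wsum[of "1\<^sub>m d1"] unital by (subst mat_fsum_two) (auto simp: Ts_def wc)
  moreover have "\<forall>i<2. \<Psi>s i \<in> UCP d1 d2" using T(3) R(3) by (simp add: \<Psi>s_def)
  moreover have "\<forall>X\<in>carrier_mat d1 d1. \<Phi> X = mat_fsum d2 (\<lambda>i. Ad (Ts i) (\<Psi>s i X)) 2"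
  proof
    fix X :: "complex mat" assume X: "X \<in> carrier_mat d1 d1"
    show "\<Phi> X = mat_fsum d2 (\<lambda>i. Ad (Ts i) (\<Psi>s i X)) 2"
      using T(7)[OF X] R(7)[OF X] wsum[of X] \<Phi>[OF X] by (subst mat_fsum_two) (auto simp: Ts_def \<Psi>s_def wc)
  qed
  ultimately obtain U where U: "\<forall>i<2. unitary_mat d2 (U i) \<and> (\<forall>X\<in>carrier_mat d1 d1. \<Psi>s i X = Ad (U i) (\<Phi> X))"
    using ext unfolding Cstar_extreme_def by blast
  have Uc: "U 0 \<in> carrier_mat d2 d2" and \<Psi>U: "\<And>X. X \<in> carrier_mat d1 d1 \<Longrightarrow> \<Psi> X = Ad (U 0) (\<Phi> X)"
    using U[rule_format, of 0] by (auto simp: unitary_mat_def \<Psi>s_def)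
  define S where "S = adj T * adj (U 0)"
  have S: "S \<in> carrier_mat d2 d2" using T(1) Uc by (simp add: S_def)
  have "kraus d2 r (\<lambda>k. S * K k) X = weighted_kraus d2 r K D X" if X: "X \<in> carrier_mat d1 d1" for X
  proof -
    have "kraus d2 r (\<lambda>k. S * K k) X = S * \<Phi> X * adj S"
      unfolding \<Phi>[OF X] by (rule kraus_conjugate[OF K S X, symmetric])
    also have "\<dots> = Ad T (\<Psi> X)"
      unfolding \<Psi>U[OF X] Ad_def S_def using T(1) Uc \<Phi>[OF X] by (simp add: adj_mult mult_assoc_dim)
    finally show ?thesis using T(7)[OF X] by simp
  qed
  then obtain B where B: "B \<in> carrier_mat r r" "adj B * B = D"
    "\<forall>k<r. S * K k = mat_comb d1 d2 r K (\<lambda>l. cnj (B $$ (k, l)))"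
    using kraus_comparison[OF K indep _ D, of "\<lambda>k. S * K k"] S carrier_matD[OF K] by auto
  then have BA: "B \<in> index_algebra d1 d2 r K" using S by (auto simp: index_algebra_def)
  obtain s where s: "s * s * complex_of_real t = 1" "cnj s = s"
    using inverse_sqrt_scalar[OF t(1)] by blast
  have "adj (s \<cdot>\<^sub>m B) * (s \<cdot>\<^sub>m B) = (s * s) \<cdot>\<^sub>m (adj B * B)"
    unfolding adj_smult s(2) using B(1) by (simp add: smult_mult_dim mult_smult_dim smult_smult_mat)
  also have "\<dots> = adj C * C" unfolding B(2) D_def smult_smult_mat s(1) by (rule one_smult_mat)
  finally show "\<exists>B\<in>index_algebra d1 d2 r K. adj B * B = adj C * C" using smult[OF BA] by blast
qed

section \<open>Kraus operators with orthogonal ranges and degradability\<close>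

text \<open>If \<open>f f\<^sup>*\<close> lies in the index algebra, the corresponding \<open>S\<close> maps each \<open>K\<^sub>j\<close> to a multiple of
  \<open>K' = \<Sum>\<^sub>l f\<^sub>l K\<^sub>l\<close>.  In the rotated family it fixes \<open>K'\<close> and kills the other members, whence
  \<open>S = K' K'\<^sup>*\<close> by unitality.\<close>

lemma Cstar_extreme_orthogonal_kraus:
  assumes ext: "Cstar_extreme d1 d2 \<Phi>"
  shows "\<exists>r K. (\<forall>k. K k \<in> carrier_mat d2 d1) \<and> (\<forall>X\<in>carrier_mat d1 d1. \<Phi> X = kraus d2 r K X) \<and>
    (\<forall>k<r. \<forall>m<r. k \<noteq> m \<longrightarrow> adj (K k) * K m = 0\<^sub>m d1 d1) \<and> (\<forall>k<r. K k * adj (K k) * K k = K k)"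
proof -
  have cp: "cp_map d1 d2 \<Phi>" using ext by (simp add: Cstar_extreme_def UCP_def)
  obtain r K where K: "\<And>k. K k \<in> carrier_mat d2 d1" and indep: "mat_independent d1 d2 r K"
    and \<Phi>: "\<And>X. X \<in> carrier_mat d1 d1 \<Longrightarrow> \<Phi> X = kraus d2 r K X"
    using kraus_decomposition[OF cp] by blast
  have unital: "kraus d2 r K (1\<^sub>m d1) = 1\<^sub>m d2"
    using ext \<Phi>[of "1\<^sub>m d1"] by (simp add: Cstar_extreme_def UCP_def)
  interpret closed_matrix_algebra r "index_algebra d1 d2 r K" by (rule index_algebra_closed[OF K unital])
  obtain f where f: "\<And>k. k < r \<Longrightarrow> f k \<in> carrier_mat r 1" "\<And>k. k < r \<Longrightarrow> f k * adj (f k) \<in> index_algebra d1 d2 r K"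
    "\<And>k l. k < r \<Longrightarrow> l < r \<Longrightarrow> adj (f k) * f l = (if k = l then 1\<^sub>m 1 else 0\<^sub>m 1 1)"
    using diagonal_projections_in_algebra[OF Cstar_extreme_gram_complete[OF ext K indep \<Phi>]] by blast
  define K' where "K' k = mat_comb d1 d2 r K (\<lambda>l. f k $$ (l, 0))" for k
  have K': "K' k \<in> carrier_mat d2 d1" for k by (simp add: K'_def)
  have orth: "(\<Sum>j<r. cnj (f k $$ (j, 0)) * f m $$ (j, 0)) = (if k = m then 1 else 0)" if km: "k < r" "m < r" for k m
  proof -
    have "(\<Sum>j<r. cnj (f k $$ (j, 0)) * f m $$ (j, 0)) = (adj (f k) * f m) $$ (0, 0)"
      using f(1)[OF km(1)] f(1)[OF km(2)] by (simp add: mult_index)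
    then show ?thesis using f(3)[OF km] by simp
  qed
  \<comment> \<open>The coefficients \<open>f\<^sub>k\<close> are orthonormal, so the new operators decompose the same map.\<close>
  define V where "V = mat r r (\<lambda>(m, k). cnj (f m $$ (k, 0)))"
  have V: "V \<in> carrier_mat r r" by (simp add: V_def)
  have "V * adj V = 1\<^sub>m r"
  proof (rule eq_matI)
    fix k m assume "k < dim_row (1\<^sub>m r :: complex mat)" "m < dim_col (1\<^sub>m r :: complex mat)"
    then have km: "k < r" "m < r" by auto
    have "(V * adj V) $$ (k, m) = (\<Sum>j<r. V $$ (k, j) * cnj (V $$ (m, j)))"
      using V km by (simp add: mult_index)
    also have "\<dots> = (\<Sum>j<r. cnj (f k $$ (j, 0)) * f m $$ (j, 0))" using km by (simp add: V_def)
    finally show "(V * adj V) $$ (k, m) = 1\<^sub>m r $$ (k, m)" using orth[OF km] km by simp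
  qed (use V in auto)
  then have VV: "adj V * V = 1\<^sub>m r" by (rule mat_mult_left_right_inverse[rotated 2]) (use V in simp_all)
  have \<Phi>': "\<Phi> X = kraus d2 r K' X" if X: "X \<in> carrier_mat d1 d1" for X
  proof -
    have "kraus d2 r K' X = kraus d2 r (\<lambda>m. mat_comb d1 d2 r K (\<lambda>k. cnj (V $$ (m, k)))) X"
    proof -
      have "K' m = mat_comb d1 d2 r K (\<lambda>k. cnj (V $$ (m, k)))" if "m < r" for m
        unfolding K'_def mat_comb_def by (rule cong_mat) (use that in \<open>simp_all add: V_def\<close>)
      then show ?thesis by (simp add: kraus_def)
    qed
    also have "\<dots> = kraus d2 r K X"
      unfolding kraus_of_combinations[OF K X V] VV by (rule weighted_kraus_one)
    finally show ?thesis using \<Phi>[OF X] by simp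
  qed
  have unital': "kraus d2 r K' (1\<^sub>m d1) = 1\<^sub>m d2" using \<Phi>'[of "1\<^sub>m d1"] \<Phi>[of "1\<^sub>m d1"] unital by simp
  have proj: "K' k * adj (K' k) * K' m = (if k = m then K' k else 0\<^sub>m d2 d1)" if km: "k < r" "m < r" for k m
  proof -
    obtain S where S: "S \<in> carrier_mat d2 d2"
      "\<And>j. j < r \<Longrightarrow> S * K j = mat_comb d1 d2 r K (\<lambda>l. cnj ((f k * adj (f k)) $$ (j, l)))"
      using f(2)[OF km(1)] unfolding index_algebra_def by blast
    have SK: "S * K j = cnj (f k $$ (j, 0)) \<cdot>\<^sub>m K' k" if j: "j < r" for j
    proof (rule eq_matI)
      fix a i assume "a < dim_row (cnj (f k $$ (j, 0)) \<cdot>\<^sub>m K' k)" "i < dim_col (cnj (f k $$ (j, 0)) \<cdot>\<^sub>m K' k)"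
      then have ai: "a < d2" "i < d1" using K'[of k] by auto
      have fl: "cnj ((f k * adj (f k)) $$ (j, l)) = cnj (f k $$ (j, 0)) * f k $$ (l, 0)" if "l < r" for l
        using f(1)[OF km(1)] j that by (simp add: mult_index)
      have "(S * K j) $$ (a, i) = (\<Sum>l<r. cnj ((f k * adj (f k)) $$ (j, l)) * K l $$ (a, i))"
        unfolding S(2)[OF j] using ai by (simp add: mat_comb_def)
      also have "\<dots> = (\<Sum>l<r. cnj (f k $$ (j, 0)) * (f k $$ (l, 0) * K l $$ (a, i)))"
        by (intro sum.cong refl) (simp add: fl)
      also have "\<dots> = (cnj (f k $$ (j, 0)) \<cdot>\<^sub>m K' k) $$ (a, i)"
        using ai by (simp add: K'_def mat_comb_def sum_distrib_left)
      finally show "(S * K j) $$ (a, i) = (cnj (f k $$ (j, 0)) \<cdot>\<^sub>m K' k) $$ (a, i)" .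
    qed (use S(1) K[of j] K'[of k] in auto)
    have SK': "S * K' m = (if k = m then K' k else 0\<^sub>m d2 d1)" if m: "m < r" for m
    proof (rule eq_matI)
      fix a i assume "a < dim_row (if k = m then K' k else 0\<^sub>m d2 d1)" "i < dim_col (if k = m then K' k else 0\<^sub>m d2 d1)"
      then have ai: "a < d2" "i < d1" using K'[of k] by (auto split: if_splits)
      have "(S * K' m) $$ (a, i) = (\<Sum>j<r. f m $$ (j, 0) * (S * K j) $$ (a, i))"
        unfolding K'_def by (rule mult_mat_comb_index[OF K S(1) ai])
      also have "\<dots> = (\<Sum>j<r. cnj (f k $$ (j, 0)) * f m $$ (j, 0)) * K' k $$ (a, i)"
        using ai K'[of k] by (simp add: SK sum_distrib_right mult.assoc mult.left_commute)
      finally show "(S * K' m) $$ (a, i) = (if k = m then K' k else 0\<^sub>m d2 d1) $$ (a, i)"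
        using orth[OF km(1) m] ai by simp
    qed (use S(1) K'[of m] K'[of k] in auto)
    have "S = K' k * adj (K' k)"
    proof (rule eq_matI)
      fix a b assume "a < dim_row (K' k * adj (K' k))" "b < dim_col (K' k * adj (K' k))"
      then have ab: "a < d2" "b < d2" using K'[of k] by auto
      have "S $$ (a, b) = (\<Sum>m<r. \<Sum>i<d1. (S * K' m) $$ (a, i) * cnj (K' m $$ (b, i)))"
        by (rule unital_reconstruct[OF K' unital' S(1) ab])
      also have "\<dots> = (\<Sum>m<r. if m = k then (\<Sum>i<d1. K' k $$ (a, i) * cnj (K' k $$ (b, i))) else 0)"
        using ab by (intro sum.cong) (auto simp: SK')
      also have "\<dots> = (K' k * adj (K' k)) $$ (a, b)"
        using km ab by (simp add: mult_index carrier_matD[OF K'])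
      finally show "S $$ (a, b) = (K' k * adj (K' k)) $$ (a, b)" .
    qed (use S(1) K'[of k] in auto)
    then show ?thesis using SK'[OF km(2)] by simp
  qed
  have "adj (K' k) * K' m = 0\<^sub>m d1 d1" if km: "k < r" "m < r" "k \<noteq> m" for k m
  proof -
    have "adj (adj (K' k) * K' m) * (adj (K' k) * K' m) = adj (K' m) * (K' k * adj (K' k) * K' m)"
      using K'[of k] K'[of m] by (simp add: adj_mult mult_assoc_dim)
    also have "\<dots> = 0\<^sub>m d1 d1" unfolding proj[OF km(1,2)] using km(3) K'[of m] by simp
    finally show ?thesis using adj_mult_self_eq_0[of "adj (K' k) * K' m"] K'[of k] K'[of m] by simp
  qed
  moreover have "K' k * adj (K' k) * K' k = K' k" if "k < r" for k using proj[OF that that] by simp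
  ultimately show ?thesis using K' \<Phi>' by blast
qed

lemma sum_diag_mult_comm:
  assumes "A \<in> carrier_mat n m" "B \<in> carrier_mat m n"
  shows "(\<Sum>i<n. (A * B) $$ (i, i)) = (\<Sum>j<m. (B * A) $$ (j, j) :: complex)"
proof -
  have "(\<Sum>i<n. (A * B) $$ (i, i)) = (\<Sum>i<n. \<Sum>j<m. A $$ (i, j) * B $$ (j, i))"
    using assms by (simp add: mult_index)
  also have "\<dots> = (\<Sum>j<m. \<Sum>i<n. A $$ (i, j) * B $$ (j, i))" by (rule sum.swap)
  also have "\<dots> = (\<Sum>j<m. (B * A) $$ (j, j))" using assms by (simp add: mult_index mult.commute)
  finally show ?thesis .
qed

text \<open>The environment of such a channel sees the diagonal matrix with entries
  \<open>tr (K\<^sub>k X K\<^sub>k\<^sup>*)\<close>, since \<open>tr (K\<^sub>k X K\<^sub>l\<^sup>*) = 0\<close> for \<open>k \<noteq> l\<close>.  These numbers are \<open>tr (K\<^sub>k\<^sup>* \<Phi>(X) K\<^sub>k)\<close>,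
  so measuring the output with the projections \<open>K\<^sub>k K\<^sub>k\<^sup>*\<close> recovers them.\<close>

lemma orthogonal_kraus_degradable:
  assumes cp: "cp_map d1 d2 \<Phi>" and K: "\<And>k. K k \<in> carrier_mat d2 d1"
    and \<Phi>: "\<And>X. X \<in> carrier_mat d1 d1 \<Longrightarrow> \<Phi> X = kraus d2 r K X"
    and orth: "\<And>k m. k < r \<Longrightarrow> m < r \<Longrightarrow> k \<noteq> m \<Longrightarrow> adj (K k) * K m = 0\<^sub>m d1 d1"
    and iso: "\<And>k. k < r \<Longrightarrow> K k * adj (K k) * K k = K k"
  shows "degradable d1 d2 \<Phi>"
proof -
  \<comment> \<open>The measurement, with one Kraus operator \<open>e\<^sub>k (K\<^sub>k e\<^sub>i)\<^sup>*\<close> for each pair \<open>(k, i)\<close>.\<close>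
  define N where "N p = mat r d2 (\<lambda>(u, a). if u = p div d1 then cnj (K u $$ (a, p mod d1)) else 0)" for p
  have N: "N p \<in> carrier_mat r d2" for p by (simp add: N_def)
  define \<Gamma> where "\<Gamma> = kraus r (r * d1) N"
  have cp\<Gamma>: "cp_map d2 r \<Gamma>" unfolding \<Gamma>_def by (rule kraus_cp[OF N])
  have \<Gamma>: "\<Gamma> Y $$ (u, v) = (if u = v then \<Sum>i<d1. (adj (K u) * Y * K u) $$ (i, i) else 0)"
    if Y: "Y \<in> carrier_mat d2 d2" and uv: "u < r" "v < r" for Y u v
  proof -
    have "\<Gamma> Y $$ (u, v) = (\<Sum>p<r * d1. \<Sum>a<d2. \<Sum>b<d2. N p $$ (u, a) * Y $$ (a, b) * cnj (N p $$ (v, b)))"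
      using uv by (simp add: \<Gamma>_def kraus_def sandwich_index[OF N N Y uv])
    also have "\<dots> = (\<Sum>p<r * d1. if p div d1 = u then (if u = v then
        (\<Sum>a<d2. \<Sum>b<d2. cnj (K u $$ (a, p mod d1)) * Y $$ (a, b) * K u $$ (b, p mod d1)) else 0) else 0)"
      using uv by (intro sum.cong) (auto simp: N_def)
    also have "\<dots> = (\<Sum>i<d1. if u = v then
        (\<Sum>a<d2. \<Sum>b<d2. cnj (K u $$ (a, i)) * Y $$ (a, b) * K u $$ (b, i)) else 0)"
      unfolding sum_over_block[OF uv(1)] by (rule sum.cong[OF refl]) simp
    also have "\<dots> = (if u = v then \<Sum>i<d1. (adj (K u) * Y * K u) $$ (i, i) else 0)"
    proof -
      have diag: "(adj (K u) * Y * adj (adj (K u))) $$ (i, i)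
        = (\<Sum>a<d2. \<Sum>b<d2. adj (K u) $$ (i, a) * Y $$ (a, b) * cnj (adj (K u) $$ (i, b)))" if "i < d1" for i
        by (rule sandwich_index[OF _ _ Y that that]) (use K in simp_all)
      have "(\<Sum>i<d1. \<Sum>a<d2. \<Sum>b<d2. cnj (K u $$ (a, i)) * Y $$ (a, b) * K u $$ (b, i))
        = (\<Sum>i<d1. (adj (K u) * Y * K u) $$ (i, i))"
        by (rule sum.cong[OF refl]) (use diag in \<open>simp add: carrier_matD[OF K]\<close>)
      then show ?thesis by (cases "u = v") simp_all
    qed
    finally show ?thesis .
  qed
  have trace_\<Phi>: "(\<Sum>i<d1. (adj (K u) * \<Phi> X * K u) $$ (i, i)) = (\<Sum>i<d2. (K u * X * adj (K u)) $$ (i, i))"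
    if X: "X \<in> carrier_mat d1 d1" and u: "u < r" for X u
  proof -
    have cross: "adj (K u) * (K k * X * adj (K k)) * K u = 0\<^sub>m d1 d1" if k: "k < r" "k \<noteq> u" for k
    proof -
      have "adj (K u) * (K k * X * adj (K k)) * K u = (adj (K u) * K k) * (X * adj (K k) * K u)"
        using K[of k] K[of u] X by (simp add: mult_assoc_dim)
      also have "\<dots> = 0\<^sub>m d1 d1" unfolding orth[OF u k(1) k(2)[symmetric]] using K[of u] X by simp
      finally show ?thesis .
    qed
    have diag: "(adj (K u) * \<Phi> X * K u) $$ (i, i) = (adj (K u) * (K u * X * adj (K u)) * K u) $$ (i, i)" if i: "i < d1" for i
    proof -
      have "(adj (K u) * \<Phi> X * K u) $$ (i, i) = (\<Sum>k<r. (adj (K u) * (K k * X * adj (K k)) * K u) $$ (i, i))"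
        unfolding \<Phi>[OF X] by (rule mult_kraus_mult_index[OF K _ K X i i]) (use K in simp)
      also have "\<dots> = (\<Sum>k<r. if k = u then (adj (K u) * (K u * X * adj (K u)) * K u) $$ (i, i) else 0)"
        using i by (intro sum.cong) (auto simp: cross)
      finally show ?thesis using u by simp
    qed
    have "adj (K u) * (K u * X * adj (K u)) * K u = adj (K u) * (K u * X * adj (K u) * K u)"
      using K[of u] X by (simp add: mult_assoc_dim)
    then have "(\<Sum>i<d1. (adj (K u) * \<Phi> X * K u) $$ (i, i))
      = (\<Sum>i<d1. (adj (K u) * (K u * X * adj (K u) * K u)) $$ (i, i))"
      by (intro sum.cong[OF refl]) (simp only: diag lessThan_iff)
    also have "\<dots> = (\<Sum>i<d2. (K u * X * adj (K u) * K u * adj (K u)) $$ (i, i))"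
      by (rule sum_diag_mult_comm) (use K X in \<open>simp_all add: carrier_matD[OF K]\<close>)
    also have "K u * X * adj (K u) * K u * adj (K u) = K u * X * adj (K u * adj (K u) * K u)"
      using K[of u] X by (simp add: adj_mult mult_assoc_dim)
    also have "\<dots> = K u * X * adj (K u)" unfolding iso[OF u] ..
    finally show ?thesis .
  qed
  define A where "A = mat (d2 * r) d1 (\<lambda>(p, j). K (p mod r) $$ (p div r, j))"
  have A: "A \<in> carrier_mat (d2 * r) d1" by (simp add: A_def)
  have AXA: "(A * X * adj A) $$ (i * r + k, j * r + l) = (K k * X * adj (K l)) $$ (i, j)"
    if X: "X \<in> carrier_mat d1 d1" and ij: "i < d2" "j < d2" and kl: "k < r" "l < r" for X i j k l
  proof -
    have lt: "i * r + k < d2 * r" "j * r + l < d2 * r" using block_index_less ij kl by auto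
    show ?thesis
      unfolding sandwich_index[OF A A X lt] sandwich_index[OF K K X ij]
      using lt kl by (intro sum.cong) (auto simp: A_def)
  qed
  have env: "\<Phi> X = id_tensor_tr d2 r (A * X * adj A) \<and> (\<Gamma> \<circ> \<Phi>) X = tr_tensor_id d2 r (A * X * adj A)"
    if X: "X \<in> carrier_mat d1 d1" for X
  proof
    show "\<Phi> X = id_tensor_tr d2 r (A * X * adj A)"
      unfolding \<Phi>[OF X] kraus_def id_tensor_tr_def by (intro eq_matI) (auto simp: AXA[OF X])
    have \<Phi>c: "\<Phi> X \<in> carrier_mat d2 d2" unfolding \<Phi>[OF X] by simp
    show "(\<Gamma> \<circ> \<Phi>) X = tr_tensor_id d2 r (A * X * adj A)"
    proof (rule eq_matI)
      fix u v assume "u < dim_row (tr_tensor_id d2 r (A * X * adj A))" "v < dim_col (tr_tensor_id d2 r (A * X * adj A))"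
      then have uv: "u < r" "v < r" by (auto simp: tr_tensor_id_def)
      have "tr_tensor_id d2 r (A * X * adj A) $$ (u, v) = (\<Sum>i<d2. (K u * X * adj (K v)) $$ (i, i))"
        using uv by (simp add: tr_tensor_id_def AXA[OF X])
      also have "\<dots> = (\<Gamma> \<circ> \<Phi>) X $$ (u, v)"
      proof (cases "u = v")
        case True
        then show ?thesis using \<Gamma>[OF \<Phi>c uv] trace_\<Phi>[OF X uv(1)] by simp
      next
        case False
        have "(\<Sum>i<d2. (K u * X * adj (K v)) $$ (i, i)) = (\<Sum>i<d1. (adj (K v) * (K u * X)) $$ (i, i))"
          by (rule sum_diag_mult_comm) (use K X in \<open>simp_all add: carrier_matD[OF K]\<close>)
        also have "adj (K v) * (K u * X) = adj (K v) * K u * X" using K[of u] K[of v] X by (simp add: mult_assoc_dim)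
        also have "\<dots> = 0\<^sub>m d1 d1" unfolding orth[OF uv(2,1) False[symmetric]] using X by simp
        finally show ?thesis using \<Gamma>[OF \<Phi>c uv] False by simp
      qed
      finally show "(\<Gamma> \<circ> \<Phi>) X $$ (u, v) = tr_tensor_id d2 r (A * X * adj A) $$ (u, v)" ..
    qed (auto simp: tr_tensor_id_def \<Gamma>_def)
  qed
  have "complementary d1 d2 r (\<Gamma> \<circ> \<Phi>) \<Phi>"
    unfolding complementary_def
  proof (intro conjI)
    show "cp_map d1 r (\<Gamma> \<circ> \<Phi>)" by (rule cp_map_compose[OF cp cp\<Gamma>])
    show "cp_map d1 d2 \<Phi>" by (rule cp)
    show "\<exists>A\<in>carrier_mat (d2 * r) d1. \<forall>X\<in>carrier_mat d1 d1.
      \<Phi> X = id_tensor_tr d2 r (A * X * adj A) \<and> (\<Gamma> \<circ> \<Phi>) X = tr_tensor_id d2 r (A * X * adj A)"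
      by (rule bexI[OF _ A], rule ballI, rule env)
  qed
  then show ?thesis unfolding degradable_def using cp\<Gamma> by metis
qed

theorem corollary4p12:
  fixes d1 d2 :: nat and \<Phi> :: "complex mat \<Rightarrow> complex mat"
  assumes "\<Phi> \<in> UCP d1 d2"
    and "Cstar_extreme d1 d2 \<Phi>"
  shows "degradable d1 d2 \<Phi>"
proof -
  obtain r K where K: "\<forall>k. K k \<in> carrier_mat d2 d1" "\<forall>X\<in>carrier_mat d1 d1. \<Phi> X = kraus d2 r K X"
    "\<forall>k<r. \<forall>m<r. k \<noteq> m \<longrightarrow> adj (K k) * K m = 0\<^sub>m d1 d1" "\<forall>k<r. K k * adj (K k) * K k = K k"
    using Cstar_extreme_orthogonal_kraus[OF assms(2)] by blast
  have cp: "cp_map d1 d2 \<Phi>" using assms(1) by (simp add: UCP_def)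
  show ?thesis
    by (rule orthogonal_kraus_degradable[OF cp K(1)[rule_format] K(2)[rule_format] K(3)[rule_format] K(4)[rule_format]])
qed

end
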